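(* Let $P\in\mathbb{C}[x,y]$ have no zeros in $\mathbb{H}^2$, satisfy $P(0,0)=0$, and have no common factors with $\bar P$. Let $[P]$, $L_1,\dots,L_M$, $q_1,\dots,q_M$ be as in the context, and $O_{jk}$ as in the context. Then for $\mathfrak{p}\in[1,\infty)$, $$\dim\bigl(\mathcal{I}^{\mathfrak{p}}_P/([P],\overline{[P]})\bigr)=\sum_{(j,k):\,j<k}O_{jk}+\sum_{k=1}^{M}\left(\left\lceil\frac{2L_k+1}{\mathfrak{p}}\right\rceil-1\right),$$ and $$\dim\bigl(\mathcal{I}^{\infty}_P/([P],\overline{[P]})\bigr)=\sum_{(j,k):\,j<k}O_{jk}.$$
   Context: $\mathbb{H}=\{z\in\mathbb{C}:\operatorname{Im} z>0\}$, $\mathbb{H}^2=\mathbb{H}\times\mathbb{H}$. For a polynomial or power series $P$, $\bar P(x,y)=\overline{P(\bar x,\bar y)}$. $\mathbb{C}\{x,y\}$ is the ring of convergent power series at $(0,0)$; $(F,G)$ denotes the ideal generated by $F,G$ there. $f\in L^{\mathfrak{p}}_{loc}$ means $f\in L^{\mathfrak{p}}(U)$ (Lebesgue measure) for some neighborhood $U$ of $(0,0)$ in $\mathbb{R}^2$ ($\mathfrak{p}\in[1,\infty]$); $\mathcal{I}^{\mathfrak{p}}_P=\{Q\in\mathbb{C}\{x,y\}:Q/P\in L^{\mathfrak{p}}_{loc}\}$. By a theorem of Bickel–Knese–Pascoe–Sola, for such $P$ vanishing to order $M$ at $(0,0)$ there exist $L_1,\dots,L_M\in\mathbb{N}$ and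 $q_1,\dots,q_M\in\mathbb{R}[x]$ with $q_j(0)=0$, $q_j'(0)>0$, $\deg q_j<2L_j$, such that $[P](x,y)=\prod_{j=1}^M(y+q_j(x)+ix^{2L_j})$ satisfies: $P/[P]$ and $[P]/P$ are bounded on a punctured neighborhood of $(0,0)$ in $\mathbb{R}^2$. $O_{ij}=\min\{\mathrm{Ord}(q_j-q_i),2L_j,2L_i\}$, where Ord is the order of vanishing at $0$. *)

theory Defs
  imports "HOL-Analysis.Analysis" "HOL-Computational_Algebra.Polynomial_Factorial"
begin

text \<open>Polynomials in C[x,y] are represented as \<open>complex poly poly\<close>:
  the outer variable is y, the inner (coefficient) variable is x.\<close>

definition eval2 :: "complex poly poly \<Rightarrow> complex \<Rightarrow> complex \<Rightarrow> complex" where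
  "eval2 P x y = poly (poly P [:y:]) x"

definition coeff2 :: "complex poly poly \<Rightarrow> nat \<Rightarrow> nat \<Rightarrow> complex" where
  "coeff2 P i j = coeff (coeff P j) i"

definition conj2 :: "complex poly poly \<Rightarrow> complex poly poly" where
  "conj2 P = map_poly (map_poly cnj) P"

definition vanishing_order :: "complex poly poly \<Rightarrow> nat" where
  "vanishing_order P = (LEAST d. \<exists>i j. i + j = d \<and> coeff2 P i j \<noteq> 0)"

definition conj_fun :: "(complex \<Rightarrow> complex \<Rightarrow> complex) \<Rightarrow> complex \<Rightarrow> complex \<Rightarrow> complex" where
  "conj_fun f x y = cnj (f (cnj x) (cnj y))"

text \<open>Functions given near (0,0) by an (absolutely) convergent double power series:
  these represent elements of C{x,y} (germs; everything below is invariant under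
  changing a function away from a neighbourhood of (0,0)).\<close>
definition conv_ps :: "(complex \<Rightarrow> complex \<Rightarrow> complex) \<Rightarrow> bool" where
  "conv_ps f \<longleftrightarrow> (\<exists>r>0. \<exists>a :: nat \<Rightarrow> nat \<Rightarrow> complex. \<forall>x y. norm x < r \<longrightarrow> norm y < r \<longrightarrow>
       ((\<lambda>(i, j). a i j * x ^ i * y ^ j) has_sum f x y) UNIV)"

definition germ_eq :: "(complex \<Rightarrow> complex \<Rightarrow> complex) \<Rightarrow> (complex \<Rightarrow> complex \<Rightarrow> complex) \<Rightarrow> bool" where
  "germ_eq f g \<longleftrightarrow> (\<forall>\<^sub>F z in nhds (0::complex, 0::complex). f (fst z) (snd z) = g (fst z) (snd z))"

definition ideal2 :: "(complex \<Rightarrow> complex \<Rightarrow> complex) \<Rightarrow> (complex \<Rightarrow> complex \<Rightarrow> complex)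
     \<Rightarrow> (complex \<Rightarrow> complex \<Rightarrow> complex) set" where
  "ideal2 F G = {Q. conv_ps Q \<and> (\<exists>A B. conv_ps A \<and> conv_ps B \<and>
       germ_eq Q (\<lambda>x y. A x y * F x y + B x y * G x y))}"

definition Lp_loc :: "real \<Rightarrow> (real \<times> real \<Rightarrow> complex) \<Rightarrow> bool" where
  "Lp_loc p f \<longleftrightarrow> (\<exists>U. open U \<and> (0, 0) \<in> U \<and> set_borel_measurable lborel U f \<and>
       (\<integral>\<^sup>+ z \<in> U. ennreal (norm (f z) powr p) \<partial>lborel) < \<infinity>)"

definition Linf_loc :: "(real \<times> real \<Rightarrow> complex) \<Rightarrow> bool" where
  "Linf_loc f \<longleftrightarrow> (\<exists>U. open U \<and> (0, 0) \<in> U \<and> set_borel_measurable lborel U f \<and>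
       (\<exists>C. AE z in lborel. z \<in> U \<longrightarrow> norm (f z) \<le> C))"

definition ratio_real :: "(complex \<Rightarrow> complex \<Rightarrow> complex) \<Rightarrow> (complex \<Rightarrow> complex \<Rightarrow> complex)
     \<Rightarrow> real \<times> real \<Rightarrow> complex" where
  "ratio_real Q P z = Q (of_real (fst z)) (of_real (snd z)) / P (of_real (fst z)) (of_real (snd z))"

definition Ip :: "real \<Rightarrow> (complex \<Rightarrow> complex \<Rightarrow> complex) \<Rightarrow> (complex \<Rightarrow> complex \<Rightarrow> complex) set" where
  "Ip p P = {Q. conv_ps Q \<and> Lp_loc p (ratio_real Q P)}"

definition Iinf :: "(complex \<Rightarrow> complex \<Rightarrow> complex) \<Rightarrow> (complex \<Rightarrow> complex \<Rightarrow> complex) set" where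
  "Iinf P = {Q. conv_ps Q \<and> Linf_loc (ratio_real Q P)}"

definition quot_dim_is :: "(complex \<Rightarrow> complex \<Rightarrow> complex) set \<Rightarrow> (complex \<Rightarrow> complex \<Rightarrow> complex) set
     \<Rightarrow> nat \<Rightarrow> bool" where
  "quot_dim_is I J n \<longleftrightarrow> (\<exists>B :: nat \<Rightarrow> complex \<Rightarrow> complex \<Rightarrow> complex.
      (\<forall>i<n. B i \<in> I) \<and>
      (\<forall>c :: nat \<Rightarrow> complex. (\<lambda>x y. \<Sum>i<n. c i * B i x y) \<in> J \<longrightarrow> (\<forall>i<n. c i = 0)) \<and>
      (\<forall>Q\<in>I. \<exists>c :: nat \<Rightarrow> complex. (\<lambda>x y. Q x y - (\<Sum>i<n. c i * B i x y)) \<in> J))"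

text \<open>Order of vanishing at 0 of a real polynomial (infinite for the zero polynomial),
  and O = min(Ord(q), a, b).\<close>
definition Omin :: "real poly \<Rightarrow> nat \<Rightarrow> nat \<Rightarrow> nat" where
  "Omin q a b = (if q = 0 then min a b else min (order 0 q) (min a b))"

definition bracketP :: "nat \<Rightarrow> (nat \<Rightarrow> nat) \<Rightarrow> (nat \<Rightarrow> real poly) \<Rightarrow> complex \<Rightarrow> complex \<Rightarrow> complex" where
  "bracketP M L q x y = (\<Prod>j=1..M. y + poly (map_poly complex_of_real (q j)) x + \<i> * x ^ (2 * L j))"

end

theory Submission
  imports Defs
begin

text \<open>
  Write \<open>l\<^sub>k = y + q\<^sub>k + i x\<^bsup>2 L\<^sub>k\<^esup>\<close>, so that \<open>[P] = \<Prod> l\<^sub>k\<close>. For any ordering of the factors, repeated division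
  by the \<open>l\<^sub>k\<close> writes each germ modulo \<open>([P], conj [P])\<close> uniquely as \<open>\<Sum> a\<^sub>k(x) \<Prod>\<^bsub>j<k\<^esub> l\<^sub>j\<close> with
  \<open>deg a\<^sub>k < D\<^sub>k = \<Sum>\<^sub>m O\<^sub>k\<^sub>m\<close>, because \<open>conj [P]\<close> restricted to the zero set of \<open>l\<^sub>k\<close> has order \<open>D\<^sub>k\<close> in \<open>x\<close>.
  Put \<open>m\<^sub>k = 2 L\<^sub>k + 1 - \<lceil>(2 L\<^sub>k + 1) / p\<rceil>\<close> (and \<open>m\<^sub>k = 2 L\<^sub>k\<close> for bounded quotients), the least \<open>m\<close> for which
  \<open>x\<^sup>m / l\<^sub>k\<close> is locally in \<open>L\<^sup>p\<close>, and \<open>N\<^sub>k = m\<^sub>k + \<Sum>\<^bsub>j>k\<^esub> O\<^sub>k\<^sub>j\<close>. If the quotient by \<open>[P]\<close> is in \<open>L\<^sup>p\<close>, then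
  integrating it over the strip \<open>y + q\<^sub>k = O(x\<^bsup>2 L\<^sub>k\<^esup>)\<close> and interpolating in \<open>y\<close> forces \<open>ord a\<^sub>k \<ge> N\<^sub>k\<close>, one factor
  after the other. Conversely, if the factors are ordered greedily, so that each \<open>N\<^sub>k\<close> is maximal among
  the remaining ones, then \<open>ord a\<^sub>k \<ge> N\<^sub>k\<close> suffices: where \<open>l\<^sub>j\<close> is the smallest factor, the others satisfy
  \<open>|l\<^sub>i| \<ge> c |x|\<^bsup>O\<^sub>i\<^sub>j\<^esup>\<close>. Hence the dimension is \<open>\<Sum> (D\<^sub>k - N\<^sub>k)\<close>, which does not depend on the ordering.
\<close>

text \<open>The threshold for \<open>m\<close> comes from scaling. With
  \<open>y + q k = x^(2 L k) * \<tau>\<close> the factor \<open>ell k\<close> becomes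
  \<open>x^(2 L k) * (\<tau> + \<i>)\<close>, so the p-th power of \<open>x^m / ell k\<close>,
  integrated over the strip, leaves \<open>x^(p (m - 2 L k) + 2 L k)\<close>, integrable at 0
  exactly when the exponent exceeds -1. The coefficient \<open>a k\<close> is visible on the branch
  \<open>y = phi k x\<close>, that is at \<open>\<tau> = -\<i>\<close>, which is not a real point.
  Interpolation carries the information there from real \<open>\<tau>\<close>; its constant is free
  of \<open>x\<close> because along a vertical line the normal form is a polynomial in
  \<open>\<tau>\<close> whose degree is bounded by the number of factors. In the converse direction
  a monomial over a product of branches must be integrable near each of these branches, so its
  exponent has to meet the largest of their demands; this is what greediness provides. Contact
  orders serve as lower and as upper bounds because \<open>q\<close> is real and the two imaginary
  terms of \<open>diffpoly\<close> have the same sign, so nothing cancels. For germs one weighted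
  l^1 norm suffices: in it substitution and division are explicit absolutely convergent
  series.\<close>

section \<open>Convergent power series\<close>

text \<open>\<open>has_psnorm a r c f\<close>: \<open>f\<close> has coefficients \<open>a\<close> and norm \<open>c\<close> in the Banach algebra of power series that
  converge absolutely on the closed polydisc of radius \<open>r\<close>.\<close>

definition has_psnorm :: "(nat \<times> nat \<Rightarrow> complex) \<Rightarrow> real \<Rightarrow> real \<Rightarrow> (complex \<Rightarrow> complex \<Rightarrow> complex) \<Rightarrow> bool" where
  "has_psnorm a r c f \<longleftrightarrow> ((\<lambda>e. norm (a e) * r ^ (fst e + snd e)) has_sum c) UNIV \<and>
     (\<forall>x y. norm x \<le> r \<longrightarrow> norm y \<le> r \<longrightarrow>
        ((\<lambda>e. a e * x ^ fst e * y ^ snd e) has_sum f x y) UNIV)"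

definition psnorm_le :: "real \<Rightarrow> real \<Rightarrow> (complex \<Rightarrow> complex \<Rightarrow> complex) \<Rightarrow> bool" where
  "psnorm_le r C f \<longleftrightarrow> (\<exists>a. \<exists>c\<le>C. has_psnorm a r c f)"

lemma psnorm_leI:
  assumes "((\<lambda>e. norm (a e) * r ^ (fst e + snd e)) has_sum c) UNIV" "c \<le> C"
    and "\<And>x y. norm x \<le> r \<Longrightarrow> norm y \<le> r \<Longrightarrow> ((\<lambda>e. a e * x ^ fst e * y ^ snd e) has_sum f x y) UNIV"
  shows "psnorm_le r C f"
  unfolding psnorm_le_def by (rule exI[of _ a], rule exI[of _ c]) (use assms in \<open>auto simp: has_psnorm_def\<close>)

lemma psnorm_leE:
  assumes "psnorm_le r C f"
  obtains a :: "nat \<times> nat \<Rightarrow> complex" and c where "c \<le> C"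
    and "((\<lambda>e. norm (a e) * r ^ (fst e + snd e)) has_sum c) UNIV"
    and "\<And>x y. norm x \<le> r \<Longrightarrow> norm y \<le> r \<Longrightarrow> ((\<lambda>e. a e * x ^ fst e * y ^ snd e) has_sum f x y) UNIV"
proof -
  from assms obtain a c where "c \<le> C" "has_psnorm a r c f" unfolding psnorm_le_def by blast
  then show thesis by (intro that[of c a]) (auto simp: has_psnorm_def)
qed

lemma monom_norm_le:
  fixes x y c :: complex
  assumes "norm x \<le> r" "norm y \<le> r"
  shows "norm (c * x ^ i * y ^ j) \<le> norm c * r ^ (i + j)"
proof -
  have "r \<ge> 0" using assms(1) norm_ge_zero order_trans by blast
  have "norm x ^ i * norm y ^ j \<le> r ^ i * r ^ j"
    using assms \<open>r \<ge> 0\<close> by (intro mult_mono power_mono) auto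
  from mult_left_mono[OF this, of "norm c"] show ?thesis
    by (simp add: norm_mult norm_power power_add mult.assoc)
qed

lemma psnorm_le_mono: "psnorm_le r C f \<Longrightarrow> C \<le> D \<Longrightarrow> psnorm_le r D f"
  by (auto simp: psnorm_le_def intro: order_trans)

lemma psnorm_le_nonneg:
  assumes "psnorm_le r C f" "r \<ge> 0"
  shows "C \<ge> 0"
proof -
  obtain a c where "c \<le> C"
    and c: "((\<lambda>e. norm (a e :: complex) * r ^ (fst e + snd e)) has_sum c) (UNIV :: (nat \<times> nat) set)"
    by (rule psnorm_leE[OF assms(1)])
  moreover have "c \<ge> 0" by (rule has_sum_nonneg[OF c]) (use assms(2) in auto)
  ultimately show ?thesis by linarith
qed

lemma psnorm_le_cong:
  assumes "psnorm_le r C f" "\<And>x y. norm x \<le> r \<Longrightarrow> norm y \<le> r \<Longrightarrow> f x y = g x y"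
  shows "psnorm_le r C g"
  using assms unfolding psnorm_le_def has_psnorm_def by fastforce

lemma psnorm_le_bound:
  assumes "psnorm_le r C f" "norm x \<le> r" "norm y \<le> r"
  shows "norm (f x y) \<le> C"
proof -
  obtain a c where c: "c \<le> C"
    and a: "((\<lambda>e. norm (a e :: complex) * r ^ (fst e + snd e)) has_sum c) (UNIV :: (nat \<times> nat) set)"
    and f': "\<And>x y. norm x \<le> r \<Longrightarrow> norm y \<le> r \<Longrightarrow> ((\<lambda>e. a e * x ^ fst e * y ^ snd e) has_sum f x y) UNIV"
    by (rule psnorm_leE[OF assms(1)]) blast
  note f = f'[OF assms(2,3)]
  have "norm (infsum (\<lambda>e. a e * x ^ fst e * y ^ snd e) UNIV) \<le> c"
    by (rule norm_infsum_le[OF has_sum_infsum]) (use f a monom_norm_le[OF assms(2,3)] in \<open>auto simp: has_sum_iff\<close>)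
  then show ?thesis using f c by (auto simp: has_sum_iff)
qed

text \<open>Completeness of the Banach algebra. The double family over \<open>k\<close> and the
  exponents \<open>e\<close> is absolutely summable, so Fubini lets it be summed coefficientwise or
  member by member with the same result. Products, the geometric series and substitution are all
  instances.\<close>

lemma psnorm_le_infsum:
  fixes F :: "'k \<Rightarrow> complex \<Rightarrow> complex \<Rightarrow> complex"
  assumes r: "r > 0" and F: "\<And>k. k \<in> K \<Longrightarrow> psnorm_le r (C k) (F k)" and C: "C summable_on K"
  shows "psnorm_le r (infsum C K) (\<lambda>x y. \<Sum>\<^sub>\<infinity>k\<in>K. F k x y)"
    and "norm x \<le> r \<Longrightarrow> norm y \<le> r \<Longrightarrow> (\<lambda>k. F k x y) summable_on K"
proof -
  from F have "\<forall>k\<in>K. \<exists>a c. c \<le> C k \<and> has_psnorm a r c (F k)" unfolding psnorm_le_def by blast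
  then obtain a c where "\<forall>k\<in>K. c k \<le> C k \<and> has_psnorm (a k) r (c k) (F k)" by metis
  then have ac: "\<And>k. k \<in> K \<Longrightarrow> c k \<le> C k"
    "\<And>k. k \<in> K \<Longrightarrow> ((\<lambda>e. norm (a k e) * r ^ (fst e + snd e)) has_sum c k) UNIV"
    "\<And>k x y. k \<in> K \<Longrightarrow> norm x \<le> r \<Longrightarrow> norm y \<le> r \<Longrightarrow>
        ((\<lambda>e. a k e * x ^ fst e * y ^ snd e) has_sum F k x y) UNIV"
    unfolding has_psnorm_def by auto
  have c0: "c k \<ge> 0" if "k \<in> K" for k
    by (rule has_sum_nonneg[OF ac(2)[OF that]]) (use r in auto)
  have cs: "c summable_on K"
    by (rule summable_on_comparison_test[OF C]) (use ac(1) c0 in auto)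
  define T where "T = (\<lambda>(k, e::nat\<times>nat). norm (a k e) * r ^ (fst e + snd e))"
  have T: "T summable_on (K \<times> UNIV)"
    unfolding T_def by (rule summable_on_SigmaI[OF _ cs]) (use ac(2) r in auto)
  obtain t where t: "(T has_sum t) (K \<times> UNIV)" using T by (auto simp: summable_on_def)
  have tc: "(c has_sum t) K"
    by (rule has_sum_SigmaD[OF t]) (use ac(2) in \<open>auto simp: T_def\<close>)
  have tC: "t \<le> infsum C K"
    using has_sum_mono[OF tc has_sum_infsum[OF C]] ac(1) by auto
  have T': "((\<lambda>(e,k). T (k,e)) has_sum t) (UNIV \<times> K)"
    using t by (subst (asm) has_sum_swap) auto
  have Te: "(\<lambda>k. T (k,e)) summable_on K" for e
    using summable_on_SigmaD1[of "\<lambda>e k. T (k,e)" UNIV "\<lambda>_. K" e] T' r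
    by (auto simp: summable_on_def T_def)
  have absak: "(\<lambda>k. norm (a k e)) summable_on K" for e
  proof -
    have "(\<lambda>k. T (k, e) * inverse (r ^ (fst e + snd e))) summable_on K"
      by (rule summable_on_cmult_left[OF Te])
    moreover have "T (k, e) * inverse (r ^ (fst e + snd e)) = norm (a k e)" for k
      using r by (simp add: T_def)
    ultimately show ?thesis by simp
  qed
  have ak: "(\<lambda>k. a k e) summable_on K" for e
    by (rule abs_summable_summable[OF absak])
  define b where "b = (\<lambda>e. \<Sum>\<^sub>\<infinity>k\<in>K. a k e)"
  define T2 where "T2 = (\<lambda>e. \<Sum>\<^sub>\<infinity>k\<in>K. T (k,e))"
  have T2: "(T2 has_sum t) UNIV"
    by (rule has_sum_SigmaD[OF T']) (use Te in \<open>auto simp: T2_def\<close>)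
  have bT: "norm (b e) * r ^ (fst e + snd e) \<le> T2 e" for e
  proof -
    have "norm (b e) \<le> (\<Sum>\<^sub>\<infinity>k\<in>K. norm (a k e))"
      unfolding b_def by (rule norm_infsum_bound[OF absak])
    then have "norm (b e) * r ^ (fst e + snd e) \<le> (\<Sum>\<^sub>\<infinity>k\<in>K. norm (a k e)) * r ^ (fst e + snd e)"
      using r by (intro mult_right_mono) auto
    also have "\<dots> = T2 e" unfolding T2_def T_def by (simp add: infsum_cmult_left')
    finally show ?thesis .
  qed
  have bs: "(\<lambda>e. norm (b e) * r ^ (fst e + snd e)) summable_on UNIV"
    by (rule summable_on_comparison_test[of T2]) (use bT T2 r in \<open>auto simp: summable_on_def\<close>)
  have bt: "infsum (\<lambda>e. norm (b e) * r ^ (fst e + snd e)) UNIV \<le> t"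
    using has_sum_mono[OF has_sum_infsum[OF bs] T2] bT by auto
  have main: "(\<lambda>k. F k x y) summable_on K \<and> ((\<lambda>e. b e * x ^ fst e * y ^ snd e) has_sum (\<Sum>\<^sub>\<infinity>k\<in>K. F k x y)) UNIV"
    if xy: "norm x \<le> r" "norm y \<le> r" for x y
  proof -
    define G where "G = (\<lambda>(k, e). a k e * x ^ fst e * y ^ snd e)"
    have "(\<lambda>z. norm (G z)) summable_on K \<times> UNIV"
      by (rule Infinite_Sum.abs_summable_on_comparison_test'[OF T])
         (use monom_norm_le[OF xy] in \<open>auto simp: G_def T_def\<close>)
    then have "G summable_on K \<times> UNIV" by (rule abs_summable_summable)
    then obtain s where s: "(G has_sum s) (K \<times> UNIV)" by (auto simp: summable_on_def)
    have 1: "((\<lambda>k. F k x y) has_sum s) K"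
      by (rule has_sum_SigmaD[OF s]) (use ac(3)[OF _ xy] in \<open>auto simp: G_def\<close>)
    have "((\<lambda>(e,k). G (k,e)) has_sum s) (UNIV \<times> K)"
      using s by (subst (asm) has_sum_swap) auto
    then have 2: "((\<lambda>e. b e * x ^ fst e * y ^ snd e) has_sum s) UNIV"
    proof (rule has_sum_SigmaD)
      fix e
      show "((\<lambda>k. case (e, k) of (e, k) \<Rightarrow> G (k, e)) has_sum b e * x ^ fst e * y ^ snd e) K"
        unfolding G_def b_def using has_sum_cmult_left[OF has_sum_infsum[OF ak[of e]], of "x ^ fst e * y ^ snd e"]
        by (simp add: mult.assoc)
    qed
    from 1 2 show ?thesis by (auto simp: has_sum_iff)
  qed
  show "psnorm_le r (infsum C K) (\<lambda>x y. \<Sum>\<^sub>\<infinity>k\<in>K. F k x y)"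
    by (rule psnorm_leI[OF has_sum_infsum[OF bs] order_trans[OF bt tC]]) (use main in auto)
  show "norm x \<le> r \<Longrightarrow> norm y \<le> r \<Longrightarrow> (\<lambda>k. F k x y) summable_on K"
    using main by blast
qed

lemma psnorm_le_sum:
  assumes "r > 0" "finite K" "\<And>k. k \<in> K \<Longrightarrow> psnorm_le r (C k) (F k)"
  shows "psnorm_le r (sum C K) (\<lambda>x y. \<Sum>k\<in>K. F k x y)"
  using psnorm_le_infsum(1)[of r K C F] assms by simp

lemma psnorm_le_add:
  assumes "r > 0" "psnorm_le r C f" "psnorm_le r D g"
  shows "psnorm_le r (C + D) (\<lambda>x y. f x y + g x y)"
  using psnorm_le_sum[of r "UNIV :: bool set" "\<lambda>b. if b then C else D" "\<lambda>b. if b then f else g"] assms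
  by (simp add: UNIV_bool add.commute)

lemma psnorm_le_monom_mult:
  assumes "psnorm_le r C f" "r > 0"
  shows "psnorm_le r (norm c * r ^ (i + j) * C) (\<lambda>x y. c * x ^ i * y ^ j * f x y)"
proof -
  obtain a t where t: "t \<le> C"
    and a: "((\<lambda>e. norm (a e :: complex) * r ^ (fst e + snd e)) has_sum t) (UNIV :: (nat \<times> nat) set)"
    and f: "\<And>x y. norm x \<le> r \<Longrightarrow> norm y \<le> r \<Longrightarrow> ((\<lambda>e. a e * x ^ fst e * y ^ snd e) has_sum f x y) UNIV"
    by (rule psnorm_leE[OF assms(1)]) blast
  define h where "h = (\<lambda>e::nat\<times>nat. (fst e + i, snd e + j))"
  have inj: "inj h" by (auto simp: h_def inj_on_def prod_eq_iff)
  define b where "b = (\<lambda>e. if e \<in> range h then c * a (inv h e) else 0)"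
  have bh: "b (h e) = c * a e" for e using inj by (simp add: b_def)
  have key: "(g has_sum s) UNIV" if "((\<lambda>e. g (h e)) has_sum s) UNIV" "\<And>e. e \<notin> range h \<Longrightarrow> g e = 0"
    for g :: "nat \<times> nat \<Rightarrow> 'z :: real_normed_vector" and s
  proof -
    have "(g has_sum s) (range h)" using that(1) inj by (subst has_sum_reindex) (auto simp: o_def)
    then show ?thesis by (rule has_sum_cong_neutral[THEN iffD1, rotated -1]) (use that(2) in auto)
  qed
  show ?thesis
  proof (rule psnorm_leI[of b r "norm c * r ^ (i + j) * t"])
    show "norm c * r ^ (i + j) * t \<le> norm c * r ^ (i + j) * C"
      using t assms(2) by (intro mult_left_mono) auto
    show "((\<lambda>e. norm (b e) * r ^ (fst e + snd e)) has_sum norm c * r ^ (i + j) * t) UNIV"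
    proof (rule key)
      show "((\<lambda>e. norm (b (h e)) * r ^ (fst (h e) + snd (h e))) has_sum norm c * r ^ (i + j) * t) UNIV"
        using has_sum_cmult_right[OF a, of "norm c * r ^ (i + j)"] unfolding bh
        by (simp add: h_def norm_mult power_add mult_ac)
    qed (auto simp: b_def)
    fix x y :: complex assume xy: "norm x \<le> r" "norm y \<le> r"
    show "((\<lambda>e. b e * x ^ fst e * y ^ snd e) has_sum c * x ^ i * y ^ j * f x y) UNIV"
    proof (rule key)
      show "((\<lambda>e. b (h e) * x ^ fst (h e) * y ^ snd (h e)) has_sum c * x ^ i * y ^ j * f x y) UNIV"
        using has_sum_cmult_right[OF f[OF xy], of "c * x ^ i * y ^ j"] unfolding bh
        by (simp add: h_def power_add mult_ac)
    qed (auto simp: b_def)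
  qed
qed

lemma psnorm_le_const:
  assumes "r > 0"
  shows "psnorm_le r (norm c) (\<lambda>x y. c)"
proof -
  have *: "(g has_sum g (0,0)) UNIV" if "\<And>e. e \<noteq> (0,0) \<Longrightarrow> g e = 0" for g :: "nat \<times> nat \<Rightarrow> 'z :: real_normed_vector"
    by (rule has_sum_finite_neutralI[of "{(0,0)}"]) (use that in auto)
  show ?thesis
  proof (rule psnorm_leI[of "\<lambda>e. if e = (0,0) then c else 0" r "norm c"])
    show "((\<lambda>e. norm (if e = (0, 0) then c else 0) * r ^ (fst e + snd e)) has_sum norm c) (UNIV :: (nat\<times>nat) set)"
      using *[of "\<lambda>e. norm (if e = (0, 0) then c else 0) * r ^ (fst e + snd e)"] by simp
    fix x y :: complex
    show "((\<lambda>e. (if e = (0, 0) then c else 0) * x ^ fst e * y ^ snd e) has_sum c) (UNIV :: (nat\<times>nat) set)"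
      using *[of "\<lambda>e. (if e = (0, 0) then c else 0) * x ^ fst e * y ^ snd e"] by simp
  qed simp
qed

lemma psnorm_le_monom:
  "r > 0 \<Longrightarrow> psnorm_le r (norm c * r ^ (i + j)) (\<lambda>x y. c * x ^ i * y ^ j)"
  using psnorm_le_monom_mult[OF psnorm_le_const[of r 1], of c i j] by simp

text \<open>No Cauchy product is formed: \<open>f * g\<close> is the sum of the monomial multiples
  \<open>a e * x^i * y^j * g\<close>, whose norms are summable.\<close>

lemma psnorm_le_mult:
  assumes r: "r > 0" and f: "psnorm_le r C f" and g: "psnorm_le r D g"
  shows "psnorm_le r (C * D) (\<lambda>x y. f x y * g x y)"
proof -
  obtain a t where t: "t \<le> C"
    and a: "((\<lambda>e. norm (a e :: complex) * r ^ (fst e + snd e)) has_sum t) (UNIV :: (nat \<times> nat) set)"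
    and f: "\<And>x y. norm x \<le> r \<Longrightarrow> norm y \<le> r \<Longrightarrow> ((\<lambda>e. a e * x ^ fst e * y ^ snd e) has_sum f x y) UNIV"
    by (rule psnorm_leE[OF f]) blast
  have s: "((\<lambda>e. norm (a e) * r ^ (fst e + snd e) * D) has_sum t * D) UNIV"
    using has_sum_cmult_left[OF a] .
  have "psnorm_le r (t * D) (\<lambda>x y. \<Sum>\<^sub>\<infinity>e. a e * x ^ fst e * y ^ snd e * g x y)"
    using psnorm_le_infsum(1)[OF r psnorm_le_monom_mult[OF g r] has_sum_imp_summable[OF s]] s by (simp add: has_sum_iff)
  then have "psnorm_le r (t * D) (\<lambda>x y. f x y * g x y)"
  proof (rule psnorm_le_cong)
    fix x y :: complex assume "norm x \<le> r" "norm y \<le> r"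
    from has_sum_cmult_left[OF f[OF this], of "g x y"]
    show "(\<Sum>\<^sub>\<infinity>e. a e * x ^ fst e * y ^ snd e * g x y) = f x y * g x y" by (simp add: has_sum_iff)
  qed
  then show ?thesis by (rule psnorm_le_mono) (use t psnorm_le_nonneg[OF g] r in \<open>auto intro: mult_right_mono\<close>)
qed

lemma psnorm_le_power:
  assumes "r > 0" "psnorm_le r C f"
  shows "psnorm_le r (C ^ n) (\<lambda>x y. f x y ^ n)"
proof (induction n)
  case 0 then show ?case using psnorm_le_const[OF assms(1), of 1] by simp
next
  case (Suc n) then show ?case using psnorm_le_mult[OF assms Suc] by simp
qed

text \<open>Second part: without a constant term every monomial has total degree at least 1 and
  gains at least one factor \<open>s / r\<close> when the radius shrinks.\<close>

lemma psnorm_le_smaller: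
  assumes f: "psnorm_le r C f" and s: "0 < s" "s \<le> r"
  shows "psnorm_le s C f"
    and "f 0 0 = 0 \<Longrightarrow> psnorm_le s (s / r * C) f"
proof -
  obtain a t where t: "t \<le> C"
    and a: "((\<lambda>e. norm (a e :: complex) * r ^ (fst e + snd e)) has_sum t) (UNIV :: (nat \<times> nat) set)"
    and f: "\<And>x y. norm x \<le> r \<Longrightarrow> norm y \<le> r \<Longrightarrow> ((\<lambda>e. a e * x ^ fst e * y ^ snd e) has_sum f x y) UNIV"
    by (rule psnorm_leE[OF f]) blast
  have le: "norm (a e) * s ^ (fst e + snd e) \<le> norm (a e) * r ^ (fst e + snd e)" for e
    using s by (intro mult_left_mono power_mono) auto
  have sm: "(\<lambda>e. norm (a e) * s ^ (fst e + snd e)) summable_on UNIV"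
    by (rule summable_on_comparison_test[OF has_sum_imp_summable[OF a]]) (use le s in auto)
  show "psnorm_le s C f"
  proof (rule psnorm_leI)
    show "((\<lambda>e. norm (a e) * s ^ (fst e + snd e)) has_sum (\<Sum>\<^sub>\<infinity>e. norm (a e) * s ^ (fst e + snd e))) UNIV"
      using sm by simp
    show "(\<Sum>\<^sub>\<infinity>e. norm (a e) * s ^ (fst e + snd e)) \<le> C"
      using has_sum_mono[OF has_sum_infsum[OF sm] a] le t by fastforce
    show "((\<lambda>e. a e * x ^ fst e * y ^ snd e) has_sum f x y) UNIV" if "norm x \<le> s" "norm y \<le> s" for x y
      using f that s by auto
  qed
  assume f0: "f 0 0 = 0"
  have "((\<lambda>e. a e * 0 ^ fst e * 0 ^ snd e) has_sum f 0 0) UNIV" using f[of 0 0] s by simp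
  \<comment> \<open>Since \<open>0 ^ 0 = 1\<close>, evaluation at the origin isolates the constant
    coefficient.\<close>
  moreover have "((\<lambda>e. a e * 0 ^ fst e * 0 ^ snd e) has_sum a (0,0)) UNIV"
    by (rule has_sum_finite_neutralI[of "{(0,0)}"]) (auto simp: power_0_left)
  ultimately have a0: "a (0,0) = 0" using f0 has_sum_unique by metis
  have le2: "norm (a e) * s ^ (fst e + snd e) \<le> s / r * (norm (a e) * r ^ (fst e + snd e))" for e
  proof (cases "fst e + snd e")
    case 0 then show ?thesis using a0 by (cases e) auto
  next
    case (Suc n)
    have "s ^ n \<le> r ^ n" using s by (intro power_mono) auto
    then have "norm (a e) * s * s ^ n \<le> norm (a e) * s * r ^ n" using s by (intro mult_left_mono) auto
    then show ?thesis using s unfolding Suc by (simp add: field_simps)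
  qed
  show "psnorm_le s (s / r * C) f"
  proof (rule psnorm_leI)
    show "((\<lambda>e. norm (a e) * s ^ (fst e + snd e)) has_sum (\<Sum>\<^sub>\<infinity>e. norm (a e) * s ^ (fst e + snd e))) UNIV"
      using sm by simp
    have "(\<Sum>\<^sub>\<infinity>e. norm (a e) * s ^ (fst e + snd e)) \<le> s / r * t"
      using has_sum_mono[OF has_sum_infsum[OF sm] has_sum_cmult_right[OF a, of "s / r"]] le2 by blast
    also have "\<dots> \<le> s / r * C" using t s by (intro mult_left_mono) auto
    finally show "(\<Sum>\<^sub>\<infinity>e. norm (a e) * s ^ (fst e + snd e)) \<le> s / r * C" .
    show "((\<lambda>e. a e * x ^ fst e * y ^ snd e) has_sum f x y) UNIV" if "norm x \<le> s" "norm y \<le> s" for x y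
      using f that s by auto
  qed
qed

lemma psnorm_le_continuous_on:
  assumes "psnorm_le r C f"
  shows "continuous_on (cball 0 r \<times> cball 0 r) (\<lambda>z. f (fst z) (snd z))"
proof -
  obtain a t where t: "t \<le> C"
    and a: "((\<lambda>e. norm (a e :: complex) * r ^ (fst e + snd e)) has_sum t) (UNIV :: (nat \<times> nat) set)"
    and f: "\<And>x y. norm x \<le> r \<Longrightarrow> norm y \<le> r \<Longrightarrow> ((\<lambda>e. a e * x ^ fst e * y ^ snd e) has_sum f x y) UNIV"
    by (rule psnorm_leE[OF assms]) blast
  have "uniform_limit (cball 0 r \<times> cball 0 r) (\<lambda>X z. \<Sum>e\<in>X. a e * fst z ^ fst e * snd z ^ snd e)
     (\<lambda>z. f (fst z) (snd z)) (finite_subsets_at_top UNIV)"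
    by (rule Weierstrass_m_test_general'[OF _ _ has_sum_imp_summable[OF a]])
       (use f monom_norm_le in auto)
  then show ?thesis
    by (rule uniform_limit_theorem[rotated])
       (auto intro!: always_eventually continuous_intros)
qed

section \<open>The ring of convergent germs\<close>

lemma conv_ps_iff_psnorm_le: "conv_ps f \<longleftrightarrow> (\<exists>r>0. \<exists>C. psnorm_le r C f)"
proof
  assume "conv_ps f"
  then obtain r a where r: "r > 0" and
    a: "\<And>x y. norm x < r \<Longrightarrow> norm y < r \<Longrightarrow> ((\<lambda>(i, j). a i j * x ^ i * y ^ j) has_sum f x y) UNIV"
    unfolding conv_ps_def by blast
  \<comment> \<open>Summable families of complex numbers are absolutely summable, so convergence at
    the single point \<open>(s, s)\<close> inside the polydisc already gives a finite norm of radius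
    \<open>s\<close>.\<close>
  define s where "s = r / 2"
  have s: "s > 0" "s < r" using r by (auto simp: s_def)
  define c where "c = (\<lambda>e. a (fst e) (snd e))"
  have c: "((\<lambda>e. c e * x ^ fst e * y ^ snd e) has_sum f x y) UNIV" if "norm x < r" "norm y < r" for x y
    using a[OF that] by (simp add: c_def case_prod_unfold)
  have "(\<lambda>e. c e * of_real s ^ fst e * of_real s ^ snd e) summable_on UNIV"
    using c[of "of_real s" "of_real s"] s by (auto simp: has_sum_iff)
  then have "(\<lambda>e. norm (c e * of_real s ^ fst e * of_real s ^ snd e)) summable_on UNIV"
    by (subst (asm) summable_on_iff_abs_summable_on_complex)
  then have "(\<lambda>e. norm (c e) * s ^ (fst e + snd e)) summable_on UNIV"
    using s by (simp add: norm_mult norm_power power_add mult.assoc)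
  then obtain t where "((\<lambda>e. norm (c e) * s ^ (fst e + snd e)) has_sum t) UNIV" by (auto simp: summable_on_def)
  then have "psnorm_le s t f" by (rule psnorm_leI) (use c s in auto)
  then show "\<exists>r>0. \<exists>C. psnorm_le r C f" using s by blast
next
  assume "\<exists>r>0. \<exists>C. psnorm_le r C f"
  then obtain r C where r: "r > 0" and "psnorm_le r C f" by blast
  then obtain a where
    a: "\<And>x y. norm x \<le> r \<Longrightarrow> norm y \<le> r \<Longrightarrow> ((\<lambda>e. a e * x ^ fst e * y ^ snd e) has_sum f x y) UNIV"
    using psnorm_leE by blast
  show "conv_ps f" unfolding conv_ps_def
    using a r by (intro exI[of _ r] conjI exI[of _ "\<lambda>i j. a (i, j)"]) (auto simp: case_prod_unfold)
qed

lemma psnorm_le_imp_conv_ps: "r > 0 \<Longrightarrow> psnorm_le r C f \<Longrightarrow> conv_ps f"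
  using conv_ps_iff_psnorm_le by blast

lemma conv_ps_common_radius:
  assumes "conv_ps f" "conv_ps g"
  obtains r C D where "r > 0" "psnorm_le r C f" "psnorm_le r D g"
proof -
  from assms obtain r s C D where *: "r > 0" "psnorm_le r C f" "s > 0" "psnorm_le s D g"
    unfolding conv_ps_iff_psnorm_le by blast
  show ?thesis
    by (rule that[of "min r s" C D])
       (use * psnorm_le_smaller(1)[of r C f "min r s"] psnorm_le_smaller(1)[of s D g "min r s"] in auto)
qed

lemma conv_ps_const: "conv_ps (\<lambda>x y. c)"
  using psnorm_le_const[of 1 c] psnorm_le_imp_conv_ps[of 1] by simp

lemma conv_ps_fst: "conv_ps (\<lambda>x y. x)"
  using psnorm_le_monom[of 1 1 1 0] psnorm_le_imp_conv_ps[of 1] by simp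

lemma conv_ps_snd: "conv_ps (\<lambda>x y. y)"
  using psnorm_le_monom[of 1 1 0 1] psnorm_le_imp_conv_ps[of 1] by simp

lemma conv_ps_add:
  assumes "conv_ps f" "conv_ps g"
  shows "conv_ps (\<lambda>x y. f x y + g x y)"
  by (rule conv_ps_common_radius[OF assms]) (rule psnorm_le_imp_conv_ps[OF _ psnorm_le_add])

lemma conv_ps_mult:
  assumes "conv_ps f" "conv_ps g"
  shows "conv_ps (\<lambda>x y. f x y * g x y)"
  by (rule conv_ps_common_radius[OF assms]) (rule psnorm_le_imp_conv_ps[OF _ psnorm_le_mult])

lemma conv_ps_diff:
  assumes "conv_ps f" "conv_ps g"
  shows "conv_ps (\<lambda>x y. f x y - g x y)"
  using conv_ps_add[OF assms(1) conv_ps_mult[OF conv_ps_const[of "-1"] assms(2)]] by simp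

lemma conv_ps_sum:
  assumes "finite K" "\<And>k. k \<in> K \<Longrightarrow> conv_ps (F k)"
  shows "conv_ps (\<lambda>x y. \<Sum>k\<in>K. F k x y)"
  using assms
proof (induction K rule: finite_induct)
  case empty
  then show ?case using conv_ps_const[of 0] by simp
next
  case (insert k K)
  then show ?case using conv_ps_add[of "F k" "\<lambda>x y. \<Sum>k\<in>K. F k x y"] by simp
qed

lemma conv_ps_prod:
  assumes "finite K" "\<And>k. k \<in> K \<Longrightarrow> conv_ps (F k)"
  shows "conv_ps (\<lambda>x y. \<Prod>k\<in>K. F k x y)"
  using assms
proof (induction K rule: finite_induct)
  case empty
  then show ?case using conv_ps_const[of 1] by simp
next
  case (insert k K)
  then show ?case using conv_ps_mult[of "F k" "\<lambda>x y. \<Prod>k\<in>K. F k x y"] by simp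
qed

lemma conv_ps_power: "conv_ps f \<Longrightarrow> conv_ps (\<lambda>x y. f x y ^ n)"
  using conv_ps_prod[of "{..<n}" "\<lambda>_. f"] by simp

lemma conv_ps_poly: "conv_ps f \<Longrightarrow> conv_ps (\<lambda>x y. poly t (f x y))"
  unfolding poly_altdef by (intro conv_ps_sum conv_ps_mult conv_ps_const conv_ps_power) auto

lemmas conv_ps_intros = conv_ps_const conv_ps_fst conv_ps_snd conv_ps_add conv_ps_mult conv_ps_diff
  conv_ps_sum conv_ps_prod conv_ps_power conv_ps_poly

lemma conv_ps_swap:
  assumes "conv_ps f"
  shows "conv_ps (\<lambda>x y. f y x)"
proof -
  from assms obtain r a where r: "r > 0" and
    a: "\<And>x y. norm x < r \<Longrightarrow> norm y < r \<Longrightarrow> ((\<lambda>(i, j). a i j * x ^ i * y ^ j) has_sum f x y) UNIV"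
    unfolding conv_ps_def by blast
  show ?thesis unfolding conv_ps_def
  proof (intro exI[of _ r] conjI exI[of _ "\<lambda>i j. a j i"] allI impI)
    fix x y :: complex assume "norm x < r" "norm y < r"
    then have "((\<lambda>(i, j). a i j * y ^ i * x ^ j) has_sum f y x) (UNIV \<times> UNIV)" using a by simp
    then have "((\<lambda>(i, j). (\<lambda>(i, j). a i j * y ^ i * x ^ j) (j, i)) has_sum f y x) (UNIV \<times> UNIV)"
      by (subst (asm) has_sum_swap)
    then show "((\<lambda>(i, j). a j i * x ^ i * y ^ j) has_sum f y x) UNIV" by (simp add: mult_ac)
  qed (rule r)
qed

text \<open>This makes geometric series and substitutions converge: a germ vanishing at the origin
  has arbitrarily small norm on small polydiscs.\<close>

lemma conv_ps_vanishing_small: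
  assumes "conv_ps f" "f 0 0 = 0" "\<epsilon> > 0" "r > 0"
  obtains s where "0 < s" "s \<le> r" "psnorm_le s \<epsilon> f"
proof -
  from assms(1) obtain r' C where r: "r' > 0" "psnorm_le r' C f" unfolding conv_ps_iff_psnorm_le by blast
  have C: "C \<ge> 0" using psnorm_le_nonneg[OF r(2)] r(1) by simp
  \<comment> \<open>The summand 1 in \<open>C + 1\<close> keeps the denominator positive when
    \<open>C = 0\<close>.\<close>
  define s where "s = min (min r r') (r' * \<epsilon> / (C + 1))"
  have s: "s > 0" "s \<le> r'" "s \<le> r" using r C assms by (auto simp: s_def)
  have "s \<le> r' * \<epsilon> / (C + 1)" by (simp add: s_def)
  then have "s * (C + 1) \<le> r' * \<epsilon>" using C by (simp add: field_simps)
  then have "s * C \<le> r' * \<epsilon>" using s by (simp add: distrib_left)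
  then have "s / r' * C \<le> \<epsilon>" using r by (simp add: field_simps)
  then show ?thesis using psnorm_le_mono[OF psnorm_le_smaller(2)[OF r(2) s(1,2) assms(2)]] s that by blast
qed

text \<open>Geometric series in \<open>w = 1 - u / u(0,0)\<close>, which vanishes at the origin and
  hence has norm at most 1/2 on a small polydisc.\<close>

lemma conv_ps_inverse:
  assumes "conv_ps u" "u 0 0 \<noteq> 0"
  shows "conv_ps (\<lambda>x y. inverse (u x y))"
proof -
  define w where "w = (\<lambda>x y. 1 - inverse (u 0 0) * u x y)"
  have "conv_ps w" unfolding w_def by (intro conv_ps_intros assms)
  moreover have "w 0 0 = 0" using assms(2) by (simp add: w_def)
  ultimately obtain s where s: "0 < s" "psnorm_le s (1/2) w"
    using conv_ps_vanishing_small[of w "1/2" 1] by auto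
  have geo: "(\<lambda>n. (1/2 :: real) ^ n) summable_on UNIV"
    by (simp add: summable_on_UNIV_nonneg_real_iff)
  have "psnorm_le s (infsum (\<lambda>n. (1/2) ^ n) UNIV) (\<lambda>x y. \<Sum>\<^sub>\<infinity>n. w x y ^ n)"
    by (rule psnorm_le_infsum(1)[OF s(1) psnorm_le_power[OF s] geo])
  then have "psnorm_le s (infsum (\<lambda>n. (1/2) ^ n) UNIV) (\<lambda>x y. u 0 0 * inverse (u x y))"
  proof (rule psnorm_le_cong)
    fix x y :: complex assume xy: "norm x \<le> s" "norm y \<le> s"
    have w: "norm (w x y) < 1" using psnorm_le_bound[OF s(2) xy] by linarith
    have "(\<lambda>n. w x y ^ n) summable_on UNIV"
      by (rule psnorm_le_infsum(2)[OF s(1) psnorm_le_power[OF s] geo xy])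
    then have "(\<lambda>n. w x y ^ n) sums (\<Sum>\<^sub>\<infinity>n. w x y ^ n)"
      by (intro has_sum_imp_sums has_sum_infsum)
    moreover have "(\<lambda>n. w x y ^ n) sums (1 / (1 - w x y))" using w by (rule geometric_sums)
    ultimately show "(\<Sum>\<^sub>\<infinity>n. w x y ^ n) = u 0 0 * inverse (u x y)"
      using assms(2) sums_unique2 by (fastforce simp: w_def field_simps)
  qed
  then have "conv_ps (\<lambda>x y. u 0 0 * inverse (u x y))" by (rule psnorm_le_imp_conv_ps[OF s(1)])
  then have "conv_ps (\<lambda>x y. inverse (u 0 0) * (u 0 0 * inverse (u x y)))"
    by (rule conv_ps_mult[OF conv_ps_const])
  then show ?thesis using assms(2) by (simp add: mult.assoc[symmetric])
qed

section \<open>Germ equality, division by \<open>y - \<phi>\<close> and Taylor expansion\<close>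

lemma germ_eq_iff:
  "germ_eq f g \<longleftrightarrow> (\<exists>r>0. \<forall>x y. norm x < r \<longrightarrow> norm y < r \<longrightarrow> f x y = g x y)"
proof
  assume "germ_eq f g"
  then obtain e where e: "e > 0" "\<And>z. dist z (0::complex,0::complex) < e \<Longrightarrow> f (fst z) (snd z) = g (fst z) (snd z)"
    unfolding germ_eq_def eventually_nhds_metric by blast
  show "\<exists>r>0. \<forall>x y. norm x < r \<longrightarrow> norm y < r \<longrightarrow> f x y = g x y"
  proof (intro exI[of _ "e/2"] conjI allI impI)
    fix x y :: complex assume "norm x < e / 2" "norm y < e / 2"
    moreover have "norm (x, y) \<le> norm x + norm y" by (rule norm_Pair_le)
    ultimately have "dist (x, y) (0, 0) < e" by (simp add: dist_norm)
    then show "f x y = g x y" using e(2)[of "(x,y)"] by simp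
  qed (use e in auto)
next
  assume "\<exists>r>0. \<forall>x y. norm x < r \<longrightarrow> norm y < r \<longrightarrow> f x y = g x y"
  then obtain r where r: "r > 0" "\<And>x y. norm x < r \<Longrightarrow> norm y < r \<Longrightarrow> f x y = g x y" by blast
  have "f (fst z) (snd z) = g (fst z) (snd z)" if "dist z (0, 0) < r" for z
  proof (rule r(2))
    have "norm z < r" using that by (simp add: dist_norm zero_prod_def[symmetric])
    moreover have "norm (fst z) \<le> norm z" "norm (snd z) \<le> norm z"
      using norm_fst_le[of "fst z" "snd z"] norm_snd_le[of "snd z" "fst z"] by simp_all
    ultimately show "norm (fst z) < r" "norm (snd z) < r" by linarith+
  qed
  then show "germ_eq f g" unfolding germ_eq_def eventually_nhds_metric using r(1) by blast
qed

text \<open>Division with remainder by a divisor of degree one in \<open>y\<close>. The quotient is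
  explicit: each \<open>y^j - \<phi>^j\<close> is divisible by \<open>y - \<phi>\<close>, and the
  termwise quotients are summable once \<open>\<phi>\<close> is small.\<close>

lemma conv_ps_subst_divide:
  assumes Q: "conv_ps Q" and phi: "conv_ps \<phi>" "\<phi> 0 0 = 0"
  shows "conv_ps (\<lambda>x y. Q x (\<phi> x y))"
    and "\<exists>Q1. conv_ps Q1 \<and> germ_eq Q (\<lambda>x y. Q x (\<phi> x y) + (y - \<phi> x y) * Q1 x y)"
proof -
  from Q obtain r C where r: "r > 0" "psnorm_le r C Q" unfolding conv_ps_iff_psnorm_le by blast
  obtain a t where
    a: "((\<lambda>e. norm (a e :: complex) * r ^ (fst e + snd e)) has_sum t) (UNIV :: (nat \<times> nat) set)"
    and f: "\<And>x y. norm x \<le> r \<Longrightarrow> norm y \<le> r \<Longrightarrow> ((\<lambda>e. a e * x ^ fst e * y ^ snd e) has_sum Q x y) UNIV"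
    by (rule psnorm_leE[OF r(2)]) blast
  have "r / 2 > 0" using r by simp
  from conv_ps_vanishing_small[OF phi this this] obtain s where s: "0 < s" "s \<le> r/2" "psnorm_le s (r/2) \<phi>" by blast
  define F where "F = (\<lambda>e x y. a e * x ^ fst e * \<phi> x y ^ snd e)"
  have psbF: "psnorm_le s (norm (a e) * r ^ (fst e + snd e)) (F e)" for e
  proof -
    have "psnorm_le s (norm (a e) * s ^ fst e * (r / 2) ^ snd e) (F e)"
      using psnorm_le_monom_mult[OF psnorm_le_power[OF s(1,3)] s(1), of "a e" "fst e" 0 "snd e"] by (simp add: F_def)
    moreover have "norm (a e) * s ^ fst e * (r / 2) ^ snd e \<le> norm (a e) * r ^ fst e * r ^ snd e"
      using s r by (intro mult_mono power_mono) auto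
    ultimately show ?thesis by (auto intro: psnorm_le_mono simp: power_add mult.assoc)
  qed
  have Fsum: "(\<Sum>\<^sub>\<infinity>e. F e x y) = Q x (\<phi> x y)" if "norm x \<le> s" "norm y \<le> s" for x y
  proof -
    have "norm (\<phi> x y) \<le> r" using psnorm_le_bound[OF s(3) that] r by simp
    then show ?thesis using f[of x "\<phi> x y"] that s by (auto simp: F_def has_sum_iff)
  qed
  have "psnorm_le s (infsum (\<lambda>e. norm (a e) * r ^ (fst e + snd e)) UNIV) (\<lambda>x y. Q x (\<phi> x y))"
    by (rule psnorm_le_cong[OF psnorm_le_infsum(1)[OF s(1) psbF has_sum_imp_summable[OF a]]]) (use Fsum in auto)
  then show "conv_ps (\<lambda>x y. Q x (\<phi> x y))" using s(1) psnorm_le_imp_conv_ps by blast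
  \<comment> \<open>The quotient of \<open>a e * x^i * (y^j - \<phi>^j)\<close> by
    \<open>y - \<phi>\<close>, written as a sum so that it also makes sense on the zero set of the
    divisor.\<close>
  define G where "G = (\<lambda>e x y. a e * x ^ fst e * (\<Sum>m<snd e. y ^ m * \<phi> x y ^ (snd e - Suc m)))"
  have psbG: "psnorm_le s (norm (a e) * r ^ (fst e + snd e) * (2 / r)) (G e)" for e
  proof -
    let ?j = "snd e"
    have "psnorm_le s (\<Sum>m<?j. s ^ m * (r/2) ^ (?j - Suc m)) (\<lambda>x y. \<Sum>m<?j. y ^ m * \<phi> x y ^ (?j - Suc m))"
      using psnorm_le_monom_mult[OF psnorm_le_power[OF s(1,3)] s(1), of 1 0]
      by (intro psnorm_le_sum) (use s in auto)
    from psnorm_le_monom_mult[OF this s(1), of "a e" "fst e" 0]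
    have "psnorm_le s (norm (a e) * s ^ fst e * (\<Sum>m<?j. s ^ m * (r/2) ^ (?j - Suc m))) (G e)"
      by (simp add: G_def)
    moreover have "(\<Sum>m<?j. s ^ m * (r/2) ^ (?j - Suc m)) \<le> r ^ ?j * (2 / r)"
    proof (cases ?j)
      case 0 then show ?thesis using r by simp
    next
      case (Suc n)
      have "(\<Sum>m<?j. s ^ m * (r/2) ^ (?j - Suc m)) \<le> (\<Sum>m<?j. (r/2) ^ n)"
      proof (rule sum_mono)
        fix m assume m: "m \<in> {..<?j}"
        have "s ^ m * (r/2) ^ (?j - Suc m) \<le> (r/2) ^ m * (r/2) ^ (?j - Suc m)"
          using s by (intro mult_right_mono power_mono) auto
        also have "\<dots> = (r/2) ^ n" using m Suc by (auto simp: power_add[symmetric])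
        finally show "s ^ m * (r/2) ^ (?j - Suc m) \<le> (r/2) ^ n" .
      qed
      also have "\<dots> = (real n + 1) * (r / 2) ^ n" using Suc by simp
      also have "\<dots> \<le> 2 ^ Suc n * (r / 2) ^ n"
      proof (rule mult_right_mono)
        have "n + 1 < 2 ^ (n + 1)" by (rule less_exp)
        then have "real (n + 1) < real (2 ^ (n + 1))" by linarith
        then show "real n + 1 \<le> 2 ^ Suc n" by simp
      qed (use r in auto)
      also have "\<dots> = r ^ ?j * (2 / r)" using r Suc by (simp add: power_divide)
      finally show ?thesis .
    qed
    then have "norm (a e) * s ^ fst e * (\<Sum>m<?j. s ^ m * (r/2) ^ (?j - Suc m)) \<le> norm (a e) * r ^ fst e * (r ^ ?j * (2 / r))"
      using s r by (intro mult_mono power_mono sum_nonneg) auto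
    ultimately show ?thesis by (auto intro: psnorm_le_mono simp: power_add mult.assoc)
  qed
  note Gs = summable_on_cmult_left[OF has_sum_imp_summable[OF a], of "2 / r"]
  define Q1 where "Q1 = (\<lambda>x y. \<Sum>\<^sub>\<infinity>e. G e x y)"
  have "conv_ps Q1" unfolding Q1_def using psnorm_le_infsum(1)[OF s(1) psbG Gs] psnorm_le_imp_conv_ps s(1) by blast
  moreover have "germ_eq Q (\<lambda>x y. Q x (\<phi> x y) + (y - \<phi> x y) * Q1 x y)"
    unfolding germ_eq_iff
  proof (intro exI[of _ s] conjI allI impI)
    fix x y :: complex assume "norm x < s" "norm y < s"
    then have xy: "norm x \<le> s" "norm y \<le> s" by auto
    have "norm (\<phi> x y) \<le> r" using psnorm_le_bound[OF s(3) xy] r by simp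
    then have 1: "((\<lambda>e. F e x y) has_sum Q x (\<phi> x y)) UNIV" using f[of x "\<phi> x y"] xy s by (auto simp: F_def)
    have "((\<lambda>e. G e x y) has_sum Q1 x y) UNIV"
      unfolding Q1_def by (intro has_sum_infsum psnorm_le_infsum(2)[OF s(1) psbG Gs xy])
    from has_sum_add[OF 1 has_sum_cmult_right[OF this, of "y - \<phi> x y"]]
    have "((\<lambda>e. F e x y + (y - \<phi> x y) * G e x y) has_sum Q x (\<phi> x y) + (y - \<phi> x y) * Q1 x y) UNIV" .
    moreover have "F e x y + (y - \<phi> x y) * G e x y = a e * x ^ fst e * y ^ snd e" for e
    proof -
      have "(y - \<phi> x y) * (\<Sum>m<snd e. y ^ m * \<phi> x y ^ (snd e - Suc m)) = y ^ snd e - \<phi> x y ^ snd e"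
        using power_diff_sumr2[of y "snd e" "\<phi> x y"] by (simp add: mult_ac)
      then have "(y - \<phi> x y) * G e x y = a e * x ^ fst e * (y ^ snd e - \<phi> x y ^ snd e)"
        unfolding G_def by (metis (no_types) mult.assoc mult.commute)
      then show ?thesis by (simp add: F_def algebra_simps)
    qed
    ultimately have "((\<lambda>e. a e * x ^ fst e * y ^ snd e) has_sum Q x (\<phi> x y) + (y - \<phi> x y) * Q1 x y) UNIV"
      by simp
    moreover have "((\<lambda>e. a e * x ^ fst e * y ^ snd e) has_sum Q x y) UNIV"
      using f xy s by auto
    ultimately show "Q x y = Q x (\<phi> x y) + (y - \<phi> x y) * Q1 x y" using has_sum_unique by blast
  qed (rule s(1))
  ultimately show "\<exists>Q1. conv_ps Q1 \<and> germ_eq Q (\<lambda>x y. Q x (\<phi> x y) + (y - \<phi> x y) * Q1 x y)" by blast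
qed

text \<open>Each induction step removes the value at the origin and one factor \<open>x\<close>.
  Exchanging the variables turns the division by \<open>y - 0\<close> into a division by
  \<open>x\<close>. Only the values of \<open>b\<close> on the axis \<open>y = 0\<close>
  matter.\<close>

lemma conv_ps_taylor_fst:
  assumes "conv_ps Q"
  shows "\<exists>(a :: complex poly) b. conv_ps b \<and> (\<forall>i\<ge>D. coeff a i = 0) \<and>
    (\<exists>r>0. \<forall>x. norm x < r \<longrightarrow> Q x 0 = poly a x + x ^ D * b x 0)"
  using assms
proof (induction D arbitrary: Q)
  case 0
  then show ?case by (intro exI[of _ "0 :: complex poly"] exI[of _ Q]) (auto intro: exI[of _ 1])
next
  case (Suc D)
  obtain Q1 where Q1: "conv_ps Q1" "germ_eq (\<lambda>x y. Q y x) (\<lambda>x y. Q 0 x + (y - 0) * Q1 x y)"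
    using conv_ps_subst_divide(2)[OF conv_ps_swap[OF Suc.prems] conv_ps_const[of 0]] by auto
  from Q1(2) obtain r where r: "r > 0" "\<And>x y. norm x < r \<Longrightarrow> norm y < r \<Longrightarrow> Q y x = Q 0 x + y * Q1 x y"
    unfolding germ_eq_iff by auto
  from Suc.IH[OF conv_ps_swap[OF Q1(1)]] obtain a b r' where
    ab: "conv_ps b" "\<forall>i\<ge>D. coeff a i = 0" "r' > 0" "\<And>x. norm x < r' \<Longrightarrow> Q1 0 x = poly a x + x ^ D * b x 0"
    by blast
  show ?case
  proof (intro exI[of _ "pCons (Q 0 0) a"] exI[of _ b] conjI exI[of _ "min r r'"] allI impI)
    fix i assume "Suc D \<le> i" then show "coeff (pCons (Q 0 0) a) i = 0" using ab(2) by (cases i) auto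
  next
    fix x :: complex assume "norm x < min r r'"
    then show "Q x 0 = poly (pCons (Q 0 0) a) x + x ^ Suc D * b x 0"
      using r(2)[of 0 x] r(1) ab(4)[of x] by (simp add: algebra_simps)
  qed (use ab r in auto)
qed

section \<open>Division by the branches\<close>

lemma isCont_eventually_nhds:
  fixes h :: "'a::t2_space \<Rightarrow> 'b::topological_space"
  assumes "isCont h z" "eventually P (nhds (h z))"
  shows "eventually (\<lambda>w. P (h w)) (nhds z)"
proof -
  have "(h \<longlongrightarrow> h z) (nhds z)" using assms(1) by (simp add: isCont_def tendsto_at_iff_tendsto_nhds)
  then show ?thesis using assms(2) by (simp add: filterlim_iff)
qed

lemma germ_eq_compose:
  assumes "germ_eq f g" "isCont \<phi> (0::complex)" "\<phi> 0 = 0"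
  shows "germ_eq (\<lambda>x y. f x (\<phi> x)) (\<lambda>x y. g x (\<phi> x))"
proof -
  have "isCont (\<lambda>z :: complex \<times> complex. \<phi> (fst z)) (0, 0)"
    by (rule isCont_o2[where g = \<phi> and f = fst]) (use assms(2) in \<open>auto intro!: continuous_intros\<close>)
  then have "isCont (\<lambda>z :: complex \<times> complex. (fst z, \<phi> (fst z))) (0, 0)"
    by (intro continuous_intros)
  from isCont_eventually_nhds[OF this, of "\<lambda>z. f (fst z) (snd z) = g (fst z) (snd z)"] show ?thesis
    using assms(1,3) unfolding germ_eq_def by simp
qed

lemma conv_ps_taylor_germ:
  assumes "conv_ps Q"
  shows "\<exists>(a :: complex poly) b. conv_ps b \<and> (\<forall>i\<ge>D. coeff a i = 0) \<and>
    germ_eq (\<lambda>x y. Q x 0) (\<lambda>x y. poly a x + x ^ D * b x y)"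
proof -
  obtain a b r where ab: "conv_ps b" "\<forall>i\<ge>D. coeff a i = 0" "r > 0"
    "\<And>x. norm x < r \<Longrightarrow> Q x 0 = poly a x + x ^ D * b x 0"
    using conv_ps_taylor_fst[OF assms] by blast
  have "conv_ps (\<lambda>x y. b x 0)" using conv_ps_subst_divide(1)[OF ab(1) conv_ps_const[of 0]] by simp
  moreover have "germ_eq (\<lambda>x y. Q x 0) (\<lambda>x y. poly a x + x ^ D * b x 0)"
    unfolding germ_eq_iff using ab by blast
  ultimately show ?thesis using ab(2) by blast
qed

lemma continuous_zero_extend:
  fixes h :: "complex \<Rightarrow> complex"
  assumes "isCont h z" "eventually (\<lambda>w. h w = 0) (at z)"
  shows "h z = 0"
proof -
  have "(h \<longlongrightarrow> 0) (at z)" using assms(2) by (rule tendsto_eventually)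
  moreover have "(h \<longlongrightarrow> h z) (at z)" using assms(1) by (simp add: isCont_def)
  ultimately show ?thesis using tendsto_unique[OF at_neq_bot] by metis
qed

text \<open>Used to cancel a factor \<open>y - \<phi> x\<close> or a power of \<open>x\<close>. By
  continuity the identity extends first in \<open>y\<close> across the curve, for \<open>x\<close>
  nonzero, and then in \<open>x\<close> to the axis \<open>x = 0\<close>.\<close>

lemma conv_ps_germ_eq_off_curve:
  assumes "conv_ps f" "conv_ps g"
    and ev: "eventually (\<lambda>z. fst z \<noteq> 0 \<longrightarrow> snd z \<noteq> \<phi> (fst z) \<longrightarrow> f (fst z) (snd z) = g (fst z) (snd z)) (nhds (0::complex,0::complex))"
  shows "germ_eq f g"
proof -
  define h where "h = (\<lambda>x y. f x y - g x y)"
  have "conv_ps h" unfolding h_def by (intro conv_ps_intros assms)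
  then obtain r C where r: "r > 0" "psnorm_le r C h" unfolding conv_ps_iff_psnorm_le by blast
  have "continuous_on (ball 0 r \<times> ball 0 r) (\<lambda>z. h (fst z) (snd z))"
    by (rule continuous_on_subset[OF psnorm_le_continuous_on[OF r(2)]]) auto
  then have cont: "isCont (\<lambda>z. h (fst z) (snd z)) (x, y)" if "norm x < r" "norm y < r" for x y
    using that by (subst (asm) continuous_on_eq_continuous_at) (auto simp: open_Times)
  have cy: "isCont (\<lambda>y. h x y) y" and cx: "isCont (\<lambda>x. h x y) x" if "norm x < r" "norm y < r" for x y
    using isCont_o2[of y "\<lambda>y. (x, y)" "\<lambda>z. h (fst z) (snd z)"] isCont_o2[of x "\<lambda>x. (x, y)" "\<lambda>z. h (fst z) (snd z)"]
      cont[OF that] by (auto intro: continuous_intros)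
  have "germ_eq (\<lambda>x y. if x \<noteq> 0 \<and> y \<noteq> \<phi> x then h x y else 0) (\<lambda>x y. 0)"
    unfolding germ_eq_def using ev by eventually_elim (auto simp: h_def)
  then obtain s where s: "s > 0" "\<And>x y. norm x < s \<Longrightarrow> norm y < s \<Longrightarrow> x \<noteq> 0 \<Longrightarrow> y \<noteq> \<phi> x \<Longrightarrow> h x y = 0"
    unfolding germ_eq_iff by (metis (full_types))
  define t where "t = min r s"
  have t: "t > 0" "t \<le> r" "t \<le> s" using r s by (auto simp: t_def)
  have near: "eventually (\<lambda>w. norm w < t) (at z)" if "norm z < t" for z :: complex
  proof -
    have "open (ball (0::complex) t)" by simp
    then have "eventually (\<lambda>w. w \<in> ball 0 t) (at z)" by (rule eventually_at_in_open') (use that in simp)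
    then show ?thesis by simp
  qed
  have 1: "h x y = 0" if "x \<noteq> 0" "norm x < t" "norm y < t" for x y
  proof (rule continuous_zero_extend[where h = "\<lambda>y. h x y"])
    show "isCont (\<lambda>y. h x y) y" using cy that t by auto
    have "eventually (\<lambda>w. w \<noteq> \<phi> x) (at y)"
    proof (cases "y = \<phi> x")
      case True then show ?thesis by (simp add: eventually_neq_at_within)
    next
      case False then show ?thesis using tendsto_imp_eventually_ne[OF tendsto_ident_at] by blast
    qed
    with near[OF that(3)] show "eventually (\<lambda>w. h x w = 0) (at y)"
      by eventually_elim (use s(2) that t in auto)
  qed
  have 2: "h x y = 0" if "norm x < t" "norm y < t" for x y
  proof (cases "x = 0")
    case True
    have "eventually (\<lambda>w :: complex. w \<noteq> 0) (at 0)" by (rule eventually_neq_at_within)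
    moreover have "eventually (\<lambda>w :: complex. norm w < t) (at 0)" using near[of 0] t by simp
    ultimately have "eventually (\<lambda>w. h w y = 0) (at 0)"
      by eventually_elim (use 1 that in auto)
    then show ?thesis using continuous_zero_extend[where h = "\<lambda>x. h x y" and z = x] cx[of x y] that t True by auto
  qed (use 1 that in auto)
  show ?thesis unfolding germ_eq_iff using 2 t(1) by (intro exI[of _ t]) (auto simp: h_def)
qed

lemma poly_factor_monom:
  fixes p :: "'a::field poly"
  assumes "\<And>i. i < n \<Longrightarrow> coeff p i = 0" "coeff p n \<noteq> 0"
  obtains u where "p = monom 1 n * u" "poly u 0 \<noteq> 0"
proof -
  have "monom 1 n dvd p" using assms(1) by (simp add: monom_1_dvd_iff')
  then obtain u where u: "p = monom 1 n * u" by (elim dvdE)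
  then have "coeff u 0 = coeff p n" by (simp add: coeff_monom_mult)
  then show ?thesis using that u assms(2) by (simp add: poly_0_coeff_0)
qed

lemma poly_factor_monom_ex:
  fixes p :: "'a::field poly"
  assumes "p \<noteq> 0"
  obtains n u where "p = monom 1 n * u" "poly u 0 \<noteq> 0" "coeff p n \<noteq> 0"
proof -
  have ex: "\<exists>n. coeff p n \<noteq> 0" using assms by (simp add: poly_eq_iff)
  define n where "n = (LEAST n. coeff p n \<noteq> 0)"
  have n: "coeff p n \<noteq> 0" unfolding n_def using ex by (rule LeastI_ex)
  have "\<And>i. i < n \<Longrightarrow> coeff p i = 0" unfolding n_def using not_less_Least by blast
  from poly_factor_monom[OF this n] show ?thesis using that n by metis
qed

text \<open>If \<open>a\<close> had exact order \<open>n < D\<close>, then after division by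
  \<open>x^n\<close> its nonzero leading part would be bounded by a positive power of
  \<open>x\<close>.\<close>

lemma poly_low_degree_eq_0:
  fixes a :: "complex poly"
  assumes deg: "\<forall>i\<ge>D. coeff a i = 0"
    and ev: "eventually (\<lambda>x. norm (poly a x) \<le> C * norm x ^ D) (at 0)"
  shows "a = 0"
proof (rule ccontr)
  assume "a \<noteq> 0"
  then obtain n u where u: "a = monom 1 n * u" "poly u 0 \<noteq> 0" "coeff a n \<noteq> 0"
    by (rule poly_factor_monom_ex)
  have nD: "n < D" using deg u(3) by (meson not_le)
  have "eventually (\<lambda>x. norm (poly u x) \<le> C * norm x ^ (D - n)) (at 0)"
    using ev eventually_neq_at_within[of "0::complex" 0 UNIV]
  proof eventually_elim
    case (elim x)
    have "norm x ^ n * norm (poly u x) \<le> C * norm x ^ D"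
      using elim(1) by (simp add: u(1) poly_monom norm_mult norm_power)
    also have "\<dots> = norm x ^ n * (C * norm x ^ (D - n))"
      using nD by (simp add: power_add[symmetric] mult.left_commute)
    finally show ?case using elim(2) by simp
  qed
  moreover have "((\<lambda>x::complex. C * norm x ^ (D - n)) \<longlongrightarrow> C * norm (0::complex) ^ (D - n)) (at 0)"
    by (intro tendsto_intros)
  moreover have "((\<lambda>x. norm (poly u x)) \<longlongrightarrow> norm (poly u 0)) (at 0)"
    by (intro tendsto_intros)
  ultimately have "norm (poly u 0) \<le> C * norm (0::complex) ^ (D - n)"
    using tendsto_le[OF at_neq_bot] by fastforce
  then show False using u(2) nD by (simp add: power_0_left split: if_splits)
qed

section \<open>Branches, their conjugates and their contact orders\<close>

locale branches =
  fixes A :: "nat set" and L :: "nat \<Rightarrow> nat" and q :: "nat \<Rightarrow> real poly"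
  assumes finite_A: "finite A"
    and L_pos: "k \<in> A \<Longrightarrow> L k > 0"
    and q_0: "k \<in> A \<Longrightarrow> poly (q k) 0 = 0"
begin

definition qc :: "nat \<Rightarrow> complex poly" where
  "qc k = map_poly complex_of_real (q k)"

definition ell :: "nat \<Rightarrow> complex \<Rightarrow> complex \<Rightarrow> complex" where
  "ell k x y = y + poly (qc k) x + \<i> * x ^ (2 * L k)"

definition ell_bar :: "nat \<Rightarrow> complex \<Rightarrow> complex \<Rightarrow> complex" where
  "ell_bar k x y = y + poly (qc k) x - \<i> * x ^ (2 * L k)"

text \<open>The zero set of \<open>ell k\<close> is the graph of this function, which passes through
  the origin but leaves the real plane at real \<open>x \<noteq> 0\<close>.\<close>

definition phi :: "nat \<Rightarrow> complex \<Rightarrow> complex" where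
  "phi k x = - poly (qc k) x - \<i> * x ^ (2 * L k)"

text \<open>The number \<open>O\<^sub>j\<^sub>k\<close> of the paper.\<close>

definition contact :: "nat \<Rightarrow> nat \<Rightarrow> nat" where
  "contact j k = Omin (q k - q j) (2 * L j) (2 * L k)"

text \<open>The number \<open>D\<^sub>k\<close> of the overview. The diagonal term is included and
  equals \<open>2 * L k\<close>.\<close>

definition total_contact :: "nat \<Rightarrow> nat" where
  "total_contact k = (\<Sum>m\<in>A. contact k m)"

text \<open>The conjugate of [P]. It is a product over the set, whereas [P] is kept as a product
  over a list: division splits off the factors of [P] one at a time but always keeps
  \<open>G\<close> whole.\<close>

definition G :: "complex \<Rightarrow> complex \<Rightarrow> complex" where
  "G x y = (\<Prod>m\<in>A. ell_bar m x y)"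

definition ell_prod :: "nat list \<Rightarrow> complex \<Rightarrow> complex \<Rightarrow> complex" where
  "ell_prod ks x y = (\<Prod>k\<leftarrow>ks. ell k x y)"

lemma ell_prod_simps [simp]:
  "ell_prod [] x y = 1" "ell_prod (k # ks) x y = ell k x y * ell_prod ks x y"
  by (simp_all add: ell_prod_def)

text \<open>The sum of the \<open>a k x * ell_prod js x y\<close>, where \<open>js\<close> are the indices preceding \<open>k\<close> in the list.\<close>

primrec horner :: "nat list \<Rightarrow> (nat \<Rightarrow> complex poly) \<Rightarrow> complex \<Rightarrow> complex \<Rightarrow> complex" where
  "horner [] a x y = 0"
| "horner (k # ks) a x y = poly (a k) x + ell k x y * horner ks a x y"

text \<open>The restriction of \<open>ell_bar m\<close> to the branch \<open>y = phi k x\<close>;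
  equally the difference \<open>ell_bar m - ell k\<close>, in which \<open>y\<close>
  cancels.\<close>

definition diffpoly :: "nat \<Rightarrow> nat \<Rightarrow> complex poly" where
  "diffpoly k m = qc m - qc k - monom \<i> (2 * L k) - monom \<i> (2 * L m)"

lemma coeff_qc: "coeff (qc k) i = of_real (coeff (q k) i)"
  by (simp add: qc_def coeff_map_poly)

lemma poly_qc_of_real: "poly (qc k) (of_real x) = of_real (poly (q k) x)"
proof -
  have "poly (map_poly complex_of_real p) (of_real x) = of_real (poly p x)" for p
    by (induction p) (auto simp: map_poly_pCons)
  then show ?thesis by (simp add: qc_def)
qed

lemma contact_commute: "contact j k = contact k j"
proof -
  have "order 0 (q k - q j) = order 0 (q j - q k)"
    using order_uminus[of 0 "q j - q k"] by simp
  then show ?thesis by (auto simp: contact_def Omin_def)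
qed

lemma contact_self: "contact k k = 2 * L k"
  by (simp add: contact_def Omin_def)

lemma contact_le: "contact j k \<le> 2 * L j" "contact j k \<le> 2 * L k"
  by (auto simp: contact_def Omin_def)

lemma phi_0: "k \<in> A \<Longrightarrow> phi k 0 = 0"
  using q_0[of k] L_pos[of k] poly_qc_of_real[of k 0] by (simp add: phi_def)

lemma ell_phi: "ell k x y = y - phi k x"
  by (simp add: ell_def phi_def)

lemma ell_bar_phi: "ell_bar m x (phi k x) = poly (diffpoly k m) x"
  by (simp add: ell_bar_def phi_def diffpoly_def poly_monom)

text \<open>The contact order is the exact order of vanishing: \<open>q m - q k\<close> contributes
  real coefficients and both other terms contribute \<open>-\<i>\<close>, so no cancellation occurs,
  not even when \<open>L k = L m\<close>.\<close>

lemma diffpoly_factor: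
  assumes "k \<in> A" "m \<in> A"
  obtains u where "diffpoly k m = monom 1 (contact k m) * u" "poly u 0 \<noteq> 0"
proof -
  define d where "d = q m - q k"
  let ?n = "contact k m"
  have co: "coeff (diffpoly k m) i = of_real (coeff d i) - (if i = 2 * L k then \<i> else 0) - (if i = 2 * L m then \<i> else 0)" for i
    by (simp add: diffpoly_def coeff_qc d_def)
  have low: "coeff d i = 0" if "i < ?n" for i
  proof (cases "d = 0")
    case False
    have "monom 1 ?n dvd d" using False by (simp add: monom_1_dvd_iff contact_def Omin_def d_def)
    then show ?thesis using that by (simp add: monom_1_dvd_iff')
  qed auto
  \<comment> \<open>If the minimum is attained by neither \<open>2 * L k\<close> nor
    \<open>2 * L m\<close>, it is the order of \<open>d\<close>, and then the coefficient of
    \<open>d\<close> there is nonzero.\<close>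
  have top: "coeff d ?n \<noteq> 0 \<or> ?n = 2 * L k \<or> ?n = 2 * L m"
  proof (rule ccontr)
    assume neg: "\<not> ?thesis"
    then have "d \<noteq> 0" "?n = order 0 d" by (auto simp: contact_def Omin_def d_def min_def split: if_splits)
    moreover have "monom 1 (Suc ?n) dvd d" using neg low by (auto simp: monom_1_dvd_iff' less_Suc_eq)
    ultimately show False by (simp add: monom_1_dvd_iff)
  qed
  show ?thesis
  proof (rule poly_factor_monom[of ?n "diffpoly k m"])
    show "coeff (diffpoly k m) i = 0" if "i < ?n" for i
      using low[OF that] that contact_le[of k m] by (auto simp: co)
    show "coeff (diffpoly k m) ?n \<noteq> 0"
      using top by (auto simp: co complex_eq_iff)
  qed (rule that)
qed

lemma G_phi_factor:
  assumes "k \<in> A"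
  obtains u where "\<And>x. G x (phi k x) = x ^ total_contact k * poly u x" "poly u 0 \<noteq> 0"
proof -
  have "\<forall>m\<in>A. \<exists>u. diffpoly k m = monom 1 (contact k m) * u \<and> poly u 0 \<noteq> 0"
    using diffpoly_factor[OF assms] by metis
  then obtain u where u: "\<forall>m\<in>A. diffpoly k m = monom 1 (contact k m) * u m \<and> poly (u m) 0 \<noteq> 0"
    by metis
  show ?thesis
  proof (rule that[of "\<Prod>m\<in>A. u m"])
    fix x
    have "G x (phi k x) = (\<Prod>m\<in>A. x ^ contact k m * poly (u m) x)"
      unfolding G_def ell_bar_phi by (rule prod.cong) (use u in \<open>auto simp: poly_monom\<close>)
    then show "G x (phi k x) = x ^ total_contact k * poly (\<Prod>m\<in>A. u m) x"
      by (simp add: prod.distrib poly_prod total_contact_def power_sum)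
  next
    show "poly (\<Prod>m\<in>A. u m) 0 \<noteq> 0" using u finite_A by (simp add: poly_prod)
  qed
qed

lemma conv_ps_ell: "conv_ps (ell k)"
proof -
  have "conv_ps (\<lambda>x y. y + poly (qc k) x + \<i> * x ^ (2 * L k))" by (intro conv_ps_intros)
  moreover have "ell k = (\<lambda>x y. y + poly (qc k) x + \<i> * x ^ (2 * L k))" by (simp add: fun_eq_iff ell_def)
  ultimately show ?thesis by simp
qed

lemma conv_ps_ell_bar: "conv_ps (ell_bar k)"
proof -
  have "conv_ps (\<lambda>x y. y + poly (qc k) x - \<i> * x ^ (2 * L k))" by (intro conv_ps_intros)
  moreover have "ell_bar k = (\<lambda>x y. y + poly (qc k) x - \<i> * x ^ (2 * L k))" by (simp add: fun_eq_iff ell_bar_def)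
  ultimately show ?thesis by simp
qed

lemma conv_ps_phi: "conv_ps (\<lambda>x y. phi k x)"
proof -
  have "conv_ps (\<lambda>x y. 0 - poly (qc k) x - \<i> * x ^ (2 * L k))" by (intro conv_ps_intros)
  then show ?thesis by (simp add: phi_def)
qed

lemma conv_ps_G: "conv_ps G"
proof -
  have "conv_ps (\<lambda>x y. \<Prod>m\<in>A. ell_bar m x y)" by (intro conv_ps_prod finite_A conv_ps_ell_bar)
  moreover have "G = (\<lambda>x y. \<Prod>m\<in>A. ell_bar m x y)" by (simp add: fun_eq_iff G_def)
  ultimately show ?thesis by simp
qed

lemma conv_ps_ell_prod: "conv_ps (ell_prod ks)"
proof (induction ks)
  case Nil then show ?case using conv_ps_const[of 1] by (simp add: fun_eq_iff ell_prod_def)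
next
  case (Cons k ks)
  have "ell_prod (k # ks) = (\<lambda>x y. ell k x y * ell_prod ks x y)" by (simp add: fun_eq_iff)
  then show ?case using conv_ps_mult[OF conv_ps_ell Cons] by simp
qed

lemma conv_ps_horner: "conv_ps (horner ks a)"
proof (induction ks)
  case Nil
  have "horner [] a = (\<lambda>x y. 0)" by (simp add: fun_eq_iff)
  then show ?case using conv_ps_const[of 0] by simp
next
  case (Cons k ks)
  have "horner (k # ks) a = (\<lambda>x y. poly (a k) x + ell k x y * horner ks a x y)" by (simp add: fun_eq_iff)
  then show ?case using conv_ps_add[OF conv_ps_poly[OF conv_ps_fst] conv_ps_mult[OF conv_ps_ell Cons]] by simp
qed

lemma isCont_phi: "isCont (phi k) x"
  unfolding phi_def[abs_def] by (intro continuous_intros)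

section \<open>Existence and uniqueness of normal forms modulo the ideal\<close>

lemma horner_cong: "(\<And>k. k \<in> set ks \<Longrightarrow> a k = b k) \<Longrightarrow> horner ks a = horner ks b"
  by (induction ks) (auto simp: fun_eq_iff)

lemma horner_zero: "(\<And>k. k \<in> set ks \<Longrightarrow> a k = 0) \<Longrightarrow> horner ks a x y = 0"
  by (induction ks) auto

lemma horner_diff: "horner ks (\<lambda>k. a k - b k) x y = horner ks a x y - horner ks b x y"
proof (induction ks)
  case (Cons k ks)
  then show ?case by (simp only: horner.simps poly_diff right_diff_distrib) (simp add: algebra_simps)
qed simp

lemma horner_sum: "horner ks (\<lambda>k. \<Sum>i\<in>E. smult (c i) (\<alpha> i k)) x y = (\<Sum>i\<in>E. c i * horner ks (\<alpha> i) x y)"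
proof (induction ks)
  case (Cons k ks)
  then show ?case
    by (simp add: poly_sum sum.distrib distrib_left sum_distrib_left mult.left_commute)
qed auto

lemma horner_phi: "horner (k # ks) a x (phi k x) = poly (a k) x"
  by (simp add: ell_phi)

text \<open>Restricting \<open>Q\<close> to the first branch leaves a power series in
  \<open>x\<close>. Its part of order at least \<open>D\<^sub>k\<close> is a multiple of the
  restriction of \<open>G\<close>, so it can be traded for a multiple of \<open>G\<close> plus a
  multiple of \<open>ell k\<close>; everything divisible by \<open>ell k\<close> is passed on to the
  remaining factors.\<close>

lemma horner_span:
  assumes "set ks \<subseteq> A" "distinct ks" "conv_ps Q"
  shows "\<exists>a U V. conv_ps U \<and> conv_ps V \<and> (\<forall>k. \<forall>i\<ge>total_contact k. coeff (a k) i = 0) \<and>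
    germ_eq Q (\<lambda>x y. horner ks a x y + U x y * ell_prod ks x y + V x y * G x y)"
  using assms
proof (induction ks arbitrary: Q)
  case Nil
  show ?case
    by (intro exI[of _ "\<lambda>_. 0"] exI[of _ Q] exI[of _ "\<lambda>x y. 0"])
       (auto simp: Nil conv_ps_const germ_eq_def)
next
  case (Cons k ks)
  then have k: "k \<in> A" by simp
  note ph = conv_ps_phi[of k] phi_0[OF k]
  obtain Q1 where Q1: "conv_ps Q1" "germ_eq Q (\<lambda>x y. Q x (phi k x) + (y - phi k x) * Q1 x y)"
    using conv_ps_subst_divide(2)[OF Cons.prems(3) ph] by blast
  obtain G1 where G1: "conv_ps G1" "germ_eq G (\<lambda>x y. G x (phi k x) + (y - phi k x) * G1 x y)"
    using conv_ps_subst_divide(2)[OF conv_ps_G ph] by blast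
  obtain u where u: "\<And>x. G x (phi k x) = x ^ total_contact k * poly u x" "poly u 0 \<noteq> 0"
    using G_phi_factor[OF k] by metis
  obtain p b where b: "conv_ps b" "\<forall>i\<ge>total_contact k. coeff p i = 0"
    "germ_eq (\<lambda>x y. Q x (phi k x)) (\<lambda>x y. poly p x + x ^ total_contact k * b x y)"
    using conv_ps_taylor_germ[OF conv_ps_subst_divide(1)[OF Cons.prems(3) ph]] by blast
  have cinv: "conv_ps (\<lambda>x y. inverse (poly u x))"
    by (rule conv_ps_inverse) (use u in \<open>auto intro: conv_ps_poly conv_ps_fst\<close>)
  \<comment> \<open>On the branch \<open>x^D * b = v * G\<close>, since \<open>G\<close> restricts
    to \<open>x^D * u\<close> with a unit \<open>u\<close>. Hence \<open>Q - p - v * G\<close> is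
    divisible by \<open>ell k\<close>, and the quotient is \<open>R\<close>.\<close>
  define v where "v = (\<lambda>x y. b x y * inverse (poly u x))"
  have v: "conv_ps v" unfolding v_def by (intro conv_ps_mult b cinv)
  define R where "R = (\<lambda>x y. Q1 x y - v x y * G1 x y)"
  have "conv_ps R" unfolding R_def by (intro conv_ps_intros Q1 G1 v)
  then obtain a U V where IH: "conv_ps U" "conv_ps V" "\<forall>k. \<forall>i\<ge>total_contact k. coeff (a k) i = 0"
    "germ_eq R (\<lambda>x y. horner ks a x y + U x y * ell_prod ks x y + V x y * G x y)"
    using Cons.IH[of R] Cons.prems by auto
  have "isCont (\<lambda>z :: complex \<times> complex. poly u (fst z)) (0,0)" by (intro continuous_intros)
  from isCont_eventually_nhds[OF this, of "\<lambda>w. w \<noteq> 0"]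
  have evu: "eventually (\<lambda>z. poly u (fst z) \<noteq> 0) (nhds (0::complex,0::complex))"
    using u(2) t1_space_nhds[of "poly u 0" 0] by simp
  define a' where "a' = a(k := p)"
  have horner': "horner ks a' = horner ks a" by (rule horner_cong) (use Cons.prems in \<open>auto simp: a'_def\<close>)
  show ?case
  proof (intro exI conjI)
    show "conv_ps U" by (rule IH)
    show "conv_ps (\<lambda>x y. ell k x y * V x y + v x y)" by (intro conv_ps_intros conv_ps_ell IH v)
    show "\<forall>k. \<forall>i\<ge>total_contact k. coeff (a' k) i = 0" using IH(3) b(2) by (auto simp: a'_def)
    show "germ_eq Q (\<lambda>x y. horner (k # ks) a' x y + U x y * ell_prod (k # ks) x y + (ell k x y * V x y + v x y) * G x y)"
      using Q1(2) G1(2) b(3) IH(4) evu unfolding germ_eq_def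
    proof eventually_elim
      case (elim z)
      define x y where "x = fst z" and "y = snd z"
      have 1: "Q x y = Q x (phi k x) + ell k x y * Q1 x y" using elim(1) by (simp add: x_def y_def ell_phi)
      have 2: "x ^ total_contact k * poly u x = G x y - ell k x y * G1 x y" using elim(2) u(1)[of x] by (simp add: x_def y_def ell_phi)
      have 3: "Q x (phi k x) = poly p x + x ^ total_contact k * b x y" using elim(3) by (simp add: x_def y_def)
      have 4: "Q1 x y = v x y * G1 x y + (horner ks a x y + U x y * ell_prod ks x y + V x y * G x y)"
        using elim(4) unfolding R_def x_def[symmetric] y_def[symmetric] by (simp add: algebra_simps)
      have "x ^ total_contact k * b x y = (x ^ total_contact k * poly u x) * v x y"
        using elim(5) by (simp add: v_def x_def)
      then have 5: "x ^ total_contact k * b x y = (G x y - ell k x y * G1 x y) * v x y" unfolding 2 .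
      show ?case unfolding x_def[symmetric] y_def[symmetric] 1 3 5 4 horner.simps horner' ell_prod_simps
        by (simp add: a'_def algebra_simps)
    qed
  qed
qed

text \<open>On the branch of the head only \<open>a k\<close> survives on the left and only the
  multiple of \<open>G\<close> on the right, so \<open>a k\<close> is \<open>O(x^D)\<close> and its
  degree bound forces it to vanish. Then \<open>V\<close> vanishes on the branch and
  \<open>ell k\<close> cancels from the whole relation, with a new \<open>V\<close>.\<close>

lemma horner_indep:
  assumes "set ks \<subseteq> A" "distinct ks" "\<And>k i. k \<in> set ks \<Longrightarrow> total_contact k \<le> i \<Longrightarrow> coeff (a k) i = 0"
    and "conv_ps U" "conv_ps V"
    and "germ_eq (horner ks a) (\<lambda>x y. U x y * ell_prod ks x y + V x y * G x y)"
  shows "\<forall>k\<in>set ks. a k = 0"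
  using assms
proof (induction ks arbitrary: V)
  case (Cons k ks)
  then have k: "k \<in> A" by simp
  note ph = conv_ps_phi[of k] phi_0[OF k]
  obtain u where u: "\<And>x. G x (phi k x) = x ^ total_contact k * poly u x" "poly u 0 \<noteq> 0"
    using G_phi_factor[OF k] by metis
  obtain V1 where V1: "conv_ps V1" "germ_eq V (\<lambda>x y. V x (phi k x) + (y - phi k x) * V1 x y)"
    using conv_ps_subst_divide(2)[OF Cons.prems(5) ph] by blast
  have "germ_eq (\<lambda>x y. horner (k # ks) a x (phi k x)) (\<lambda>x y. U x (phi k x) * ell_prod (k # ks) x (phi k x) + V x (phi k x) * G x (phi k x))"
    by (rule germ_eq_compose[OF Cons.prems(6) isCont_phi ph(2)])
  then have ev: "germ_eq (\<lambda>x y. poly (a k) x) (\<lambda>x y. x ^ total_contact k * (poly u x * V x (phi k x)))"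
    unfolding horner_phi u by (simp add: ell_phi mult_ac)
  then obtain r1 where r1: "r1 > 0" "\<And>x. norm x < r1 \<Longrightarrow> poly (a k) x = x ^ total_contact k * (poly u x * V x (phi k x))"
    unfolding germ_eq_iff by (metis norm_zero)
  have "conv_ps (\<lambda>x y. poly u x * V x (phi k x))"
    by (rule conv_ps_mult[OF conv_ps_poly[OF conv_ps_fst] conv_ps_subst_divide(1)[OF Cons.prems(5) ph]])
  then obtain r2 C where r2: "r2 > 0" "psnorm_le r2 C (\<lambda>x y. poly u x * V x (phi k x))" unfolding conv_ps_iff_psnorm_le by blast
  have "eventually (\<lambda>x. x \<in> ball 0 (min r1 r2)) (at (0::complex))"
    by (rule eventually_at_in_open') (use r1 r2 in auto)
  then have "eventually (\<lambda>x. norm (poly (a k) x) \<le> C * norm x ^ total_contact k) (at 0)"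
  proof eventually_elim
    case (elim x)
    then have "norm (poly u x * V x (phi k x)) \<le> C" using psnorm_le_bound[OF r2(2), of x 0] r2(1) by simp
    then have "norm x ^ total_contact k * norm (poly u x * V x (phi k x)) \<le> norm x ^ total_contact k * C"
      by (rule mult_left_mono) simp
    then show ?case using r1(2)[of x] elim by (simp add: norm_mult norm_power mult.commute)
  qed
  then have ak: "a k = 0" by (rule poly_low_degree_eq_0[rotated]) (use Cons.prems(3) in auto)
  have "isCont (\<lambda>z :: complex \<times> complex. poly u (fst z)) (0,0)" by (intro continuous_intros)
  from isCont_eventually_nhds[OF this, of "\<lambda>w. w \<noteq> 0"]
  have evu: "eventually (\<lambda>z. poly u (fst z) \<noteq> 0) (nhds (0::complex,0::complex))"
    using u(2) t1_space_nhds[of "poly u 0" 0] by simp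
  \<comment> \<open>\<open>V = ell k * V1\<close> follows from \<open>V x (phi k x) = 0\<close>.
    That equation is obtained by cancelling \<open>x^D\<close>, and afterwards \<open>ell k\<close>
    is cancelled, whence the exclusion of both the axis and the branch.\<close>
  have "germ_eq (horner ks a) (\<lambda>x y. U x y * ell_prod ks x y + V1 x y * G x y)"
  proof (rule conv_ps_germ_eq_off_curve[of _ _ "phi k"])
    show "conv_ps (horner ks a)" by (rule conv_ps_horner)
    show "conv_ps (\<lambda>x y. U x y * ell_prod ks x y + V1 x y * G x y)"
      by (intro conv_ps_intros Cons.prems V1 conv_ps_ell_prod conv_ps_G)
    show "eventually (\<lambda>z. fst z \<noteq> 0 \<longrightarrow> snd z \<noteq> phi k (fst z) \<longrightarrow> horner ks a (fst z) (snd z) =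
        U (fst z) (snd z) * ell_prod ks (fst z) (snd z) + V1 (fst z) (snd z) * G (fst z) (snd z)) (nhds (0, 0))"
      using Cons.prems(6) V1(2) ev evu unfolding germ_eq_def
    proof eventually_elim
      case (elim z)
      show ?case
      proof (intro impI)
        assume z: "fst z \<noteq> 0" "snd z \<noteq> phi k (fst z)"
        define x y where "x = fst z" and "y = snd z"
        have "V x (phi k x) = 0" using elim(3,4) z ak by (simp add: x_def)
        then have V: "V x y = ell k x y * V1 x y" using elim(2) by (simp add: x_def y_def ell_phi)
        have "ell k x y * horner ks a x y = ell k x y * (U x y * ell_prod ks x y + V1 x y * G x y)"
          using elim(1) ak unfolding x_def[symmetric] y_def[symmetric] V by (simp add: algebra_simps)
        moreover have "ell k x y \<noteq> 0" using z by (simp add: ell_phi x_def y_def)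
        ultimately show "horner ks a (fst z) (snd z) =
          U (fst z) (snd z) * ell_prod ks (fst z) (snd z) + V1 (fst z) (snd z) * G (fst z) (snd z)"
          by (simp add: x_def y_def)
      qed
    qed
  qed
  then have "\<forall>k\<in>set ks. a k = 0"
    using Cons.IH[of V1] Cons.prems V1(1) by auto
  then show ?case using ak by simp
qed simp

text \<open>The coefficients of one basis germ: for distinct \<open>ks\<close> containing
  \<open>k\<close>, \<open>horner ks (single k i)\<close> is \<open>x^i\<close> times the product of
  the factors listed before \<open>k\<close>.\<close>

definition single :: "nat \<Rightarrow> nat \<Rightarrow> nat \<Rightarrow> complex poly" where
  "single k i = (\<lambda>j. if j = k then monom 1 i else 0)"

text \<open>Common frame for finite and infinite exponents. The basis consists of the germs
  \<open>horner ks (single k i)\<close> with \<open>N k \<le> i < D\<^sub>k\<close>. Here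
  \<open>mem\<close> puts them into \<open>I\<close>, and \<open>nonmem\<close> says that no nonzero
  normal form in \<open>I\<close> has only coefficients below the leading orders.\<close>

lemma quot_dim_is_of_leading_orders:
  assumes ks: "distinct ks" "set ks = A"
    and N: "\<And>k. k \<in> A \<Longrightarrow> N k \<le> total_contact k"
    and conv: "\<And>Q. Q \<in> I \<Longrightarrow> conv_ps Q"
    and JI: "ideal2 (ell_prod ks) G \<subseteq> I"
    and diff: "\<And>Q R. Q \<in> I \<Longrightarrow> R \<in> I \<Longrightarrow> (\<lambda>x y. Q x y - R x y) \<in> I"
    and scale: "\<And>Q c. Q \<in> I \<Longrightarrow> (\<lambda>x y. c * Q x y) \<in> I"
    and mem: "\<And>k i. k \<in> A \<Longrightarrow> N k \<le> i \<Longrightarrow> horner ks (single k i) \<in> I"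
    and nonmem: "\<And>a. horner ks a \<in> I \<Longrightarrow> (\<And>k i. k \<in> A \<Longrightarrow> N k \<le> i \<Longrightarrow> coeff (a k) i = 0) \<Longrightarrow> \<forall>k\<in>A. a k = 0"
  shows "quot_dim_is I (ideal2 (ell_prod ks) G) (\<Sum>k\<in>A. total_contact k - N k)"
proof -
  define E where "E = Sigma A (\<lambda>k. {N k..<total_contact k})"
  have finE: "finite E" unfolding E_def using finite_A by auto
  have cardE: "card E = (\<Sum>k\<in>A. total_contact k - N k)"
    unfolding E_def using finite_A by (subst card_SigmaI) auto
  obtain \<beta> where "bij_betw \<beta> {0..<card E} E" using ex_bij_betw_nat_finite[OF finE] by blast
  then have \<beta>: "bij_betw \<beta> {..<card E} E" by (simp add: atLeast0LessThan)
  define n where "n = card E"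
  note \<beta> = \<beta>[folded n_def]
  define B where "B = (\<lambda>i. horner ks (single (fst (\<beta> i)) (snd (\<beta> i))))"
  define comb where "comb = (\<lambda>(c :: nat \<Rightarrow> complex) k. \<Sum>i<n. smult (c i) (single (fst (\<beta> i)) (snd (\<beta> i)) k))"
  have Bsum: "(\<Sum>i<n. c i * B i x y) = horner ks (comb c) x y" for c x y
    unfolding B_def comb_def by (rule horner_sum[symmetric])
  have coeff_comb: "coeff (comb c k) j = (\<Sum>i<n. if \<beta> i = (k, j) then c i else 0)" for c k j
    unfolding comb_def coeff_sum by (rule sum.cong) (auto simp: single_def prod_eq_iff)
  have coeff_comb_out: "coeff (comb c k) j = 0" if "(k, j) \<notin> E" for c k j
    unfolding coeff_comb using bij_betwE[OF \<beta>] that by (intro sum.neutral) (metis lessThan_iff)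
  have coeff_comb_in: "coeff (comb c (fst (\<beta> i))) (snd (\<beta> i)) = c i" if "i < n" for c i
  proof -
    have "coeff (comb c (fst (\<beta> i))) (snd (\<beta> i)) = (\<Sum>m<n. if m = i then c m else 0)"
      unfolding coeff_comb by (rule sum.cong) (use \<beta> that in \<open>auto simp: bij_betw_def inj_on_def\<close>)
    then show ?thesis using that by simp
  qed
  have BI: "B i \<in> I" if "i < n" for i
  proof -
    have "\<beta> i \<in> E" using \<beta> that by (auto dest: bij_betwE)
    then show ?thesis unfolding B_def by (intro mem) (auto simp: E_def)
  qed
  have zeroI: "(\<lambda>x y. 0) \<in> I"
    using JI conv_ps_const[of 0] by (auto simp: ideal2_def germ_eq_def intro!: subsetD[OF JI] exI[of _ "\<lambda>x y. 0"])
  have add: "(\<lambda>x y. Q x y + R x y) \<in> I" if "Q \<in> I" "R \<in> I" for Q R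
    using diff[OF that(1) scale[OF that(2), of "-1"]] by simp
  have combI: "(\<lambda>x y. \<Sum>i<m. c i * B i x y) \<in> I" if "m \<le> n" for c m
    using that
  proof (induction m)
    case 0 then show ?case using zeroI by simp
  next
    case (Suc m) then show ?case using add[of "\<lambda>x y. \<Sum>i<m. c i * B i x y" "\<lambda>x y. c m * B m x y"] scale BI by simp
  qed
  have "quot_dim_is I (ideal2 (ell_prod ks) G) n"
    unfolding quot_dim_is_def
  proof (intro exI[of _ B] conjI allI impI ballI)
    show "B i \<in> I" if "i < n" for i using BI that .
  next
    fix c i assume "(\<lambda>x y. \<Sum>i<n. c i * B i x y) \<in> ideal2 (ell_prod ks) G" and i: "i < n"
    then obtain U V where UV: "conv_ps U" "conv_ps V" "germ_eq (horner ks (comb c)) (\<lambda>x y. U x y * ell_prod ks x y + V x y * G x y)"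
      unfolding ideal2_def Bsum by (auto simp: eta_contract_eq)
    have "\<forall>k\<in>set ks. comb c k = 0"
    proof (rule horner_indep[OF _ ks(1) _ UV])
      show "coeff (comb c k) j = 0" if "k \<in> set ks" "total_contact k \<le> j" for k j
        using that by (intro coeff_comb_out) (auto simp: E_def)
    qed (use ks in auto)
    moreover have "fst (\<beta> i) \<in> set ks"
      using bspec[OF bij_betwE[OF \<beta>], of i] i ks by (auto simp: E_def mem_Sigma_iff)
    ultimately show "c i = 0" using coeff_comb_in[OF i, of c] by simp
  next
    fix Q assume Q: "Q \<in> I"
    obtain a U V where a: "conv_ps U" "conv_ps V" "\<forall>k. \<forall>i\<ge>total_contact k. coeff (a k) i = 0"
      "germ_eq Q (\<lambda>x y. horner ks a x y + U x y * ell_prod ks x y + V x y * G x y)"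
      using horner_span[OF _ ks(1) conv[OF Q]] ks(2) by auto
    have J: "(\<lambda>x y. Q x y - horner ks a x y) \<in> ideal2 (ell_prod ks) G"
      unfolding ideal2_def
    proof (intro CollectI conjI exI)
      show "conv_ps (\<lambda>x y. Q x y - horner ks a x y)" by (intro conv_ps_diff conv[OF Q] conv_ps_horner)
      show "germ_eq (\<lambda>x y. Q x y - horner ks a x y) (\<lambda>x y. U x y * ell_prod ks x y + V x y * G x y)"
        using a(4) unfolding germ_eq_def by eventually_elim (simp add: algebra_simps)
    qed (use a in auto)
    define c where "c = (\<lambda>i. coeff (a (fst (\<beta> i))) (snd (\<beta> i)))"
    have cI: "horner ks (comb c) \<in> I"
      using combI[of n c] unfolding Bsum by (simp add: eta_contract_eq)
    \<comment> \<open>Modulo the ideal \<open>Q\<close> is its normal form. Removing the monomials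
      of order at least \<open>N k\<close> by basis elements stays inside \<open>I\<close>, and what
      is left has low-order coefficients only.\<close>
    have "(\<lambda>x y. Q x y - (Q x y - horner ks a x y) - horner ks (comb c) x y) \<in> I"
      using diff[OF diff[OF Q subsetD[OF JI J]] cI] .
    moreover have "(\<lambda>x y. Q x y - (Q x y - horner ks a x y) - horner ks (comb c) x y) = horner ks (\<lambda>k. a k - comb c k)"
      by (simp add: fun_eq_iff horner_diff)
    ultimately have "horner ks (\<lambda>k. a k - comb c k) \<in> I" by simp
    then have "\<forall>k\<in>A. a k - comb c k = 0"
    proof (rule nonmem)
      fix k i assume ki: "k \<in> A" "N k \<le> i"
      show "coeff (a k - comb c k) i = 0"
      proof (cases "i < total_contact k")
        case True
        then have "(k, i) \<in> E" using ki by (auto simp: E_def)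
        then obtain m where m: "m < n" "\<beta> m = (k, i)" using \<beta> by (auto simp: bij_betw_def image_iff lessThan_def)
        show ?thesis using coeff_comb_in[OF m(1), of c] m(2) by (simp add: c_def)
      next
        case False
        then have "(k, i) \<notin> E" by (auto simp: E_def)
        from coeff_comb_out[OF this, of c] show ?thesis using a(3) False by simp
      qed
    qed
    then have "horner ks (comb c) = horner ks a" by (intro horner_cong) (use ks in auto)
    then show "\<exists>c. (\<lambda>x y. Q x y - (\<Sum>i<n. c i * B i x y)) \<in> ideal2 (ell_prod ks) G"
      using J unfolding Bsum by (intro exI[of _ c]) simp
  qed
  then show ?thesis by (simp add: n_def cardE)
qed

end

section \<open>Local integrals in the plane\<close>

lemma nn_integral_powr_finite:
  fixes a c :: real
  assumes a: "a > -1"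
  shows "(\<integral>\<^sup>+x. ennreal (\<bar>x\<bar> powr a) * indicator {-c..c} x \<partial>lborel) < \<infinity>"
proof (cases "c \<ge> 0")
  case True
  let ?I = "c powr (a+1) / (a+1)"
  have 1: "((\<lambda>x. \<bar>x\<bar> powr a) has_integral ?I) {0..c}"
    using has_integral_powr_from_0[OF a True] by (rule has_integral_eq[rotated]) auto
  then have "((\<lambda>x. \<bar>-x\<bar> powr a) has_integral ?I) {-c..-0}"
    by (subst has_integral_reflect_real)
  then have 2: "((\<lambda>x. \<bar>x\<bar> powr a) has_integral ?I) {-c..0}" by simp
  have "((\<lambda>x. \<bar>x\<bar> powr a) has_integral (?I + ?I)) {-c..c}"
    by (rule has_integral_combine[OF _ _ 2 1]) (use True in auto)
  from nn_integral_has_integral_lebesgue'[OF _ this] show ?thesis by simp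
next
  case False
  then have "{-c..c} = {}" by auto
  then show ?thesis by simp
qed

lemma nn_integral_powr_infinite:
  fixes a e :: real
  assumes a: "a \<le> -1" and e: "e > 0"
  shows "(\<integral>\<^sup>+x. ennreal (x powr a) * indicator {0<..<e} x \<partial>lborel) = \<infinity>"
proof (rule ccontr)
  let ?J = "\<integral>\<^sup>+x. ennreal (x powr a) * indicator {0<..<e} x \<partial>lborel"
  assume "?J \<noteq> \<infinity>"
  then obtain r where r: "?J = ennreal r" "r \<ge> 0" by (cases ?J) auto
  define b where "b = min 1 (e/2)"
  \<comment> \<open>Chosen so that the integral of \<open>1 / x\<close> from \<open>d\<close> to
    \<open>b\<close> is \<open>r + 1\<close>, one more than the supposed value of the whole
    integral.\<close>
  define d where "d = b * exp (- (r + 1))"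
  have b: "0 < b" "b \<le> 1" "b < e" using e by (auto simp: b_def)
  have d: "0 < d" "d \<le> b" using b r by (auto simp: d_def)
  have "((\<lambda>x. inverse x) has_integral (ln b - ln d)) {d..b}"
    by (rule fundamental_theorem_of_calculus)
       (use d in \<open>auto intro!: derivative_eq_intros simp: has_real_derivative_iff_has_vector_derivative[symmetric] field_simps\<close>)
  from nn_integral_has_integral_lebesgue'[OF _ this]
  have "ennreal (ln b - ln d) = (\<integral>\<^sup>+x. ennreal (inverse x) * indicator {d..b} x \<partial>lborel)"
    using d by simp
  also have "\<dots> \<le> ?J"
  proof (rule nn_integral_mono)
    fix x
    show "ennreal (inverse x) * indicator {d..b} x \<le> ennreal (x powr a) * indicator {0<..<e} x"
    proof (cases "x \<in> {d..b}")
      case True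
      then have x: "0 < x" "x \<le> 1" "x < e" using d b by auto
      have "inverse x = x powr (-1)" using x by (simp add: powr_minus)
      also have "\<dots> \<le> x powr a" using x a by (intro powr_mono') auto
      finally show ?thesis using True x by (simp add: ennreal_leI)
    qed simp
  qed
  finally have "ln b - ln d \<le> r" using r by simp
  moreover have "ln d = ln b - (r + 1)" using b by (simp add: d_def ln_mult)
  ultimately show False by simp
qed

definition sq :: "real \<Rightarrow> (real \<times> real) set" where
  "sq e = {-e<..<e} \<times> {-e<..<e}"

lemma mem_sq [simp]: "(x, y) \<in> sq e \<longleftrightarrow> \<bar>x\<bar> < e \<and> \<bar>y\<bar> < e"
  by (auto simp: sq_def)

lemma open_sq [simp]: "open (sq e)" by (simp add: sq_def open_Times)

lemma sq_measurable [measurable]: "sq e \<in> sets borel"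
  by (simp add: borel_open)

lemma sq_mono: "d \<le> e \<Longrightarrow> sq d \<subseteq> sq e"
  by (auto simp: sq_def)

lemma sq_subset_open:
  assumes "open U" "(0,0) \<in> U"
  obtains e where "e > 0" "sq e \<subseteq> U"
proof -
  obtain d where d: "d > 0" "ball (0,0) d \<subseteq> U" using assms open_contains_ball by blast
  have "sq (d/2) \<subseteq> ball (0,0) d"
  proof
    fix z assume "z \<in> sq (d/2)"
    then obtain x y where z: "z = (x,y)" "\<bar>x\<bar> < d/2" "\<bar>y\<bar> < d/2" by (cases z) auto
    have "norm (x, y) \<le> norm x + norm y" by (rule norm_Pair_le)
    then have "dist z (0,0) < d" using z by (simp add: dist_norm)
    then show "z \<in> ball (0,0) d" by (simp add: dist_commute)
  qed
  then show ?thesis using d that[of "d/2"] by auto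
qed

text \<open>The factor \<open>indicator\<close> sits inside the power, which is harmless as \<open>0 powr p = 0\<close>.\<close>

definition Lp_sq :: "real \<Rightarrow> real \<Rightarrow> (real \<times> real \<Rightarrow> 'a::real_normed_vector) \<Rightarrow> bool" where
  "Lp_sq p e f \<longleftrightarrow> (\<integral>\<^sup>+z. ennreal ((indicator (sq e) z * norm (f z)) powr p) \<partial>lborel) < \<infinity>"

lemma Lp_sq_alt:
  "(\<integral>\<^sup>+z. ennreal ((indicator (sq e) z * norm (f z)) powr p) \<partial>lborel) =
   (\<integral>\<^sup>+z\<in>sq e. ennreal (norm (f z) powr p) \<partial>lborel)"
  by (rule nn_integral_cong) (auto simp: indicator_def)

text \<open>Every summand is replaced by the largest one. The constant is cruder than that from
  convexity, but the argument is the same for all \<open>p \<ge> 0\<close>.\<close>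

lemma powr_sum_le:
  fixes g :: "'a \<Rightarrow> real"
  assumes J: "finite J" and g: "\<And>j. j \<in> J \<Longrightarrow> g j \<ge> 0" and p: "p \<ge> 0"
  shows "(\<Sum>j\<in>J. g j) powr p \<le> real (card J) powr p * (\<Sum>j\<in>J. g j powr p)"
proof (cases "J = {}")
  case False
  define M where "M = Max (g ` J)"
  have "M \<in> g ` J" unfolding M_def using J False by (intro Max_in) auto
  then obtain i where i: "i \<in> J" "M = g i" by auto
  have "(\<Sum>j\<in>J. g j) \<le> (\<Sum>j\<in>J. M)" unfolding M_def using J by (intro sum_mono Max_ge) auto
  then have "(\<Sum>j\<in>J. g j) powr p \<le> (real (card J) * M) powr p"
    using g p by (intro powr_mono2 sum_nonneg) auto
  also have "\<dots> = real (card J) powr p * g i powr p" using i g by (simp add: powr_mult)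
  also have "\<dots> \<le> real (card J) powr p * (\<Sum>j\<in>J. g j powr p)"
    using i J by (intro mult_left_mono member_le_sum) auto
  finally show ?thesis .
qed auto

lemma Lp_sq_dominated:
  fixes f :: "real \<times> real \<Rightarrow> 'a::real_normed_vector" and g :: "'j \<Rightarrow> real \<times> real \<Rightarrow> 'b::real_normed_vector"
  assumes J: "finite J" and g: "\<And>j. j \<in> J \<Longrightarrow> Lp_sq p e (g j)"
    and meas: "\<And>j. j \<in> J \<Longrightarrow> (\<lambda>z. indicator (sq e) z * norm (g j z)) \<in> borel_measurable borel"
    and p: "p \<ge> 0" and C: "C \<ge> 0" and d: "d \<le> e"
    and le: "AE z in lborel. z \<in> sq d \<longrightarrow> norm (f z) \<le> C * (\<Sum>j\<in>J. norm (g j z))"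
  shows "Lp_sq p d f"
proof -
  define h where "h = (\<lambda>j z. indicator (sq e) z * norm (g j z))"
  define K where "K = C powr p * real (card J) powr p"
  have K: "K \<ge> 0" by (simp add: K_def)
  have hm: "h j \<in> borel_measurable borel" if "j \<in> J" for j using meas[OF that] by (simp add: h_def)
  have "(\<integral>\<^sup>+z. ennreal ((indicator (sq d) z * norm (f z)) powr p) \<partial>lborel)
      \<le> (\<integral>\<^sup>+z. ennreal K * (\<Sum>j\<in>J. ennreal (h j z powr p)) \<partial>lborel)"
  proof (rule nn_integral_mono_AE)
    show "AE z in lborel. ennreal ((indicator (sq d) z * norm (f z)) powr p) \<le> ennreal K * (\<Sum>j\<in>J. ennreal (h j z powr p))"
      using le
    proof eventually_elim
      case (elim z)
      show ?case
      proof (cases "z \<in> sq d")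
        case True
        then have ze: "z \<in> sq e" using sq_mono[OF d] by auto
        have "norm (f z) powr p \<le> (C * (\<Sum>j\<in>J. norm (g j z))) powr p"
          using elim True p by (intro powr_mono2) auto
        also have "\<dots> = C powr p * (\<Sum>j\<in>J. norm (g j z)) powr p"
          using C by (simp add: powr_mult sum_nonneg)
        also have "\<dots> \<le> C powr p * (real (card J) powr p * (\<Sum>j\<in>J. norm (g j z) powr p))"
          by (intro mult_left_mono powr_sum_le J p) auto
        finally have "norm (f z) powr p \<le> K * (\<Sum>j\<in>J. h j z powr p)"
          using ze by (simp add: K_def h_def mult.assoc)
        then have "ennreal (norm (f z) powr p) \<le> ennreal (K * (\<Sum>j\<in>J. h j z powr p))" by (rule ennreal_leI)
        also have "\<dots> = ennreal K * (\<Sum>j\<in>J. ennreal (h j z powr p))"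
          using K by (simp add: ennreal_mult sum_nonneg)
        finally show ?thesis using True by simp
      qed simp
    qed
  qed
  also have "\<dots> = ennreal K * (\<Sum>j\<in>J. (\<integral>\<^sup>+z. ennreal (h j z powr p) \<partial>lborel))"
  proof -
    have m: "(\<lambda>z. ennreal (h j z powr p)) \<in> borel_measurable lborel" if "j \<in> J" for j
      using hm[OF that] by simp
    show ?thesis
      by (subst nn_integral_cmult, intro borel_measurable_sum m, assumption, subst nn_integral_sum) (rule m, assumption, rule refl)
  qed
  also have "\<dots> < \<infinity>"
    using g J by (auto simp: Lp_sq_def h_def ennreal_mult_less_top less_top)
  finally show ?thesis by (simp add: Lp_sq_def)
qed

lemma nn_integral_real_pair:
  fixes f :: "real \<times> real \<Rightarrow> ennreal"
  assumes "f \<in> borel_measurable borel"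
  shows "(\<integral>\<^sup>+z. f z \<partial>lborel) = (\<integral>\<^sup>+x. \<integral>\<^sup>+y. f (x, y) \<partial>lborel \<partial>lborel)"
proof -
  have "f \<in> borel_measurable (lborel \<Otimes>\<^sub>M lborel)" using assms by (simp add: lborel_prod)
  from lborel.nn_integral_fst[OF this] show ?thesis by (simp add: lborel_prod)
qed

text \<open>The constant must not depend on \<open>t\<close>, because the bound is later integrated over \<open>t\<close>.\<close>

lemma poly_bound_off_axis:
  "\<exists>K>0. \<forall>T :: complex poly. degree T \<le> n \<longrightarrow> (\<forall>t\<in>{0..1::real}.
     norm (poly T (-\<i>)) \<le> K * (\<Sum>m\<le>n. norm (poly T (of_real (t + real m)))))"
proof (induction n)
  case 0
  show ?case
  proof (intro exI[of _ 1] conjI allI impI ballI)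
    fix T :: "complex poly" and t :: real assume "degree T \<le> 0"
    then obtain c where "T = [:c:]" by (metis degree_eq_zeroE le_zero_eq)
    then show "norm (poly T (-\<i>)) \<le> 1 * (\<Sum>m\<le>0. norm (poly T (of_real (t + real m))))" by simp
  qed simp
next
  case (Suc n)
  then obtain K where K: "K > 0" "\<And>(T :: complex poly) t. degree T \<le> n \<Longrightarrow> t \<in> {0..1} \<Longrightarrow>
     norm (poly T (-\<i>)) \<le> K * (\<Sum>m\<le>n. norm (poly T (of_real (t + real m))))" by blast
  \<comment> \<open>The factor \<open>n + 3\<close> bounds the distance from \<open>-\<i>\<close> to
    the last node, \<open>n + 2\<close> the loss in passing from values of \<open>T\<close> to
    values of the quotient \<open>R\<close>, and 1 accounts for the value at the last node
    itself.\<close>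
  define K' where "K' = 1 + (real n + 3) * K * (real n + 2)"
  show ?case
  proof (intro exI[of _ K'] conjI allI impI ballI)
    show "K' > 0" using K by (simp add: K'_def add_pos_nonneg)
    fix T :: "complex poly" and t :: real assume T: "degree T \<le> Suc n" and t: "t \<in> {0..1}"
    define t0 :: complex where "t0 = of_real (t + real (Suc n))"
    \<comment> \<open>The difference quotient of \<open>T\<close> at the last node has smaller
      degree. The other nodes are at distance at least 1 from \<open>t0\<close>, so its values there
      are controlled by those of \<open>T\<close>.\<close>
    define R where "R = synthetic_div T t0"
    have R: "degree R \<le> n" using T by (simp add: R_def degree_synthetic_div)
    have TR: "poly T w = (w - t0) * poly R w + poly T t0" for w
      using arg_cong[OF synthetic_div_correct'[of t0 T], of "\<lambda>p. poly p w"] by (simp add: R_def algebra_simps)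
    let ?b = "\<lambda>m. norm (poly T (of_real (t + real m)))"
    let ?S = "\<Sum>m\<le>Suc n. ?b m"
    have t0S: "norm (poly T t0) \<le> ?S" unfolding t0_def
      by (rule member_le_sum[of "Suc n" "{..Suc n}" ?b]) auto
    have Rm: "norm (poly R (of_real (t + real m))) \<le> ?b m + norm (poly T t0)" if "m \<le> n" for m
    proof -
      let ?w = "of_real (t + real m) :: complex"
      have "?w - t0 = of_real (real m - real (Suc n))" by (simp add: t0_def)
      then have "norm (?w - t0) \<ge> 1" using that by (simp only: norm_of_real)
      then have "1 * norm (poly R ?w) \<le> norm (?w - t0) * norm (poly R ?w)" by (intro mult_right_mono) auto
      also have "\<dots> = norm (poly T ?w - poly T t0)" using TR[of ?w] by (simp add: norm_mult)
      also have "\<dots> \<le> ?b m + norm (poly T t0)" by (rule norm_triangle_ineq4)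
      finally show ?thesis by simp
    qed
    have "(\<Sum>m\<le>n. norm (poly R (of_real (t + real m)))) \<le> (\<Sum>m\<le>n. ?b m + norm (poly T t0))"
      by (rule sum_mono) (use Rm in auto)
    also have "\<dots> = (\<Sum>m\<le>n. ?b m) + (real n + 1) * norm (poly T t0)" by (simp add: sum.distrib)
    also have "\<dots> \<le> ?S + (real n + 1) * ?S" using t0S by (intro add_mono mult_left_mono) auto
    finally have sumR: "(\<Sum>m\<le>n. norm (poly R (of_real (t + real m)))) \<le> (real n + 2) * ?S"
      by (simp add: algebra_simps)
    have "norm (- \<i> - t0) \<le> norm (- \<i>) + norm t0" by (rule norm_triangle_ineq4)
    also have "norm t0 \<le> real n + 2" using t unfolding t0_def norm_of_real by simp
    finally have it0: "norm (- \<i> - t0) \<le> real n + 3" by simp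
    have "norm (poly T (-\<i>)) \<le> norm (- \<i> - t0) * norm (poly R (-\<i>)) + norm (poly T t0)"
      unfolding TR[of "-\<i>"] by (rule order_trans[OF norm_triangle_ineq]) (simp add: norm_mult)
    also have "\<dots> \<le> (real n + 3) * (K * ((real n + 2) * ?S)) + ?S"
      using it0 t0S K(2)[OF R t] sumR K(1)
      by (intro add_mono mult_mono) (auto intro: order_trans mult_left_mono)
    also have "\<dots> = K' * ?S" by (simp add: K'_def algebra_simps)
    finally show "norm (poly T (-\<i>)) \<le> K' * ?S" .
  qed
qed

section \<open>Contact of branches and greedy orderings\<close>

context branches
begin

lemma ell_real:
  "ell k (of_real x) (of_real y) = Complex (y + poly (q k) x) (x ^ (2 * L k))"
  by (simp add: ell_def poly_qc_of_real complex_eq_iff Re_power_real flip: of_real_power)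

lemma norm_ell_bar_real: "norm (ell_bar k (of_real x) (of_real y)) = norm (ell k (of_real x) (of_real y))"
proof -
  have "ell_bar k (of_real x) (of_real y) = cnj (ell k (of_real x) (of_real y))"
    by (simp add: ell_def ell_bar_def poly_qc_of_real)
  then show ?thesis by simp
qed

lemma ell_nonzero:
  assumes "k \<in> A" "(x, y) \<noteq> (0, 0)"
  shows "ell k (of_real x) (of_real y) \<noteq> 0"
  using assms q_0[OF assms(1)] L_pos[OF assms(1)] by (auto simp: ell_real complex_eq_iff)

lemma ell_prod_nonzero:
  assumes "set ks \<subseteq> A" "(x, y) \<noteq> (0, 0)"
  shows "ell_prod ks (of_real x) (of_real y) \<noteq> 0"
  using assms(1) by (induction ks) (use ell_nonzero assms(2) in auto)

lemma ell_prod_set: "distinct ks \<Longrightarrow> ell_prod ks x y = (\<Prod>k\<in>set ks. ell k x y)"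
  by (induction ks) auto

lemma norm_ell_ge:
  "\<bar>y + poly (q k) x\<bar> \<le> norm (ell k (of_real x) (of_real y))"
  "\<bar>x\<bar> ^ (2 * L k) \<le> norm (ell k (of_real x) (of_real y))"
  using abs_Re_le_cmod[of "ell k (of_real x) (of_real y)"] abs_Im_le_cmod[of "ell k (of_real x) (of_real y)"]
  by (simp_all add: ell_real power_abs)

lemma diffpoly_ell: "poly (diffpoly j l) x = ell_bar l x y - ell j x y"
  by (simp add: diffpoly_def ell_def ell_bar_def poly_monom)

lemma contact_lower_pair:
  assumes "j \<in> A" "l \<in> A"
  shows "\<exists>c>0. \<forall>\<^sub>F x :: real in nhds 0. c * \<bar>x\<bar> ^ contact j l \<le> norm (poly (diffpoly j l) (of_real x))"
proof -
  obtain u where u: "diffpoly j l = monom 1 (contact j l) * u" "poly u 0 \<noteq> 0"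
    by (rule diffpoly_factor[OF assms])
  have "isCont (\<lambda>x :: real. norm (poly u (of_real x))) 0" by (intro continuous_intros)
  moreover have "eventually (\<lambda>w. norm (poly u 0) / 2 < w) (nhds (norm (poly u (of_real 0))))"
    using u(2) eventually_nhds_in_open[of "{norm (poly u 0) / 2<..}" "norm (poly u 0)"] by simp
  ultimately have "eventually (\<lambda>x :: real. norm (poly u 0) / 2 < norm (poly u (of_real x))) (nhds 0)"
    by (rule isCont_eventually_nhds)
  then have "\<forall>\<^sub>F x :: real in nhds 0. norm (poly u 0) / 2 * \<bar>x\<bar> ^ contact j l \<le> norm (poly (diffpoly j l) (of_real x))"
  proof eventually_elim
    case (elim x)
    have "norm (poly (diffpoly j l) (of_real x)) = norm (poly u (of_real x)) * \<bar>x\<bar> ^ contact j l"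
      by (simp add: u(1) poly_monom norm_mult norm_power)
    then show ?case using mult_right_mono[OF less_imp_le[OF elim], of "\<bar>x\<bar> ^ contact j l"] by simp
  qed
  then show ?thesis using u(2) by (intro exI[of _ "norm (poly u 0) / 2"]) auto
qed

text \<open>In \<open>ell_bar l - ell j = diffpoly j l\<close> the variable \<open>y\<close>
  cancels, and at real points \<open>ell_bar l\<close> has the modulus of \<open>ell l\<close>.
  Hence twice the larger of the two factors dominates a polynomial in \<open>x\<close> whose order
  is the contact, uniformly in \<open>y\<close>.\<close>

lemma contact_lower:
  obtains c e where "0 < c" "c \<le> 1" "0 < e" "e \<le> 1"
    "\<And>j l x y :: real. j \<in> A \<Longrightarrow> l \<in> A \<Longrightarrow> \<bar>x\<bar> < e \<Longrightarrow>
       norm (ell j (of_real x) (of_real y)) \<le> norm (ell l (of_real x) (of_real y)) \<Longrightarrow>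
       c * \<bar>x\<bar> ^ contact j l \<le> norm (ell l (of_real x) (of_real y))"
proof -
  have "\<forall>z\<in>A \<times> A. \<exists>c>0. \<forall>\<^sub>F x :: real in nhds 0. c * \<bar>x\<bar> ^ contact (fst z) (snd z) \<le> norm (poly (diffpoly (fst z) (snd z)) (of_real x))"
    using contact_lower_pair by auto
  from bchoice[OF this] obtain C where C: "\<forall>z\<in>A \<times> A. C z > 0 \<and> (\<forall>\<^sub>F x :: real in nhds 0. C z * \<bar>x\<bar> ^ contact (fst z) (snd z) \<le> norm (poly (diffpoly (fst z) (snd z)) (of_real x)))"
    by blast
  have fin: "finite (A \<times> A)" using finite_A by simp
  have "\<forall>\<^sub>F x :: real in nhds 0. \<forall>z\<in>A \<times> A. C z * \<bar>x\<bar> ^ contact (fst z) (snd z) \<le> norm (poly (diffpoly (fst z) (snd z)) (of_real x))"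
    using C by (intro eventually_ball_finite[OF fin]) auto
  then obtain d where d0: "d > 0" and "\<forall>x. dist x 0 < d \<longrightarrow> (\<forall>z\<in>A \<times> A. C z * \<bar>x\<bar> ^ contact (fst z) (snd z) \<le> norm (poly (diffpoly (fst z) (snd z)) (of_real x)))"
    unfolding eventually_nhds_metric by (elim exE conjE)
  then have d: "d > 0" "\<And>x z. dist x 0 < d \<Longrightarrow> z \<in> A \<times> A \<Longrightarrow> C z * \<bar>x\<bar> ^ contact (fst z) (snd z) \<le> norm (poly (diffpoly (fst z) (snd z)) (of_real x))"
    by blast+
  \<comment> \<open>The half absorbs the sum of the two factors. Inserting 1 keeps the minimum
    defined for empty \<open>A\<close> and gives \<open>c \<le> 1\<close>.\<close>
  define c where "c = Min (insert 1 (C ` (A \<times> A))) / 2"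
  have c: "c > 0" "2 * c \<le> 1" using C fin by (auto simp: c_def)
  have cC: "2 * c \<le> C (j, l)" if "j \<in> A" "l \<in> A" for j l
    unfolding c_def using fin that by (auto intro: Min_le)
  show ?thesis
  proof (rule that[of c "min d 1"])
    fix j l and x y :: real
    assume jl: "j \<in> A" "l \<in> A" and x: "\<bar>x\<bar> < min d 1"
      and le: "norm (ell j (of_real x) (of_real y)) \<le> norm (ell l (of_real x) (of_real y))"
    have "2 * c * \<bar>x\<bar> ^ contact j l \<le> C (j, l) * \<bar>x\<bar> ^ contact j l"
      using cC[OF jl] by (intro mult_right_mono) auto
    also have "\<dots> \<le> norm (poly (diffpoly j l) (of_real x))" using d(2)[of x "(j,l)"] x jl by simp
    also have "\<dots> \<le> norm (ell_bar l (of_real x) (of_real y)) + norm (ell j (of_real x) (of_real y))"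
      unfolding diffpoly_ell[of j l "of_real x" "of_real y"] by (rule norm_triangle_ineq4)
    also have "\<dots> \<le> 2 * norm (ell l (of_real x) (of_real y))" using le by (simp add: norm_ell_bar_real)
    finally show "c * \<bar>x\<bar> ^ contact j l \<le> norm (ell l (of_real x) (of_real y))" by simp
  qed (use c d in auto)
qed

text \<open>At real \<open>x\<close> the difference of the two real polynomials is the real part of
  \<open>diffpoly\<close>, which vanishes to the order of contact.\<close>

lemma contact_upper:
  assumes "k \<in> A" "j \<in> A"
  shows "\<exists>C\<ge>0. \<forall>x::real. \<bar>x\<bar> \<le> 1 \<longrightarrow> \<bar>poly (q j) x - poly (q k) x\<bar> \<le> C * \<bar>x\<bar> ^ contact k j"
proof -
  obtain u where u: "diffpoly k j = monom 1 (contact k j) * u"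
    by (rule diffpoly_factor[OF assms])
  have "compact ((\<lambda>x :: real. norm (poly u (of_real x))) ` {-1..1})"
    by (intro compact_continuous_image continuous_intros) auto
  then have "bounded ((\<lambda>x :: real. norm (poly u (of_real x))) ` {-1..1})" by (rule compact_imp_bounded)
  then obtain C where C: "\<And>x. x \<in> {-1..1} \<Longrightarrow> norm (poly u (of_real x :: complex)) \<le> C"
    unfolding bounded_iff by (metis abs_norm_cancel image_eqI real_norm_def)
  have C0: "C \<ge> 0" using order_trans[OF norm_ge_zero C[of 0]] by simp
  show ?thesis
  proof (intro exI[of _ C] conjI allI impI C0)
    fix x :: real assume x: "\<bar>x\<bar> \<le> 1"
    have "\<bar>Re (poly (diffpoly k j) (of_real x))\<bar> \<le> norm (poly (diffpoly k j) (of_real x))" by (rule abs_Re_le_cmod)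
    also have "\<dots> = \<bar>x\<bar> ^ contact k j * norm (poly u (of_real x))" by (simp add: u poly_monom norm_mult norm_power)
    also have "\<dots> \<le> \<bar>x\<bar> ^ contact k j * C" using x by (intro mult_left_mono C) auto
    also have "Re (poly (diffpoly k j) (of_real x)) = poly (q j) x - poly (q k) x"
      by (simp add: diffpoly_def poly_monom poly_qc_of_real flip: of_real_power)
    finally show "\<bar>poly (q j) x - poly (q k) x\<bar> \<le> C * \<bar>x\<bar> ^ contact k j" by (simp add: mult.commute)
  qed
qed

text \<open>On the strip around branch \<open>k\<close> each \<open>ell j\<close> is built from
  \<open>x^(2 L k) * \<tau>\<close>, \<open>q j - q k\<close> and \<open>x^(2 L j)\<close>, and all
  three are of order at least \<open>contact k j\<close>.\<close>

lemma ell_prod_upper: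
  assumes k: "k \<in> A" and "set ks \<subseteq> A" "distinct ks" and B: "B \<ge> 0"
  shows "\<exists>C>0. \<forall>x \<tau> :: real. 0 < x \<longrightarrow> x \<le> 1 \<longrightarrow> 0 \<le> \<tau> \<longrightarrow> \<tau> \<le> B \<longrightarrow>
    norm (ell_prod ks (of_real x) (of_real (- poly (q k) x + x ^ (2 * L k) * \<tau>))) \<le> C * x ^ (\<Sum>l\<in>set ks. contact k l)"
  using assms(2,3)
proof (induction ks)
  case Nil then show ?case by (auto intro: exI[of _ 1])
next
  case (Cons j ks)
  then obtain C where C: "C > 0" "\<And>x \<tau> :: real. 0 < x \<Longrightarrow> x \<le> 1 \<Longrightarrow> 0 \<le> \<tau> \<Longrightarrow> \<tau> \<le> B \<Longrightarrow>
    norm (ell_prod ks (of_real x) (of_real (- poly (q k) x + x ^ (2 * L k) * \<tau>))) \<le> C * x ^ (\<Sum>l\<in>set ks. contact k l)"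
    by auto
  obtain C1 where C1: "C1 \<ge> 0" "\<And>x::real. \<bar>x\<bar> \<le> 1 \<Longrightarrow> \<bar>poly (q j) x - poly (q k) x\<bar> \<le> C1 * \<bar>x\<bar> ^ contact k j"
    using contact_upper[OF k, of j] Cons.prems by auto
  define D where "D = B + C1 + 1"
  show ?case
  proof (intro exI[of _ "D * C"] conjI allI impI)
    show "D * C > 0" using B C C1 by (auto simp: D_def intro!: mult_pos_pos)
    fix x \<tau> :: real assume x: "0 < x" "x \<le> 1" and \<tau>: "0 \<le> \<tau>" "\<tau> \<le> B"
    define y where "y = - poly (q k) x + x ^ (2 * L k) * \<tau>"
    have p1: "x ^ (2 * L k) \<le> x ^ contact k j" "x ^ (2 * L j) \<le> x ^ contact k j"
      using x contact_le[of k j] by (auto intro: power_decreasing)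
    have "norm (ell j (of_real x) (of_real y)) \<le> \<bar>y + poly (q j) x\<bar> + \<bar>x ^ (2 * L j)\<bar>"
      unfolding ell_real using cmod_le[of "Complex (y + poly (q j) x) (x ^ (2 * L j))"] by simp
    also have "\<bar>y + poly (q j) x\<bar> \<le> \<bar>x ^ (2 * L k) * \<tau>\<bar> + \<bar>poly (q j) x - poly (q k) x\<bar>"
      unfolding y_def by linarith
    also have "\<bar>x ^ (2 * L k) * \<tau>\<bar> = x ^ (2 * L k) * \<tau>" using x \<tau> by simp
    also have "x ^ (2 * L k) * \<tau> \<le> x ^ contact k j * B" using x \<tau> p1 by (intro mult_mono) auto
    also have "\<bar>poly (q j) x - poly (q k) x\<bar> \<le> C1 * x ^ contact k j" using C1(2)[of x] x by simp
    also have "\<bar>x ^ (2 * L j)\<bar> \<le> x ^ contact k j" using p1 x by simp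
    finally have j: "norm (ell j (of_real x) (of_real y)) \<le> D * x ^ contact k j" by (simp add: D_def algebra_simps)
    have "norm (ell_prod (j # ks) (of_real x) (of_real y)) \<le> (D * x ^ contact k j) * (C * x ^ (\<Sum>l\<in>set ks. contact k l))"
      unfolding ell_prod_simps norm_mult
      using j C(2)[OF x \<tau>] B C C1 x by (intro mult_mono) (auto simp: y_def D_def)
    also have "\<dots> = D * C * x ^ (\<Sum>l\<in>set (j # ks). contact k l)"
      using Cons.prems by (simp add: power_add)
    finally show "norm (ell_prod (j # ks) (of_real x) (of_real (- poly (q k) x + x ^ (2 * L k) * \<tau>))) \<le> D * C * x ^ (\<Sum>l\<in>set (j # ks). contact k l)"
      unfolding y_def .
  qed
qed

text \<open>Least order of the coefficient of index \<open>j\<close> for which its term is integrable (in a greedy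
  ordering), if \<open>m\<close> gives these orders for the single branches.\<close>

primrec lead_ord :: "(nat \<Rightarrow> nat) \<Rightarrow> nat list \<Rightarrow> nat \<Rightarrow> nat" where
  "lead_ord m [] j = 0"
| "lead_ord m (k # ks) j = (if j = k then m k + (\<Sum>l\<in>set ks. contact k l) else lead_ord m ks j)"

text \<open>The left-hand side is the leading order that \<open>j\<close> would receive if it stood
  at the head of this tail; so the head of every tail is a branch with the largest demand.\<close>

primrec greedy :: "(nat \<Rightarrow> nat) \<Rightarrow> nat list \<Rightarrow> bool" where
  "greedy m [] \<longleftrightarrow> True"
| "greedy m (k # ks) \<longleftrightarrow> (\<forall>j\<in>set ks. m j + (\<Sum>l\<in>set (k # ks) - {j}. contact j l) \<le> m k + (\<Sum>l\<in>set ks. contact k l)) \<and> greedy m ks"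

lemma greedy_exists:
  assumes "finite S"
  shows "\<exists>ks. distinct ks \<and> set ks = S \<and> greedy m ks"
  using assms
proof (induction S rule: finite_psubset_induct)
  case (psubset S)
  show ?case
  proof (cases "S = {}")
    case False
    define V where "V = (\<lambda>j. m j + (\<Sum>l\<in>S - {j}. contact j l))"
    have "Max (V ` S) \<in> V ` S" using psubset(1) False by (intro Max_in) auto
    then obtain k where k: "k \<in> S" "Max (V ` S) = V k" by auto
    have V: "V j \<le> V k" if "j \<in> S" for j using k(2) psubset(1) that by (metis Max_ge finite_imageI imageI)
    obtain ks where ks: "distinct ks" "set ks = S - {k}" "greedy m ks"
      using psubset.IH[of "S - {k}"] k(1) by auto
    have "set (k # ks) = S" using ks k by auto
    then show ?thesis using ks V by (intro exI[of _ "k # ks"]) (auto simp: V_def)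
  qed auto
qed

lemma lead_ord_le:
  assumes "distinct ks" "set ks \<subseteq> A" "k \<in> set ks" "m k \<le> 2 * L k"
  shows "lead_ord m ks k \<le> total_contact k"
  using assms(1-3)
proof (induction ks)
  case (Cons j ks)
  show ?case
  proof (cases "k = j")
    case True
    have "lead_ord m (j # ks) k \<le> contact k k + (\<Sum>l\<in>set ks. contact k l)"
      using True assms(4) by (simp add: contact_self)
    also have "\<dots> = (\<Sum>l\<in>insert k (set ks). contact k l)" using Cons.prems True by simp
    also have "\<dots> \<le> total_contact k" unfolding total_contact_def
      using Cons.prems True finite_A by (intro sum_mono2) auto
    finally show ?thesis .
  qed (use Cons in auto)
qed simp

text \<open>Each unordered pair of branches is counted once, at its earlier member, so the sum of
  the leading orders is the same for all orderings. Doubling expresses this through the symmetric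
  sum over all ordered pairs without subtraction.\<close>

lemma sum_lead_ord:
  assumes "distinct ks"
  shows "2 * (\<Sum>k\<in>set ks. lead_ord m ks k) + (\<Sum>k\<in>set ks. contact k k) =
         2 * (\<Sum>k\<in>set ks. m k) + (\<Sum>k\<in>set ks. \<Sum>l\<in>set ks. contact k l)"
  using assms
proof (induction ks)
  case (Cons j ks)
  have 1: "(\<Sum>k\<in>set ks. lead_ord m (j # ks) k) = (\<Sum>k\<in>set ks. lead_ord m ks k)"
    by (rule sum.cong) (use Cons.prems in auto)
  have 2: "(\<Sum>k\<in>set ks. contact k j) = (\<Sum>l\<in>set ks. contact j l)"
    by (rule sum.cong) (auto simp: contact_commute)
  have "(\<Sum>k\<in>set (j # ks). \<Sum>l\<in>set (j # ks). contact k l) =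
     contact j j + (\<Sum>l\<in>set ks. contact j l) + ((\<Sum>k\<in>set ks. contact k j) + (\<Sum>k\<in>set ks. \<Sum>l\<in>set ks. contact k l))"
    using Cons.prems by (simp add: sum.distrib)
  then show ?case using Cons 1 unfolding 2 by simp
qed simp

text \<open>The factors before \<open>k\<close> cancel, leaving \<open>x^i\<close> over the product
  of the branches from \<open>k\<close> on. If \<open>ell j\<close> is the smallest of these at a
  given point, each other factor is bounded below by its contact with \<open>j\<close>, and what
  remains is at most a constant times \<open>x^(m j) / ell j\<close>.\<close>

lemma horner_single_bound:
  assumes "set ks \<subseteq> A" "distinct ks" "greedy m ks" "k \<in> set ks" "lead_ord m ks k \<le> i"
  shows "\<exists>C\<ge>0. \<exists>e>0. \<forall>x y :: real. (x, y) \<noteq> (0, 0) \<longrightarrow> \<bar>x\<bar> < e \<longrightarrow>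
    norm (ratio_real (horner ks (single k i)) (ell_prod ks) (x, y)) \<le>
      C * (\<Sum>j\<in>set ks. \<bar>x\<bar> ^ m j / norm (ell j (of_real x) (of_real y)))"
  using assms
proof (induction ks)
  case (Cons k' ks)
  show ?case
  proof (cases "k' = k")
    case False
    then obtain C e where C: "C \<ge> 0" "e > 0" "\<And>x y :: real. (x, y) \<noteq> (0, 0) \<Longrightarrow> \<bar>x\<bar> < e \<Longrightarrow>
      norm (ratio_real (horner ks (single k i)) (ell_prod ks) (x, y)) \<le>
      C * (\<Sum>j\<in>set ks. \<bar>x\<bar> ^ m j / norm (ell j (of_real x) (of_real y)))"
      using Cons by auto
    show ?thesis
    proof (rule exI[of _ C], intro conjI exI[of _ e] allI impI C(1,2))
      fix x y :: real assume xy: "(x, y) \<noteq> (0, 0)" "\<bar>x\<bar> < e"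
      have "ell k' (of_real x) (of_real y) \<noteq> 0" using ell_nonzero[OF _ xy(1)] Cons.prems by simp
      then have "ratio_real (horner (k' # ks) (single k i)) (ell_prod (k' # ks)) (x, y) = ratio_real (horner ks (single k i)) (ell_prod ks) (x, y)"
        using False by (simp add: ratio_real_def single_def)
      also have "norm \<dots> \<le> C * (\<Sum>j\<in>set ks. \<bar>x\<bar> ^ m j / norm (ell j (of_real x) (of_real y)))" by (rule C(3)[OF xy])
      also have "\<dots> \<le> C * (\<Sum>j\<in>set (k' # ks). \<bar>x\<bar> ^ m j / norm (ell j (of_real x) (of_real y)))"
        using C(1) by (intro mult_left_mono sum_mono2) auto
      finally show "norm (ratio_real (horner (k' # ks) (single k i)) (ell_prod (k' # ks)) (x, y)) \<le> C * (\<Sum>j\<in>set (k' # ks). \<bar>x\<bar> ^ m j / norm (ell j (of_real x) (of_real y)))" .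
    qed
  next
    case True
    define J where "J = set (k # ks)"
    have J: "finite J" "J \<subseteq> A" "J \<noteq> {}" using Cons.prems True by (auto simp: J_def)
    \<comment> \<open>Here greediness enters: whichever branch \<open>j\<close> of the tail is
      nearest to the point, the exponent \<open>i\<close> covers its demand.\<close>
    have grd: "m j + (\<Sum>l\<in>J - {j}. contact j l) \<le> i" if "j \<in> J" for j
    proof (cases "j = k")
      case jk: True
      then have "J - {j} = set ks" using Cons.prems(2) True by (auto simp: J_def)
      then show ?thesis using Cons.prems(5) True jk by simp
    next
      case False
      then show ?thesis using Cons.prems(3,5) True that by (auto simp: J_def intro: order_trans)
    qed
    obtain c e where c: "0 < c" "c \<le> 1" "0 < e" "e \<le> 1"
    "\<And>j l x y :: real. j \<in> A \<Longrightarrow> l \<in> A \<Longrightarrow> \<bar>x\<bar> < e \<Longrightarrow>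
       norm (ell j (of_real x) (of_real y)) \<le> norm (ell l (of_real x) (of_real y)) \<Longrightarrow>
       c * \<bar>x\<bar> ^ contact j l \<le> norm (ell l (of_real x) (of_real y))" using contact_lower by metis
    define n where "n = card J - 1"
    show ?thesis
    proof (rule exI[of _ "inverse (c ^ n)"], intro conjI exI[of _ e] allI impI)
      fix x y :: real assume xy: "(x, y) \<noteq> (0, 0)" "\<bar>x\<bar> < e"
      let ?l = "\<lambda>j. norm (ell j (of_real x) (of_real y))"
      have lpos: "?l j > 0" if "j \<in> J" for j using ell_nonzero[OF _ xy(1)] J that by auto
      have "Min (?l ` J) \<in> ?l ` J" using J by (intro Min_in) auto
      then obtain j where j: "j \<in> J" "Min (?l ` J) = ?l j" by auto
      have min: "?l j \<le> ?l l" if "l \<in> J" for l using j(2) J(1) that by (metis Min_le finite_imageI imageI)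
      let ?s = "\<Sum>l\<in>J - {j}. contact j l"
      have "c ^ n * \<bar>x\<bar> ^ ?s = (\<Prod>l\<in>J - {j}. c * \<bar>x\<bar> ^ contact j l)"
        using J j by (simp add: prod.distrib power_sum n_def)
      also have "\<dots> \<le> (\<Prod>l\<in>J - {j}. ?l l)"
      proof (rule prod_mono)
        fix l assume "l \<in> J - {j}"
        then show "0 \<le> c * \<bar>x\<bar> ^ contact j l \<and> c * \<bar>x\<bar> ^ contact j l \<le> ?l l"
          using c(1) c(5)[of j l x y] J(2) j(1) min[of l] xy(2) by auto
      qed
      finally have pr: "c ^ n * \<bar>x\<bar> ^ ?s \<le> (\<Prod>l\<in>J - {j}. ?l l)" .
      have "\<bar>x\<bar> ^ i \<le> \<bar>x\<bar> ^ (m j + ?s)" using grd[OF j(1)] xy c by (intro power_decreasing) auto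
      then have "c ^ n * \<bar>x\<bar> ^ i \<le> \<bar>x\<bar> ^ m j * (c ^ n * \<bar>x\<bar> ^ ?s)"
        using c by (simp add: power_add mult.left_commute)
      also have "\<dots> \<le> \<bar>x\<bar> ^ m j * (\<Prod>l\<in>J - {j}. ?l l)" using pr by (intro mult_left_mono) auto
      finally have key: "c ^ n * \<bar>x\<bar> ^ i \<le> \<bar>x\<bar> ^ m j * (\<Prod>l\<in>J - {j}. ?l l)" .
      have pos: "(\<Prod>l\<in>J - {j}. ?l l) > 0" using lpos by (intro prod_pos) auto
      have tot: "norm (ell_prod (k # ks) (of_real x) (of_real y)) = ?l j * (\<Prod>l\<in>J - {j}. ?l l)"
      proof -
        have "ell_prod (k # ks) (of_real x) (of_real y) = (\<Prod>l\<in>J. ell l (of_real x) (of_real y))"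
          unfolding J_def by (rule ell_prod_set) (use Cons.prems True in simp)
        then show ?thesis by (simp only: prod_norm[symmetric] prod.remove[OF J(1) j(1)] norm_mult)
      qed
      have "horner (k # ks) (single k i) (of_real x) (of_real y) = of_real x ^ i"
        using Cons.prems True horner_zero[of ks "single k i"] by (simp add: single_def poly_monom) (metis (no_types, lifting) horner_zero mult_eq_0_iff)
      then have "norm (ratio_real (horner (k # ks) (single k i)) (ell_prod (k # ks)) (x, y)) = \<bar>x\<bar> ^ i / (?l j * (\<Prod>l\<in>J - {j}. ?l l))"
        unfolding ratio_real_def fst_conv snd_conv norm_divide tot by (simp add: norm_power)
      also have "\<dots> \<le> inverse (c ^ n) * (\<bar>x\<bar> ^ m j / ?l j)"
        using key pos lpos[OF j(1)] c by (simp add: field_simps)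
      also have "\<dots> \<le> inverse (c ^ n) * (\<Sum>j\<in>J. \<bar>x\<bar> ^ m j / ?l j)"
        using J j c by (intro mult_left_mono member_le_sum) auto
      finally show "norm (ratio_real (horner (k' # ks) (single k i)) (ell_prod (k' # ks)) (x, y))
          \<le> inverse (c ^ n) * (\<Sum>j\<in>set (k' # ks). \<bar>x\<bar> ^ m j / ?l j)" by (simp add: J_def True)
    qed (use c in auto)
  qed
qed simp

end

section \<open>Integrability of quotients by the branches\<close>

context branches
begin

lemma continuous_ell: "continuous_on UNIV (\<lambda>z :: real \<times> real. ell k (of_real (fst z)) (of_real (snd z)))"
  unfolding ell_def by (intro continuous_intros)

lemma continuous_ell_prod: "continuous_on UNIV (\<lambda>z :: real \<times> real. ell_prod ks (of_real (fst z)) (of_real (snd z)))"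
  by (induction ks) (auto intro!: continuous_intros continuous_ell)

lemma continuous_horner: "continuous_on UNIV (\<lambda>z :: real \<times> real. horner ks a (of_real (fst z)) (of_real (snd z)))"
  by (induction ks) (auto intro!: continuous_intros continuous_ell)

lemma measurable_ell [measurable]:
  "(\<lambda>z :: real \<times> real. ell k (of_real (fst z)) (of_real (snd z))) \<in> borel_measurable borel"
  by (rule borel_measurable_continuous_onI[OF continuous_ell])

lemma measurable_ratio_horner:
  "ratio_real (horner ks a) (ell_prod ks) \<in> borel_measurable borel"
proof -
  have [measurable]: "(\<lambda>z :: real \<times> real. horner ks a (of_real (fst z)) (of_real (snd z))) \<in> borel_measurable borel"
    "(\<lambda>z :: real \<times> real. ell_prod ks (of_real (fst z)) (of_real (snd z))) \<in> borel_measurable borel"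
    by (intro borel_measurable_continuous_onI continuous_horner continuous_ell_prod)+
  show ?thesis unfolding ratio_real_def[abs_def] by measurable
qed

text \<open>The power \<open>-p\<close> of the modulus is split into \<open>-(1 - \<eta>)\<close>,
  estimated through the real part \<open>y + q k\<close>, and \<open>-(p - 1 + \<eta>)\<close>,
  estimated through the imaginary part \<open>x^(2 L k)\<close>. Without \<open>\<eta>\<close> the
  first factor would be the inverse of \<open>y + q k\<close>, which is not integrable in
  \<open>y\<close>.\<close>

lemma branch_term_pointwise:
  fixes x y p \<eta> :: real
  assumes x: "x \<noteq> 0" and y: "y + poly (q k) x \<noteq> 0" and p: "p \<ge> 1" and \<eta>: "0 < \<eta>" "\<eta> \<le> 1"
  shows "(\<bar>x\<bar> ^ m / norm (ell k (of_real x) (of_real y))) powr p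
    \<le> \<bar>x\<bar> powr (real m * p - 2 * real (L k) * (p - 1 + \<eta>)) * \<bar>y + poly (q k) x\<bar> powr (-(1 - \<eta>))"
proof -
  define l where "l = norm (ell k (of_real x) (of_real y))"
  have l1: "\<bar>y + poly (q k) x\<bar> \<le> l" and l2: "\<bar>x\<bar> ^ (2 * L k) \<le> l"
    unfolding l_def by (rule norm_ell_ge)+
  have l: "l > 0" using l1 y by linarith
  have "(\<bar>x\<bar> ^ m / l) powr p = \<bar>x\<bar> powr (real m * p) * l powr (- p)"
    using x l by (simp add: powr_divide powr_minus_divide powr_realpow[symmetric] powr_powr)
  also have "l powr (- p) = l powr (-(1 - \<eta>)) * l powr (-(p - 1 + \<eta>))"
    by (simp flip: powr_add)
  also have "l powr (-(1 - \<eta>)) \<le> \<bar>y + poly (q k) x\<bar> powr (-(1 - \<eta>))"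
    using \<eta> l1 y by (intro powr_mono2') auto
  also have "l powr (-(p - 1 + \<eta>)) \<le> (\<bar>x\<bar> ^ (2 * L k)) powr (-(p - 1 + \<eta>))"
    using \<eta> l2 x p by (intro powr_mono2') auto
  also have "(\<bar>x\<bar> ^ (2 * L k)) powr (-(p - 1 + \<eta>)) = \<bar>x\<bar> powr (- (2 * real (L k) * (p - 1 + \<eta>)))"
    using x by (simp add: powr_realpow[symmetric] powr_powr algebra_simps)
  finally have "(\<bar>x\<bar> ^ m / l) powr p \<le> \<bar>x\<bar> powr (real m * p) * (\<bar>y + poly (q k) x\<bar> powr (-(1 - \<eta>)) * \<bar>x\<bar> powr (- (2 * real (L k) * (p - 1 + \<eta>))))"
    by (simp add: mult_left_mono mult_right_mono)
  also have "\<dots> = \<bar>x\<bar> powr (real m * p - 2 * real (L k) * (p - 1 + \<eta>)) * \<bar>y + poly (q k) x\<bar> powr (-(1 - \<eta>))"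
    using powr_add[of "\<bar>x\<bar>" "real m * p" "- (2 * real (L k) * (p - 1 + \<eta>))"] by (simp only: mult_ac diff_conv_add_uminus)
  finally show ?thesis by (simp add: l_def)
qed

text \<open>The condition on \<open>m\<close> is the one predicted by scaling. It is strict, which
  leaves room for the loss \<open>2 L k * \<eta>\<close> in the exponent of \<open>x\<close> caused
  by the pointwise splitting.\<close>

lemma branch_term_Lp:
  assumes k: "k \<in> A" and p: "p \<ge> 1" and m: "p * (real m - 2 * real (L k)) + 2 * real (L k) > -1" and e: "e > 0"
  shows "Lp_sq p e (\<lambda>z. \<bar>fst z\<bar> ^ m / norm (ell k (of_real (fst z)) (of_real (snd z))))"
proof -
  have Lk: "real (L k) > 0" using L_pos[OF k] by simp
  \<comment> \<open>\<open>s\<close> is the slack in the hypothesis. The choice of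
    \<open>\<eta>\<close> below spends at most half of it, so the exponent \<open>b\<close> of
    \<open>x\<close> stays above -1.\<close>
  define s where "s = p * (real m - 2 * real (L k)) + 2 * real (L k) + 1"
  have s: "s > 0" using m by (simp add: s_def)
  define \<eta> where "\<eta> = min 1 (s / (4 * real (L k)))"
  have \<eta>: "0 < \<eta>" "\<eta> \<le> 1" using s Lk by (auto simp: \<eta>_def)
  define b where "b = real m * p - 2 * real (L k) * (p - 1 + \<eta>)"
  have "\<eta> \<le> s / (4 * real (L k))" by (simp add: \<eta>_def)
  then have "2 * real (L k) * \<eta> \<le> s / 2" using Lk by (simp add: field_simps)
  moreover have "b = s - 1 - 2 * real (L k) * \<eta>" by (simp add: b_def s_def algebra_simps)
  ultimately have b: "b > -1" using s by simp
  have "compact ((\<lambda>x. poly (q k) x) ` {-e..e})" by (intro compact_continuous_image continuous_intros) auto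
  then have "bounded ((\<lambda>x. poly (q k) x) ` {-e..e})" by (rule compact_imp_bounded)
  then obtain B where B: "\<And>x. x \<in> {-e..e} \<Longrightarrow> \<bar>poly (q k) x\<bar> \<le> B"
    unfolding bounded_iff by (metis image_eqI real_norm_def)
  \<comment> \<open>The translation \<open>u = y + q k x\<close> moves the interval for
    \<open>y\<close> into \<open>[-R, R]\<close> for every \<open>x\<close> considered, so
    \<open>K\<close> bounds the inner integral independently of \<open>x\<close>.\<close>
  define R where "R = e + B"
  define K where "K = (\<integral>\<^sup>+u. ennreal (\<bar>u\<bar> powr (-(1 - \<eta>))) * indicator {-R..R} u \<partial>lborel)"
  have K: "K < \<infinity>" unfolding K_def using \<eta> by (intro nn_integral_powr_finite) auto
  define h where "h = (\<lambda>z :: real \<times> real. \<bar>fst z\<bar> ^ m / norm (ell k (of_real (fst z)) (of_real (snd z))))"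
  define f where "f = (\<lambda>z. ennreal ((indicator (sq e) z * norm (h z)) powr p))"
  have [measurable]: "(\<lambda>z :: real \<times> real. \<bar>fst z\<bar> ^ m) \<in> borel_measurable borel"
    by (intro borel_measurable_continuous_onI continuous_intros)
  have [measurable]: "h \<in> borel_measurable borel" unfolding h_def by measurable
  have fm: "f \<in> borel_measurable borel" unfolding f_def by measurable
  have "(\<integral>\<^sup>+z. f z \<partial>lborel) = (\<integral>\<^sup>+x. \<integral>\<^sup>+y. f (x, y) \<partial>lborel \<partial>lborel)" by (rule nn_integral_real_pair[OF fm])
  also have "\<dots> \<le> (\<integral>\<^sup>+x. (ennreal (\<bar>x\<bar> powr b) * indicator {-e..e} x) * K \<partial>lborel)"
  proof (rule nn_integral_mono_AE)
    show "AE x in lborel. (\<integral>\<^sup>+y. f (x, y) \<partial>lborel) \<le> (ennreal (\<bar>x\<bar> powr b) * indicator {-e..e} x) * K"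
      using AE_lborel_singleton[of "0::real"]
    proof eventually_elim
      case (elim x)
      show ?case
      proof (cases "\<bar>x\<bar> < e")
        case False
        then have "f (x, y) = 0" for y by (simp add: f_def)
        then show ?thesis by simp
      next
        case True
        define c where "c = poly (q k) x"
        define g where "g = (\<lambda>u. ennreal (\<bar>u\<bar> powr (-(1 - \<eta>))) * indicator {-R..R} u)"
        have gm [measurable]: "g \<in> borel_measurable borel" unfolding g_def by measurable
        have cB: "\<bar>c\<bar> \<le> B" unfolding c_def by (rule B) (use True in auto)
        have "(\<integral>\<^sup>+y. f (x, y) \<partial>lborel) \<le> (\<integral>\<^sup>+y. ennreal (\<bar>x\<bar> powr b) * g (c + 1 * y) \<partial>lborel)"
        proof (rule nn_integral_mono_AE)
          show "AE y in lborel. f (x, y) \<le> ennreal (\<bar>x\<bar> powr b) * g (c + 1 * y)"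
            using AE_lborel_singleton[of "- c"]
          proof eventually_elim
            case (elim y)
            show ?case
            proof (cases "\<bar>y\<bar> < e")
              case y: True
              have yc: "y + poly (q k) x \<noteq> 0" using elim by (simp add: c_def add_eq_0_iff2)
              have "f (x, y) = ennreal (h (x, y) powr p)" using y True by (simp add: f_def h_def)
              also have "\<dots> \<le> ennreal (\<bar>x\<bar> powr b * \<bar>y + c\<bar> powr (-(1 - \<eta>)))"
                using branch_term_pointwise[OF \<open>x \<noteq> 0\<close> yc p \<eta>, of m] by (intro ennreal_leI) (simp add: h_def b_def c_def)
              also have "\<dots> = ennreal (\<bar>x\<bar> powr b) * ennreal (\<bar>y + c\<bar> powr (-(1 - \<eta>)))" by (simp add: ennreal_mult)
              also have "ennreal (\<bar>y + c\<bar> powr (-(1 - \<eta>))) = g (c + 1 * y)"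
                using y cB by (auto simp: g_def R_def add.commute indicator_def)
              finally show ?thesis .
            qed (simp add: f_def)
          qed
        qed
        also have "\<dots> = ennreal (\<bar>x\<bar> powr b) * (\<integral>\<^sup>+y. g (c + 1 * y) \<partial>lborel)"
          by (rule nn_integral_cmult) measurable
        also have "(\<integral>\<^sup>+y. g (c + 1 * y) \<partial>lborel) = K"
          using nn_integral_real_affine[OF gm, of 1 c] by (simp add: K_def g_def)
        finally have "(\<integral>\<^sup>+y. f (x, y) \<partial>lborel) \<le> ennreal (\<bar>x\<bar> powr b) * K" .
        moreover have "x \<in> {-e..e}" using True by auto
        ultimately show ?thesis by simp
      qed
    qed
  qed
  also have "\<dots> = (\<integral>\<^sup>+x. ennreal (\<bar>x\<bar> powr b) * indicator {-e..e} x \<partial>lborel) * K"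
    by (rule nn_integral_multc) measurable
  also have "\<dots> < \<infinity>" using nn_integral_powr_finite[OF b, of e] K by (simp add: ennreal_mult_less_top)
  finally show ?thesis by (simp add: Lp_sq_def f_def h_def)
qed

section \<open>Necessity of the leading orders: normal forms along vertical lines\<close>

lemma horner_poly:
  "\<exists>T :: complex poly. degree T \<le> length ks \<and> (\<forall>w. poly T w = horner ks a x (c + d * w))"
proof (induction ks)
  case Nil then show ?case by (intro exI[of _ 0]) auto
next
  case (Cons k ks)
  then obtain T where T: "degree T \<le> length ks" "\<And>w. poly T w = horner ks a x (c + d * w)" by blast
  define Z where "Z = [:c - phi k x, d:]"
  have "degree (Z * T) \<le> degree Z + degree T" by (rule degree_mult_le)
  also have "\<dots> \<le> Suc (length ks)" using T by (simp add: Z_def)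
  finally have "degree ([:poly (a k) x:] + Z * T) \<le> Suc (length ks)" by (intro degree_add_le) auto
  moreover have "poly ([:poly (a k) x:] + Z * T) w = horner (k # ks) a x (c + d * w)" for w
    by (simp add: T(2) Z_def ell_phi algebra_simps)
  ultimately show ?case by (intro exI[of _ "[:poly (a k) x:] + Z * T"]) auto
qed

text \<open>Put \<open>y = - q k + x^(2 L k) * w\<close>. The value of the normal form at
  \<open>w = -\<i>\<close> is \<open>a k\<close>, because all other terms contain
  \<open>ell k\<close>. At the real nodes \<open>w = t + i\<close> it is the quotient times the
  product of the branches, and that product is bounded by the contacts with
  \<open>k\<close>.\<close>

lemma horner_slice_bound:
  assumes ks: "set (k # ks) \<subseteq> A" "distinct (k # ks)"
  shows "\<exists>K>0. \<forall>x t :: real. 0 < x \<longrightarrow> x \<le> 1 \<longrightarrow> 0 \<le> t \<longrightarrow> t \<le> 1 \<longrightarrow>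
    norm (poly (a k) (of_real x)) \<le> K * x ^ (\<Sum>l\<in>set (k # ks). contact k l) *
      (\<Sum>i\<le>length (k # ks). norm (ratio_real (horner (k # ks) a) (ell_prod (k # ks))
          (x, - poly (q k) x + x ^ (2 * L k) * (t + real i))))"
proof -
  define n where "n = length (k # ks)"
  obtain K where K: "K > 0" "\<And>(T :: complex poly) t. degree T \<le> n \<Longrightarrow> t \<in> {0..1} \<Longrightarrow>
     norm (poly T (-\<i>)) \<le> K * (\<Sum>m\<le>n. norm (poly T (of_real (t + real m))))"
    using poly_bound_off_axis[of n] by blast
  \<comment> \<open>The width \<open>n + 1\<close> covers all nodes \<open>t + i\<close> with
    \<open>t \<le> 1\<close> and \<open>i \<le> n\<close>.\<close>
  obtain C where C: "C > 0" "\<And>x \<tau> :: real. 0 < x \<Longrightarrow> x \<le> 1 \<Longrightarrow> 0 \<le> \<tau> \<Longrightarrow> \<tau> \<le> real n + 1 \<Longrightarrow>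
    norm (ell_prod (k # ks) (of_real x) (of_real (- poly (q k) x + x ^ (2 * L k) * \<tau>))) \<le> C * x ^ (\<Sum>l\<in>set (k # ks). contact k l)"
    using ell_prod_upper[OF _ ks, of k "real n + 1"] ks(1) by auto
  show ?thesis
  proof (intro exI[of _ "K * C"] conjI allI impI)
    show "K * C > 0" using K C by simp
    fix x t :: real assume x: "0 < x" "x \<le> 1" and t: "0 \<le> t" "t \<le> 1"
    let ?c = "- poly (q k) x" and ?d = "x ^ (2 * L k)" and ?s = "\<Sum>l\<in>set (k # ks). contact k l"
    let ?r = "\<lambda>i. norm (ratio_real (horner (k # ks) a) (ell_prod (k # ks)) (x, ?c + ?d * (t + real i)))"
    obtain T where T: "degree T \<le> n" "\<And>w. poly T w = horner (k # ks) a (of_real x) (of_real ?c + of_real ?d * w)"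
      using horner_poly[of "k # ks" a "of_real x" "of_real ?c" "of_real ?d"] unfolding n_def by blast
    \<comment> \<open>The parameter value \<open>-\<i>\<close> is the point of the branch over
      \<open>x\<close>.\<close>
    have "of_real ?c + of_real ?d * (- \<i>) = phi k (of_real x)"
      by (simp add: phi_def poly_qc_of_real mult.commute)
    then have Ti: "poly T (-\<i>) = poly (a k) (of_real x)" using T(2)[of "-\<i>"] horner_phi[of k ks a "of_real x"] by simp
    have nod: "norm (poly T (of_real (t + real i))) \<le> C * x ^ ?s * ?r i" if "i \<le> n" for i
    proof -
      let ?y = "?c + ?d * (t + real i)"
      have ne: "ell_prod (k # ks) (of_real x) (of_real ?y) \<noteq> 0"
        by (rule ell_prod_nonzero[OF ks(1)]) (use x in auto)
      have "poly T (of_real (t + real i)) = horner (k # ks) a (of_real x) (of_real ?y)" unfolding T(2) by simp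
      also have "\<dots> = ratio_real (horner (k # ks) a) (ell_prod (k # ks)) (x, ?y) * ell_prod (k # ks) (of_real x) (of_real ?y)"
        unfolding ratio_real_def fst_conv snd_conv by (simp only: times_divide_eq_left nonzero_mult_div_cancel_right[OF ne])
      finally have "norm (poly T (of_real (t + real i))) = ?r i * norm (ell_prod (k # ks) (of_real x) (of_real ?y))"
        by (simp only: norm_mult)
      also have "\<dots> \<le> ?r i * (C * x ^ ?s)" using C(2)[OF x, of "t + real i"] t that by (intro mult_left_mono) auto
      finally show ?thesis by (simp add: mult.commute)
    qed
    have "norm (poly (a k) (of_real x)) \<le> K * (\<Sum>i\<le>n. norm (poly T (of_real (t + real i))))"
      using K(2)[OF T(1), of t] t unfolding Ti by simp
    also have "\<dots> \<le> K * (\<Sum>i\<le>n. C * x ^ ?s * ?r i)" using K(1) nod by (intro mult_left_mono sum_mono) auto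
    also have "\<dots> = K * C * x ^ ?s * (\<Sum>i\<le>n. ?r i)" by (simp add: sum_distrib_left mult_ac)
    finally show "norm (poly (a k) (of_real x)) \<le> K * C * x ^ ?s * (\<Sum>i\<le>length (k # ks). ?r i)"
      unfolding n_def .
  qed
qed

text \<open>If \<open>a k\<close> had order \<open>i\<close> below the leading order, the slice
  bound would force the p-th power of the quotient, integrated over a strip of width comparable to
  \<open>x^(2 L k)\<close>, to be at least a constant times \<open>x^(p (i - S) + 2 L k)\<close>,
  whose exponent is at most -1.\<close>

lemma horner_head_eq_0:
  assumes ks: "set (k # ks) \<subseteq> A" "distinct (k # ks)" and p: "p \<ge> 1"
    and m: "p * (real m - 1 - 2 * real (L k)) + 2 * real (L k) \<le> -1"
    and e: "e > 0" and Lp: "Lp_sq p e (ratio_real (horner (k # ks) a) (ell_prod (k # ks)))"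
    and deg: "\<And>i. m + (\<Sum>l\<in>set ks. contact k l) \<le> i \<Longrightarrow> coeff (a k) i = 0"
  shows "a k = 0"
proof (rule ccontr)
  assume "a k \<noteq> 0"
  then obtain i u where u: "a k = monom 1 i * u" "poly u 0 \<noteq> 0" "coeff (a k) i \<noteq> 0"
    by (rule poly_factor_monom_ex)
  \<comment> \<open>\<open>S\<close> includes the contact \<open>2 * L k\<close> of the branch with
    itself. Since \<open>i\<close> misses the leading order by at least 1,
    \<open>i - S \<le> m - 1 - 2 L k\<close>.\<close>
  define S where "S = (\<Sum>l\<in>set (k # ks). contact k l)"
  have S: "S = 2 * L k + (\<Sum>l\<in>set ks. contact k l)" using ks(2) by (simp add: S_def contact_self)
  have "i < m + (\<Sum>l\<in>set ks. contact k l)" using deg u(3) by (meson not_le)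
  then have "real i + 1 \<le> real m + (real S - 2 * real (L k))" unfolding S by linarith
  then have "real i - real S \<le> real m - 1 - 2 * real (L k)" by linarith
  then have "p * (real i - real S) \<le> p * (real m - 1 - 2 * real (L k))" using p by (intro mult_left_mono) auto
  then have expo: "p * (real i - real S) + 2 * real (L k) \<le> -1" using m by linarith
  define n where "n = length (k # ks)"
  define r where "r = ratio_real (horner (k # ks) a) (ell_prod (k # ks))"
  obtain K where K: "K > 0" "\<And>x t :: real. 0 < x \<Longrightarrow> x \<le> 1 \<Longrightarrow> 0 \<le> t \<Longrightarrow> t \<le> 1 \<Longrightarrow>
    norm (poly (a k) (of_real x)) \<le> K * x ^ S * (\<Sum>i\<le>n. norm (r (x, - poly (q k) x + x ^ (2 * L k) * (t + real i))))"
    using horner_slice_bound[OF ks, of a] unfolding S_def n_def r_def by blast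
  define c where "c = norm (poly u 0) / 2"
  have c: "c > 0" using u(2) by (simp add: c_def)
  have "eventually (\<lambda>x :: real. c < norm (poly u (of_real x))) (nhds 0)"
  proof (rule isCont_eventually_nhds[where P = "\<lambda>w. c < w"])
    show "isCont (\<lambda>x :: real. norm (poly u (of_real x))) 0" by (intro continuous_intros)
    show "eventually (\<lambda>w. c < w) (nhds (norm (poly u (of_real 0))))"
      using u(2) eventually_nhds_in_open[of "{c<..}" "norm (poly u 0)"] by (simp add: c_def)
  qed
  moreover have "eventually (\<lambda>x :: real. \<bar>- poly (q k) x\<bar> + \<bar>x\<bar> ^ (2 * L k) * (real n + 1) < e) (nhds 0)"
  proof (rule isCont_eventually_nhds[where P = "\<lambda>w. w < e"])
    show "isCont (\<lambda>x :: real. \<bar>- poly (q k) x\<bar> + \<bar>x\<bar> ^ (2 * L k) * (real n + 1)) 0" by (intro continuous_intros)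
    have "\<bar>- poly (q k) 0\<bar> + \<bar>0\<bar> ^ (2 * L k) * (real n + 1) = 0" using q_0[of k] L_pos[of k] ks by simp
    then show "eventually (\<lambda>w. w < e) (nhds (\<bar>- poly (q k) 0\<bar> + \<bar>0\<bar> ^ (2 * L k) * (real n + 1)))"
      using e eventually_nhds_in_open[of "{..<e}" 0] by simp
  qed
  ultimately have "eventually (\<lambda>x :: real. c < norm (poly u (of_real x)) \<and> \<bar>- poly (q k) x\<bar> + \<bar>x\<bar> ^ (2 * L k) * (real n + 1) < e) (nhds 0)"
    by eventually_elim simp
  then obtain d0 where d0: "d0 > 0" "\<And>x :: real. dist x 0 < d0 \<Longrightarrow> c < norm (poly u (of_real x)) \<and> \<bar>- poly (q k) x\<bar> + \<bar>x\<bar> ^ (2 * L k) * (real n + 1) < e"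
    unfolding eventually_nhds_metric by (elim exE conjE) simp
  define d where "d = min (min d0 e) 1"
  have d: "d > 0" "d \<le> e" "d \<le> 1" "\<And>x. 0 < x \<Longrightarrow> x < d \<Longrightarrow> c < norm (poly u (of_real x))"
    "\<And>x. 0 < x \<Longrightarrow> x < d \<Longrightarrow> \<bar>- poly (q k) x\<bar> + x ^ (2 * L k) * (real n + 1) < e"
  proof -
    fix x assume x: "0 < x" "x < d"
    have "c < norm (poly u (of_real x)) \<and> \<bar>- poly (q k) x\<bar> + \<bar>x\<bar> ^ (2 * L k) * (real n + 1) < e"
      by (rule d0(2)) (use x in \<open>auto simp: d_def\<close>)
    then show "c < norm (poly u (of_real x))" "\<bar>- poly (q k) x\<bar> + x ^ (2 * L k) * (real n + 1) < e"
      using x by simp_all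
  qed (use d0 e in \<open>auto simp: d_def\<close>)
  define f where "f = (\<lambda>z. ennreal ((indicator (sq e) z * norm (r z)) powr p))"
  have [measurable]: "r \<in> borel_measurable borel" unfolding r_def by (rule measurable_ratio_horner)
  have fm [measurable]: "f \<in> borel_measurable borel" unfolding f_def by measurable
  define \<Phi> where "\<Phi> = (\<lambda>x. \<integral>\<^sup>+y. f (x, y) \<partial>lborel)"
  have fin: "(\<integral>\<^sup>+x. \<Phi> x \<partial>lborel) < \<infinity>"
    using Lp nn_integral_real_pair[OF fm] by (simp add: Lp_sq_def f_def r_def \<Phi>_def)
  \<comment> \<open>From \<open>c * x^i \<le> |a k| \<le> K * x^S * (sum of n + 1 terms)\<close>:
    raise to the power \<open>p\<close> and apply \<open>powr_sum_le\<close>, which costs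
    \<open>(n + 1)^p\<close>.\<close>
  define c1 where "c1 = (c / K) powr p / real (Suc n) powr p"
  have c1: "c1 > 0" using c K by (simp add: c1_def)
  have point: "ennreal (c1 * x powr (p * (real i - real S))) \<le> (\<Sum>j\<le>n. f (x, - poly (q k) x + x ^ (2 * L k) * (t + real j)))"
    if x: "0 < x" "x < d" and t: "0 \<le> t" "t \<le> 1" for x t
  proof -
    let ?y = "\<lambda>j. - poly (q k) x + x ^ (2 * L k) * (t + real j)"
    have "c * x ^ i \<le> norm (poly (a k) (of_real x))"
      using d(4)[OF x] x by (simp add: u(1) poly_monom norm_mult norm_power mult.commute)
    also have "\<dots> \<le> K * x ^ S * (\<Sum>j\<le>n. norm (r (x, ?y j)))" using K(2)[of x t] x t d by simp
    finally have "c / K * (x ^ i / x ^ S) \<le> (\<Sum>j\<le>n. norm (r (x, ?y j)))"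
      using K(1) x by (simp add: field_simps)
    also have "x ^ i / x ^ S = x powr (real i - real S)" using x by (simp add: powr_diff powr_realpow)
    finally have "(c / K * x powr (real i - real S)) powr p \<le> (\<Sum>j\<le>n. norm (r (x, ?y j))) powr p"
      using c K p by (intro powr_mono2) auto
    also have "\<dots> \<le> real (card {..n}) powr p * (\<Sum>j\<le>n. norm (r (x, ?y j)) powr p)"
      using p by (intro powr_sum_le) auto
    finally have le: "(c / K * x powr (real i - real S)) powr p \<le> real (card {..n}) powr p * (\<Sum>j\<le>n. norm (r (x, ?y j)) powr p)" .
    then have "(c / K) powr p * x powr (p * (real i - real S)) \<le> real (Suc n) powr p * (\<Sum>j\<le>n. norm (r (x, ?y j)) powr p)"
    proof -
      have "(c / K * x powr (real i - real S)) powr p = (c / K) powr p * (x powr (real i - real S)) powr p"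
        by (rule powr_mult)
      then have "(c / K * x powr (real i - real S)) powr p = (c / K) powr p * x powr (p * (real i - real S))"
        by (simp add: powr_powr mult.commute)
      then show ?thesis using le by simp
    qed
    then have "c1 * x powr (p * (real i - real S)) \<le> (\<Sum>j\<le>n. norm (r (x, ?y j)) powr p)"
      by (simp add: c1_def field_simps)
    moreover have "f (x, ?y j) = ennreal (norm (r (x, ?y j)) powr p)" if "j \<le> n" for j
    proof -
      have "\<bar>?y j\<bar> \<le> \<bar>- poly (q k) x\<bar> + \<bar>x ^ (2 * L k) * (t + real j)\<bar>" by (rule abs_triangle_ineq)
      also have "\<bar>x ^ (2 * L k) * (t + real j)\<bar> = x ^ (2 * L k) * (t + real j)" using x t by simp
      also have "\<dots> \<le> x ^ (2 * L k) * (real n + 1)" using x t that by (intro mult_left_mono) auto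
      also have "\<bar>- poly (q k) x\<bar> + x ^ (2 * L k) * (real n + 1) < e" using d(5)[OF x] .
      finally show ?thesis using x d by (simp add: f_def)
    qed
    ultimately show ?thesis by (simp add: ennreal_leI)
  qed
  have slice: "ennreal (x ^ (2 * L k) * (c1 * x powr (p * (real i - real S)))) \<le> of_nat (Suc n) * \<Phi> x"
    if x: "0 < x" "x < d" for x
  proof -
    let ?c = "\<lambda>j. - poly (q k) x + x ^ (2 * L k) * real j" and ?d = "x ^ (2 * L k)"
    let ?v = "c1 * x powr (p * (real i - real S))"
    have dpos: "?d > 0" using x by simp
    have fx: "(\<lambda>y. f (x, y)) \<in> borel_measurable borel" by measurable
    \<comment> \<open>The Jacobian \<open>x^(2 L k)\<close> of the strip appears here. Integrating
      over all \<open>t\<close> and not only over \<open>[0, 1]\<close> makes every one of the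
      \<open>n + 1\<close> nodes contribute exactly \<open>\<Phi> x\<close>.\<close>
    have aff: "ennreal ?d * (\<integral>\<^sup>+t. f (x, ?c j + ?d * t) \<partial>lborel) = \<Phi> x" for j
      unfolding \<Phi>_def using nn_integral_real_affine[OF fx, of ?d "?c j"] dpos x by simp
    have "ennreal ?v = (\<integral>\<^sup>+t. ennreal ?v * indicator {0..1::real} t \<partial>lborel)"
      by (simp add: nn_integral_cmult_indicator)
    also have "\<dots> \<le> (\<integral>\<^sup>+t. (\<Sum>j\<le>n. f (x, ?c j + ?d * t)) \<partial>lborel)"
    proof (rule nn_integral_mono)
      fix t :: real
      show "ennreal ?v * indicator {0..1} t \<le> (\<Sum>j\<le>n. f (x, ?c j + ?d * t))"
        using point[OF x, of t] by (cases "t \<in> {0..1}") (auto simp: algebra_simps)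
    qed
    also have "\<dots> = (\<Sum>j\<le>n. (\<integral>\<^sup>+t. f (x, ?c j + ?d * t) \<partial>lborel))"
      by (rule nn_integral_sum) measurable
    finally have "ennreal ?d * ennreal ?v \<le> ennreal ?d * (\<Sum>j\<le>n. (\<integral>\<^sup>+t. f (x, ?c j + ?d * t) \<partial>lborel))"
      by (rule mult_left_mono) simp
    also have "\<dots> = (\<Sum>j\<le>n. \<Phi> x)" by (simp only: sum_distrib_left aff)
    also have "\<dots> = of_nat (Suc n) * \<Phi> x" by simp
    finally show ?thesis using dpos c1 by (simp add: ennreal_mult)
  qed
  let ?w = "p * (real i - real S) + 2 * real (L k)"
  have \<Phi>m [measurable]: "\<Phi> \<in> borel_measurable borel" unfolding \<Phi>_def by measurable
  have "ennreal c1 * (\<integral>\<^sup>+x. ennreal (x powr ?w) * indicator {0<..<d} x \<partial>lborel)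
     = (\<integral>\<^sup>+x. ennreal c1 * (ennreal (x powr ?w) * indicator {0<..<d} x) \<partial>lborel)"
    by (rule nn_integral_cmult[symmetric]) measurable
  also have "\<dots> \<le> (\<integral>\<^sup>+x. of_nat (Suc n) * \<Phi> x \<partial>lborel)"
  proof (rule nn_integral_mono)
    fix x :: real
    show "ennreal c1 * (ennreal (x powr ?w) * indicator {0<..<d} x) \<le> of_nat (Suc n) * \<Phi> x"
    proof (cases "0 < x \<and> x < d")
      case True
      have "x ^ (2 * L k) * (c1 * x powr (p * (real i - real S))) = c1 * x powr ?w"
        using True by (simp add: powr_add powr_realpow[symmetric])
      then have "ennreal (c1 * x powr ?w) \<le> of_nat (Suc n) * \<Phi> x" using slice[of x] True by (simp only:)
      moreover have "ennreal (c1 * x powr ?w) = ennreal c1 * (ennreal (x powr ?w) * indicator {0<..<d} x)"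
        using True c1 by (simp add: ennreal_mult)
      ultimately show ?thesis by (simp only:)
    qed auto
  qed
  also have "\<dots> = of_nat (Suc n) * (\<integral>\<^sup>+x. \<Phi> x \<partial>lborel)" by (rule nn_integral_cmult) measurable
  also have "\<dots> < \<infinity>" using fin by (auto simp: ennreal_mult_less_top of_nat_less_top)
  finally have "ennreal c1 * \<infinity> < \<infinity>" using nn_integral_powr_infinite[OF expo d(1)] by simp
  then show False using c1 by (simp add: ennreal_mult_less_top)
qed

text \<open>Once the head coefficient is zero, \<open>ell k\<close> cancels from numerator and
  denominator off the origin, and the quotient is the one belonging to the shorter list.\<close>

lemma horner_Lp_imp_0:
  assumes "set ks \<subseteq> A" "distinct ks" and p: "p \<ge> 1"
    and m: "\<And>k. k \<in> A \<Longrightarrow> p * (real (m k) - 1 - 2 * real (L k)) + 2 * real (L k) \<le> -1"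
    and e: "e > 0" and "Lp_sq p e (ratio_real (horner ks a) (ell_prod ks))"
    and "\<And>k i. k \<in> set ks \<Longrightarrow> lead_ord m ks k \<le> i \<Longrightarrow> coeff (a k) i = 0"
  shows "\<forall>k\<in>set ks. a k = 0"
  using assms(1,2,6,7)
proof (induction ks)
  case (Cons k ks)
  have ak: "a k = 0"
    by (rule horner_head_eq_0[OF Cons.prems(1,2) p m e Cons.prems(3)]) (use Cons.prems(1,4) in auto)
  have "Lp_sq p e (ratio_real (horner ks a) (ell_prod ks))"
  proof -
    have "(\<integral>\<^sup>+z. ennreal ((indicator (sq e) z * norm (ratio_real (horner ks a) (ell_prod ks) z)) powr p) \<partial>lborel)
      \<le> (\<integral>\<^sup>+z. ennreal ((indicator (sq e) z * norm (ratio_real (horner (k # ks) a) (ell_prod (k # ks)) z)) powr p) \<partial>lborel)"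
    proof (rule nn_integral_mono_AE)
      show "AE z in lborel. ennreal ((indicator (sq e) z * norm (ratio_real (horner ks a) (ell_prod ks) z)) powr p)
        \<le> ennreal ((indicator (sq e) z * norm (ratio_real (horner (k # ks) a) (ell_prod (k # ks)) z)) powr p)"
        using AE_lborel_singleton[of "(0::real, 0::real)"]
      proof eventually_elim
        case (elim z)
        have "ell k (of_real (fst z)) (of_real (snd z)) \<noteq> 0"
          using ell_nonzero[of k "fst z" "snd z"] Cons.prems(1) elim by (simp add: prod_eq_iff)
        then have "ratio_real (horner (k # ks) a) (ell_prod (k # ks)) z = ratio_real (horner ks a) (ell_prod ks) z"
          by (simp add: ratio_real_def ak)
        then show ?case by simp
      qed
    qed
    then show ?thesis using Cons.prems(3) unfolding Lp_sq_def by (rule le_less_trans)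
  qed
  then have "\<forall>k\<in>set ks. a k = 0"
  proof (rule Cons.IH[rotated 2])
    fix j i assume j: "j \<in> set ks" "lead_ord m ks j \<le> i"
    then have "j \<noteq> k" using Cons.prems(2) by auto
    then show "coeff (a j) i = 0" using j Cons.prems(4)[of j i] by simp
  qed (use Cons.prems in auto)
  then show ?case using ak by simp
qed simp

end

section \<open>The ideals of integrable and bounded quotients\<close>

text \<open>A function representing a germ is arbitrary away from the origin, so boundedness and
  measurability are available only after cutting off to a small square.\<close>

lemma conv_ps_real:
  assumes "conv_ps Q"
  obtains r C where "r > 0" "\<And>x y :: real. \<bar>x\<bar> < r \<Longrightarrow> \<bar>y\<bar> < r \<Longrightarrow> norm (Q (of_real x) (of_real y)) \<le> C"
    "\<And>e. e \<le> r \<Longrightarrow> (\<lambda>z. indicator (sq e) z *\<^sub>R Q (of_real (fst z)) (of_real (snd z))) \<in> borel_measurable borel"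
proof -
  from assms obtain r C where r: "r > 0" "psnorm_le r C Q" unfolding conv_ps_iff_psnorm_le by blast
  show ?thesis
  proof (rule that[OF r(1)])
    fix x y :: real assume "\<bar>x\<bar> < r" "\<bar>y\<bar> < r"
    then show "norm (Q (of_real x) (of_real y)) \<le> C" by (intro psnorm_le_bound[OF r(2)]) auto
  next
    fix e assume e: "e \<le> r"
    have "continuous_on (sq e) ((\<lambda>z. Q (fst z) (snd z)) \<circ> (\<lambda>z. (of_real (fst z) :: complex, of_real (snd z) :: complex)))"
    proof (rule continuous_on_compose)
      show "continuous_on (sq e) (\<lambda>z. (of_real (fst z) :: complex, of_real (snd z) :: complex))"
        by (intro continuous_intros)
      show "continuous_on ((\<lambda>z. (of_real (fst z) :: complex, of_real (snd z) :: complex)) ` sq e) (\<lambda>z. Q (fst z) (snd z))"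
        by (rule continuous_on_subset[OF psnorm_le_continuous_on[OF r(2)]]) (use e in \<open>auto simp: sq_def\<close>)
    qed
    then have "continuous_on (sq e) (\<lambda>z. Q (of_real (fst z)) (of_real (snd z)))" by (simp add: o_def)
    then show "(\<lambda>z. indicator (sq e) z *\<^sub>R Q (of_real (fst z)) (of_real (snd z))) \<in> borel_measurable borel"
      by (intro borel_measurable_continuous_on_indicator) auto
  qed
qed

abbreviation real_measurable :: "(complex \<Rightarrow> complex \<Rightarrow> complex) \<Rightarrow> bool" where
  "real_measurable F \<equiv> (\<lambda>z :: real \<times> real. F (of_real (fst z)) (of_real (snd z))) \<in> borel_measurable borel"

lemma ratio_measurable:
  assumes "conv_ps Q" and F: "real_measurable F"
  obtains r where "r > 0"
    "\<And>e. e \<le> r \<Longrightarrow> set_borel_measurable lborel (sq e) (ratio_real Q F)"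
    "\<And>e. e \<le> r \<Longrightarrow> (\<lambda>z. indicator (sq e) z * norm (ratio_real Q F z)) \<in> borel_measurable borel"
proof -
  obtain r C where r: "r > 0"
    "\<And>e. e \<le> r \<Longrightarrow> (\<lambda>z. indicator (sq e) z *\<^sub>R Q (of_real (fst z)) (of_real (snd z))) \<in> borel_measurable borel"
    using conv_ps_real[OF assms(1)] by metis
  have 1: "(\<lambda>z. indicator (sq e) z *\<^sub>R ratio_real Q F z) \<in> borel_measurable borel" if "e \<le> r" for e
  proof -
    have "(\<lambda>z. (indicator (sq e) z *\<^sub>R Q (of_real (fst z)) (of_real (snd z))) / F (of_real (fst z)) (of_real (snd z))) \<in> borel_measurable borel"
      by (rule borel_measurable_divide[OF r(2)[OF that] F])
    then show ?thesis by (simp add: ratio_real_def scaleR_conv_of_real)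
  qed
  show ?thesis
  proof (rule that[OF r(1)])
    fix e assume e: "e \<le> r"
    show "set_borel_measurable lborel (sq e) (ratio_real Q F)"
      using 1[OF e] by (simp add: set_borel_measurable_def)
    show "(\<lambda>z. indicator (sq e) z * norm (ratio_real Q F z)) \<in> borel_measurable borel"
      using measurable_compose[OF 1[OF e] borel_measurable_norm] by simp
  qed
qed

lemma Lp_sq_mono:
  assumes "Lp_sq p e f" "d \<le> e"
  shows "Lp_sq p d f"
proof -
  have "(\<integral>\<^sup>+z. ennreal ((indicator (sq d) z * norm (f z)) powr p) \<partial>lborel)
     \<le> (\<integral>\<^sup>+z. ennreal ((indicator (sq e) z * norm (f z)) powr p) \<partial>lborel)"
    by (rule nn_integral_mono) (use sq_mono[OF assms(2)] in \<open>auto simp: indicator_def\<close>)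
  then show ?thesis using assms(1) unfolding Lp_sq_def by (rule le_less_trans)
qed

text \<open>Neighbourhoods may be replaced by squares. The measurability clause of
  \<open>Lp_loc\<close> is met by shrinking the square into the polydisc of convergence.\<close>

lemma Lp_loc_iff:
  assumes "conv_ps Q" "real_measurable F"
  shows "Lp_loc p (ratio_real Q F) \<longleftrightarrow> (\<exists>e>0. Lp_sq p e (ratio_real Q F))"
proof
  assume "Lp_loc p (ratio_real Q F)"
  then obtain U where U: "open U" "(0,0) \<in> U" "(\<integral>\<^sup>+ z \<in> U. ennreal (norm (ratio_real Q F z) powr p) \<partial>lborel) < \<infinity>"
    unfolding Lp_loc_def by blast
  obtain e where e: "e > 0" "sq e \<subseteq> U" by (rule sq_subset_open[OF U(1,2)])
  have "(\<integral>\<^sup>+ z \<in> sq e. ennreal (norm (ratio_real Q F z) powr p) \<partial>lborel) \<le> (\<integral>\<^sup>+ z \<in> U. ennreal (norm (ratio_real Q F z) powr p) \<partial>lborel)"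
    by (rule nn_integral_mono) (use e in \<open>auto simp: indicator_def\<close>)
  then have "Lp_sq p e (ratio_real Q F)" unfolding Lp_sq_def Lp_sq_alt using U(3) by (rule le_less_trans)
  then show "\<exists>e>0. Lp_sq p e (ratio_real Q F)" using e by blast
next
  assume "\<exists>e>0. Lp_sq p e (ratio_real Q F)"
  then obtain e where e: "e > 0" "Lp_sq p e (ratio_real Q F)" by blast
  obtain r where r: "r > 0" "\<And>e. e \<le> r \<Longrightarrow> set_borel_measurable lborel (sq e) (ratio_real Q F)"
    using ratio_measurable[OF assms] by metis
  have "Lp_sq p (min e r) (ratio_real Q F)" by (rule Lp_sq_mono[OF e(2)]) simp
  then show "Lp_loc p (ratio_real Q F)" unfolding Lp_loc_def Lp_sq_def Lp_sq_alt
    using r e by (intro exI[of _ "sq (min e r)"]) auto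
qed

lemma Linf_loc_iff:
  assumes "conv_ps Q" "real_measurable F"
  shows "Linf_loc (ratio_real Q F) \<longleftrightarrow> (\<exists>e>0. \<exists>C. AE z in lborel. z \<in> sq e \<longrightarrow> norm (ratio_real Q F z) \<le> C)"
proof
  assume "Linf_loc (ratio_real Q F)"
  then obtain U C where U: "open U" "(0,0) \<in> U" "AE z in lborel. z \<in> U \<longrightarrow> norm (ratio_real Q F z) \<le> C"
    unfolding Linf_loc_def by blast
  obtain e where e: "e > 0" "sq e \<subseteq> U" by (rule sq_subset_open[OF U(1,2)])
  have "AE z in lborel. z \<in> sq e \<longrightarrow> norm (ratio_real Q F z) \<le> C"
    using U(3) by eventually_elim (use e in auto)
  then show "\<exists>e>0. \<exists>C. AE z in lborel. z \<in> sq e \<longrightarrow> norm (ratio_real Q F z) \<le> C" using e by blast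
next
  assume "\<exists>e>0. \<exists>C. AE z in lborel. z \<in> sq e \<longrightarrow> norm (ratio_real Q F z) \<le> C"
  then obtain e C where e: "e > 0" "AE z in lborel. z \<in> sq e \<longrightarrow> norm (ratio_real Q F z) \<le> C" by blast
  obtain r where r: "r > 0" "\<And>e. e \<le> r \<Longrightarrow> set_borel_measurable lborel (sq e) (ratio_real Q F)"
    using ratio_measurable[OF assms] by metis
  have "AE z in lborel. z \<in> sq (min e r) \<longrightarrow> norm (ratio_real Q F z) \<le> C"
    using e(2) by eventually_elim (use sq_mono[of "min e r" e] in auto)
  then show "Linf_loc (ratio_real Q F)" unfolding Linf_loc_def
    using r e by (intro exI[of _ "sq (min e r)"]) auto
qed

lemma Lp_sq_bounded:
  fixes f :: "real \<times> real \<Rightarrow> complex"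
  assumes "AE z in lborel. z \<in> sq e \<longrightarrow> norm (f z) \<le> C" "p \<ge> 0"
  shows "Lp_sq p e f"
proof -
  have one: "Lp_sq p e (\<lambda>_. 1 :: real)"
  proof -
    have "bounded (sq e)" unfolding sq_def by (intro bounded_Times) (auto intro: bounded_subset[OF bounded_closed_interval[of "-e" e]])
    then have "emeasure lborel (sq e) < \<infinity>" by (rule emeasure_bounded_finite)
    moreover have "(\<integral>\<^sup>+z. ennreal ((indicator (sq e) z * norm (1::real)) powr p) \<partial>lborel) = (\<integral>\<^sup>+z. indicator (sq e) z \<partial>lborel)"
      by (rule nn_integral_cong) (auto simp: indicator_def)
    ultimately show ?thesis by (simp add: Lp_sq_def)
  qed
  show ?thesis
  proof (rule Lp_sq_dominated[where J = "{()}" and g = "\<lambda>_ _. 1 :: real" and C = "max C 0" and e = e])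
    show "AE z in lborel. z \<in> sq e \<longrightarrow> norm (f z) \<le> max C 0 * (\<Sum>j\<in>{()}. norm (1::real))"
      using assms(1) by eventually_elim auto
  qed (use one assms(2) in auto)
qed

lemma Linf_loc_imp_Lp_loc:
  assumes "conv_ps Q" "real_measurable F" "Linf_loc (ratio_real Q F)" "p \<ge> 0"
  shows "Lp_loc p (ratio_real Q F)"
  using assms Lp_sq_bounded unfolding Lp_loc_iff[OF assms(1,2)] Linf_loc_iff[OF assms(1,2)] by blast

lemma AE_sq_punctured:
  assumes "\<And>x y. (x, y) \<noteq> (0, 0) \<Longrightarrow> \<bar>x\<bar> < e \<Longrightarrow> \<bar>y\<bar> < e \<Longrightarrow> P (x, y)"
  shows "AE z in lborel. z \<in> sq e \<longrightarrow> P z"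
  using AE_lborel_singleton[of "(0::real, 0::real)"]
proof eventually_elim
  case (elim z)
  then show ?case using assms by (cases z) auto
qed

text \<open>Transfers both ideals between two comparable denominators; it is applied in both
  directions to \<open>P\<close> and [P].\<close>

lemma ratio_compare:
  assumes Q: "conv_ps Q" and F: "real_measurable F1" "real_measurable F2" and e: "e > 0"
    and le: "\<And>x y. (x, y) \<noteq> (0, 0) \<Longrightarrow> \<bar>x\<bar> < e \<Longrightarrow> \<bar>y\<bar> < e \<Longrightarrow>
      norm (ratio_real Q F1 (x, y)) \<le> C * norm (ratio_real Q F2 (x, y))"
  shows "p \<ge> 0 \<Longrightarrow> Lp_loc p (ratio_real Q F2) \<Longrightarrow> Lp_loc p (ratio_real Q F1)"
    and "Linf_loc (ratio_real Q F2) \<Longrightarrow> Linf_loc (ratio_real Q F1)"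
proof -
  \<comment> \<open>The sign of \<open>C\<close> is not known, while domination asks for a
    nonnegative constant.\<close>
  have le': "norm (ratio_real Q F1 (x, y)) \<le> max C 0 * norm (ratio_real Q F2 (x, y))"
    if "(x, y) \<noteq> (0, 0)" "\<bar>x\<bar> < e" "\<bar>y\<bar> < e" for x y
    using le[OF that] mult_right_mono[of C "max C 0" "norm (ratio_real Q F2 (x, y))"] by simp
  show "Lp_loc p (ratio_real Q F1)" if p: "p \<ge> 0" and 2: "Lp_loc p (ratio_real Q F2)"
  proof -
    from 2 obtain d where d: "d > 0" "Lp_sq p d (ratio_real Q F2)" unfolding Lp_loc_iff[OF Q F(2)] by blast
    obtain r where r: "r > 0" "\<And>e. e \<le> r \<Longrightarrow> (\<lambda>z. indicator (sq e) z * norm (ratio_real Q F2 z)) \<in> borel_measurable borel"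
      using ratio_measurable[OF Q F(2)] by metis
    define b where "b = min d (min r e)"
    have b: "b > 0" "b \<le> d" "b \<le> r" "b \<le> e" using d r e by (auto simp: b_def)
    have "Lp_sq p b (ratio_real Q F1)"
    proof (rule Lp_sq_dominated[where J = "{()}" and g = "\<lambda>_. ratio_real Q F2" and C = "max C 0" and e = b])
      show "AE z in lborel. z \<in> sq b \<longrightarrow> norm (ratio_real Q F1 z) \<le> max C 0 * (\<Sum>j\<in>{()}. norm (ratio_real Q F2 z))"
        by (rule AE_sq_punctured) (use le' b in auto)
    qed (use r b p Lp_sq_mono[OF d(2) b(2)] in auto)
    then show ?thesis unfolding Lp_loc_iff[OF Q F(1)] using b by blast
  qed
  show "Linf_loc (ratio_real Q F1)" if 2: "Linf_loc (ratio_real Q F2)"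
  proof -
    from 2 obtain d B where d: "d > 0" "AE z in lborel. z \<in> sq d \<longrightarrow> norm (ratio_real Q F2 z) \<le> B"
      unfolding Linf_loc_iff[OF Q F(2)] by blast
    have "AE z in lborel. z \<in> sq e \<longrightarrow> norm (ratio_real Q F1 z) \<le> max C 0 * norm (ratio_real Q F2 z)"
      by (rule AE_sq_punctured) (use le' in auto)
    with d(2) have "AE z in lborel. z \<in> sq (min d e) \<longrightarrow> norm (ratio_real Q F1 z) \<le> max C 0 * B"
    proof eventually_elim
      case (elim z)
      show ?case
      proof
        assume "z \<in> sq (min d e)"
        then have "z \<in> sq d" "z \<in> sq e" using sq_mono[of "min d e" d] sq_mono[of "min d e" e] by auto
        then show "norm (ratio_real Q F1 z) \<le> max C 0 * B"
          using elim mult_left_mono[of "norm (ratio_real Q F2 z)" B "max C 0"] by auto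
      qed
    qed
    moreover have "min d e > 0" using d e by simp
    ultimately show ?thesis unfolding Linf_loc_iff[OF Q F(1)] by blast
  qed
qed

lemma ratio_real_diff: "ratio_real (\<lambda>x y. Q x y - R x y) F z = ratio_real Q F z - ratio_real R F z"
  by (simp add: ratio_real_def diff_divide_distrib)

lemma ratio_real_scale: "ratio_real (\<lambda>x y. c * Q x y) F z = c * ratio_real Q F z"
  by (simp add: ratio_real_def)

lemma Ip_diff:
  assumes F: "real_measurable F" and p: "p \<ge> 0" and QR: "Q \<in> Ip p F" "R \<in> Ip p F"
  shows "(\<lambda>x y. Q x y - R x y) \<in> Ip p F"
proof -
  have Q: "conv_ps Q" and R: "conv_ps R" using QR by (auto simp: Ip_def)
  have QR': "conv_ps (\<lambda>x y. Q x y - R x y)" by (rule conv_ps_diff[OF Q R])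
  obtain d1 d2 where d: "d1 > 0" "Lp_sq p d1 (ratio_real Q F)" "d2 > 0" "Lp_sq p d2 (ratio_real R F)"
    using QR unfolding Ip_def mem_Collect_eq Lp_loc_iff[OF Q F] Lp_loc_iff[OF R F] by blast
  obtain r1 where r1: "r1 > 0" "\<And>e. e \<le> r1 \<Longrightarrow> (\<lambda>z. indicator (sq e) z * norm (ratio_real Q F z)) \<in> borel_measurable borel"
    using ratio_measurable[OF Q F] by metis
  obtain r2 where r2: "r2 > 0" "\<And>e. e \<le> r2 \<Longrightarrow> (\<lambda>z. indicator (sq e) z * norm (ratio_real R F z)) \<in> borel_measurable borel"
    using ratio_measurable[OF R F] by metis
  define b where "b = min (min d1 d2) (min r1 r2)"
  have b: "b > 0" "b \<le> d1" "b \<le> d2" "b \<le> r1" "b \<le> r2" using d r1 r2 by (auto simp: b_def)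
  have "Lp_sq p b (ratio_real (\<lambda>x y. Q x y - R x y) F)"
  proof (rule Lp_sq_dominated[where J = "UNIV :: bool set" and g = "\<lambda>j. if j then ratio_real Q F else ratio_real R F" and C = 1 and e = b])
    show "AE z in lborel. z \<in> sq b \<longrightarrow> norm (ratio_real (\<lambda>x y. Q x y - R x y) F z) \<le> 1 * (\<Sum>j\<in>UNIV. norm ((if j then ratio_real Q F else ratio_real R F) z))"
      by (intro always_eventually allI impI) (simp add: UNIV_bool ratio_real_diff norm_triangle_ineq4 add.commute)
  qed (use b p r1(2)[of b] r2(2)[of b] Lp_sq_mono[OF d(2) b(2)] Lp_sq_mono[OF d(4) b(3)] in auto)
  then show ?thesis using b QR' unfolding Ip_def mem_Collect_eq Lp_loc_iff[OF QR' F] by blast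
qed

lemma Ip_scale:
  assumes F: "real_measurable F" and p: "p \<ge> 0" and Q: "Q \<in> Ip p F"
  shows "(\<lambda>x y. c * Q x y) \<in> Ip p F"
proof -
  have Q': "conv_ps Q" using Q by (auto simp: Ip_def)
  have cQ: "conv_ps (\<lambda>x y. c * Q x y)" by (rule conv_ps_mult[OF conv_ps_const Q'])
  obtain d where d: "d > 0" "Lp_sq p d (ratio_real Q F)"
    using Q unfolding Ip_def mem_Collect_eq Lp_loc_iff[OF Q' F] by blast
  obtain r where r: "r > 0" "\<And>e. e \<le> r \<Longrightarrow> (\<lambda>z. indicator (sq e) z * norm (ratio_real Q F z)) \<in> borel_measurable borel"
    using ratio_measurable[OF Q' F] by metis
  define b where "b = min d r"
  have b: "b > 0" "b \<le> d" "b \<le> r" using d r by (auto simp: b_def)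
  have "Lp_sq p b (ratio_real (\<lambda>x y. c * Q x y) F)"
  proof (rule Lp_sq_dominated[where J = "{()}" and g = "\<lambda>_. ratio_real Q F" and C = "norm c" and e = b])
    show "AE z in lborel. z \<in> sq b \<longrightarrow> norm (ratio_real (\<lambda>x y. c * Q x y) F z) \<le> norm c * (\<Sum>j\<in>{()}. norm (ratio_real Q F z))"
      by (intro always_eventually allI impI) (simp add: ratio_real_scale norm_mult)
  qed (use b p r(2)[of b] Lp_sq_mono[OF d(2) b(2)] in auto)
  then show ?thesis using b cQ unfolding Ip_def mem_Collect_eq Lp_loc_iff[OF cQ F] by blast
qed

lemma Iinf_diff:
  assumes F: "real_measurable F" and QR: "Q \<in> Iinf F" "R \<in> Iinf F"
  shows "(\<lambda>x y. Q x y - R x y) \<in> Iinf F"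
proof -
  have Q: "conv_ps Q" and R: "conv_ps R" using QR by (auto simp: Iinf_def)
  have QR': "conv_ps (\<lambda>x y. Q x y - R x y)" by (rule conv_ps_diff[OF Q R])
  obtain d1 d2 C1 C2 where d: "d1 > 0" "AE z in lborel. z \<in> sq d1 \<longrightarrow> norm (ratio_real Q F z) \<le> C1"
    "d2 > 0" "AE z in lborel. z \<in> sq d2 \<longrightarrow> norm (ratio_real R F z) \<le> C2"
    using QR unfolding Iinf_def mem_Collect_eq Linf_loc_iff[OF Q F] Linf_loc_iff[OF R F] by blast
  from d(2,4) have "AE z in lborel. z \<in> sq (min d1 d2) \<longrightarrow> norm (ratio_real (\<lambda>x y. Q x y - R x y) F z) \<le> C1 + C2"
  proof eventually_elim
    case (elim z)
    show ?case
    proof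
      assume "z \<in> sq (min d1 d2)"
      then have "z \<in> sq d1" "z \<in> sq d2" using sq_mono[of "min d1 d2" d1] sq_mono[of "min d1 d2" d2] by auto
      then show "norm (ratio_real (\<lambda>x y. Q x y - R x y) F z) \<le> C1 + C2"
        using elim norm_triangle_ineq4[of "ratio_real Q F z" "ratio_real R F z"] by (auto simp: ratio_real_diff)
    qed
  qed
  moreover have "min d1 d2 > 0" using d by simp
  ultimately show ?thesis using QR' unfolding Iinf_def mem_Collect_eq Linf_loc_iff[OF QR' F] by blast
qed

lemma Iinf_scale:
  assumes F: "real_measurable F" and Q: "Q \<in> Iinf F"
  shows "(\<lambda>x y. c * Q x y) \<in> Iinf F"
proof -
  have Q': "conv_ps Q" using Q by (auto simp: Iinf_def)
  have cQ: "conv_ps (\<lambda>x y. c * Q x y)" by (rule conv_ps_mult[OF conv_ps_const Q'])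
  obtain d C where d: "d > 0" "AE z in lborel. z \<in> sq d \<longrightarrow> norm (ratio_real Q F z) \<le> C"
    using Q unfolding Iinf_def mem_Collect_eq Linf_loc_iff[OF Q' F] by blast
  from d(2) have "AE z in lborel. z \<in> sq d \<longrightarrow> norm (ratio_real (\<lambda>x y. c * Q x y) F z) \<le> norm c * C"
    by eventually_elim (auto simp: ratio_real_scale norm_mult intro: mult_left_mono)
  then show ?thesis using d cQ unfolding Iinf_def mem_Collect_eq Linf_loc_iff[OF cQ F] by blast
qed

section \<open>The two ideals for a product of branches and their dimensions\<close>

context branches
begin

lemma real_measurable_ell_prod: "real_measurable (ell_prod ks)"
  by (rule borel_measurable_continuous_onI[OF continuous_ell_prod])

lemma norm_G_real:
  assumes "distinct ks" "set ks = A"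
  shows "norm (G (of_real x) (of_real y)) = norm (ell_prod ks (of_real x) (of_real y))"
  using assms by (simp add: G_def ell_prod_set norm_ell_bar_real prod_norm[symmetric])

text \<open>At real points both generators have the same modulus, so the quotient of
  \<open>U * [P] + V * G\<close> by [P] is bounded by the bounds of \<open>U\<close> and
  \<open>V\<close>.\<close>

lemma ideal_subset_Iinf:
  assumes ks: "distinct ks" "set ks = A"
  shows "ideal2 (ell_prod ks) G \<subseteq> Iinf (ell_prod ks)"
proof
  fix Q assume "Q \<in> ideal2 (ell_prod ks) G"
  then obtain U V where Q: "conv_ps Q" and UV: "conv_ps U" "conv_ps V" "germ_eq Q (\<lambda>x y. U x y * ell_prod ks x y + V x y * G x y)"
    unfolding ideal2_def by blast
  obtain r1 C1 where 1: "r1 > 0" "\<And>x y :: real. \<bar>x\<bar> < r1 \<Longrightarrow> \<bar>y\<bar> < r1 \<Longrightarrow> norm (U (of_real x) (of_real y)) \<le> C1"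
    by (rule conv_ps_real[OF UV(1)]) blast
  obtain r2 C2 where 2: "r2 > 0" "\<And>x y :: real. \<bar>x\<bar> < r2 \<Longrightarrow> \<bar>y\<bar> < r2 \<Longrightarrow> norm (V (of_real x) (of_real y)) \<le> C2"
    by (rule conv_ps_real[OF UV(2)]) blast
  obtain r3 where 3: "r3 > 0" "\<And>x y. norm x < r3 \<Longrightarrow> norm y < r3 \<Longrightarrow> Q x y = U x y * ell_prod ks x y + V x y * G x y"
    using UV(3) unfolding germ_eq_iff by blast
  define r where "r = min r1 (min r2 r3)"
  have r: "r > 0" using 1 2 3 by (simp add: r_def)
  have "AE z in lborel. z \<in> sq r \<longrightarrow> norm (ratio_real Q (ell_prod ks) z) \<le> C1 + C2"
  proof (rule AE_sq_punctured)
    fix x y :: real assume xy: "(x, y) \<noteq> (0, 0)" "\<bar>x\<bar> < r" "\<bar>y\<bar> < r"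
    let ?x = "of_real x :: complex" and ?y = "of_real y :: complex"
    have ne: "ell_prod ks ?x ?y \<noteq> 0" using ell_prod_nonzero[OF _ xy(1)] ks by simp
    have "norm (Q ?x ?y) \<le> norm (U ?x ?y) * norm (ell_prod ks ?x ?y) + norm (V ?x ?y) * norm (G ?x ?y)"
      using 3(2)[of ?x ?y] xy norm_triangle_ineq[of "U ?x ?y * ell_prod ks ?x ?y" "V ?x ?y * G ?x ?y"] by (simp add: r_def norm_mult)
    also have "\<dots> \<le> C1 * norm (ell_prod ks ?x ?y) + C2 * norm (ell_prod ks ?x ?y)"
      unfolding norm_G_real[OF ks] using 1(2)[of x y] 2(2)[of x y] xy by (intro add_mono mult_right_mono) (auto simp: r_def)
    finally show "norm (ratio_real Q (ell_prod ks) (x, y)) \<le> C1 + C2"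
      using ne by (simp add: ratio_real_def norm_divide field_simps)
  qed
  then show "Q \<in> Iinf (ell_prod ks)"
    using r Q unfolding Iinf_def mem_Collect_eq Linf_loc_iff[OF Q real_measurable_ell_prod] by blast
qed

lemma Iinf_subset_Ip: "p \<ge> 0 \<Longrightarrow> Iinf (ell_prod ks) \<subseteq> Ip p (ell_prod ks)"
  using Linf_loc_imp_Lp_loc[OF _ real_measurable_ell_prod] by (auto simp: Iinf_def Ip_def)

lemma horner_single_Ip:
  assumes ks: "distinct ks" "set ks = A" "greedy m ks" and k: "k \<in> A" "lead_ord m ks k \<le> i" and p: "p \<ge> 1"
    and m: "\<And>k. k \<in> A \<Longrightarrow> p * (real (m k) - 2 * real (L k)) + 2 * real (L k) > -1"
  shows "horner ks (single k i) \<in> Ip p (ell_prod ks)"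
proof -
  obtain C e where C: "C \<ge> 0" "e > 0" "\<And>x y :: real. (x, y) \<noteq> (0, 0) \<Longrightarrow> \<bar>x\<bar> < e \<Longrightarrow>
    norm (ratio_real (horner ks (single k i)) (ell_prod ks) (x, y)) \<le>
      C * (\<Sum>j\<in>set ks. \<bar>x\<bar> ^ m j / norm (ell j (of_real x) (of_real y)))"
    using horner_single_bound[OF _ ks(1,3), of k i] ks(2) k by auto
  define g where "g = (\<lambda>j (z :: real \<times> real). \<bar>fst z\<bar> ^ m j / norm (ell j (of_real (fst z)) (of_real (snd z))))"
  have "Lp_sq p e (ratio_real (horner ks (single k i)) (ell_prod ks))"
  proof (rule Lp_sq_dominated[where J = A and g = g and C = C and e = e])
    show "Lp_sq p e (g j)" if "j \<in> A" for j
      unfolding g_def by (rule branch_term_Lp[OF that p m[OF that] C(2)])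
    show "(\<lambda>z. indicator (sq e) z * norm (g j z)) \<in> borel_measurable borel" if "j \<in> A" for j
    proof -
      have [measurable]: "(\<lambda>z :: real \<times> real. \<bar>fst z\<bar> ^ m j) \<in> borel_measurable borel"
        by (intro borel_measurable_continuous_onI continuous_intros)
      show ?thesis unfolding g_def by measurable
    qed
    show "AE z in lborel. z \<in> sq e \<longrightarrow> norm (ratio_real (horner ks (single k i)) (ell_prod ks) z) \<le> C * (\<Sum>j\<in>A. norm (g j z))"
      by (rule AE_sq_punctured) (use C(3) ks(2) in \<open>auto simp: g_def\<close>)
  qed (use finite_A p C in auto)
  then show ?thesis using C(2) conv_ps_horner
    unfolding Ip_def mem_Collect_eq Lp_loc_iff[OF conv_ps_horner real_measurable_ell_prod] by blast
qed

text \<open>With \<open>m = 2 L\<close> every branch quotient in the pointwise bound is at most 1,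
  because \<open>ell j\<close> has imaginary part \<open>x^(2 L j)\<close>.\<close>

lemma horner_single_Iinf:
  assumes ks: "distinct ks" "set ks = A" "greedy (\<lambda>k. 2 * L k) ks" and k: "k \<in> A" "lead_ord (\<lambda>k. 2 * L k) ks k \<le> i"
  shows "horner ks (single k i) \<in> Iinf (ell_prod ks)"
proof -
  obtain C e where C: "C \<ge> 0" "e > 0" "\<And>x y :: real. (x, y) \<noteq> (0, 0) \<Longrightarrow> \<bar>x\<bar> < e \<Longrightarrow>
    norm (ratio_real (horner ks (single k i)) (ell_prod ks) (x, y)) \<le>
      C * (\<Sum>j\<in>set ks. \<bar>x\<bar> ^ (2 * L j) / norm (ell j (of_real x) (of_real y)))"
    using horner_single_bound[OF _ ks(1,3), of k i] ks(2) k by auto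
  have "AE z in lborel. z \<in> sq e \<longrightarrow> norm (ratio_real (horner ks (single k i)) (ell_prod ks) z) \<le> C * real (card A)"
  proof (rule AE_sq_punctured)
    fix x y :: real assume xy: "(x, y) \<noteq> (0, 0)" "\<bar>x\<bar> < e"
    have "(\<Sum>j\<in>set ks. \<bar>x\<bar> ^ (2 * L j) / norm (ell j (of_real x) (of_real y))) \<le> (\<Sum>j\<in>set ks. 1)"
    proof (rule sum_mono)
      fix j
      have "a / b \<le> 1" if "a \<le> b" "0 \<le> b" for a b :: real
        using that by (cases "b = 0") auto
      then show "\<bar>x\<bar> ^ (2 * L j) / norm (ell j (of_real x) (of_real y)) \<le> 1"
        using norm_ell_ge(2)[of x j y] norm_ge_zero by blast
    qed
    then have "C * (\<Sum>j\<in>set ks. \<bar>x\<bar> ^ (2 * L j) / norm (ell j (of_real x) (of_real y))) \<le> C * real (card A)"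
      using C(1) ks(2) by (intro mult_left_mono) auto
    then show "norm (ratio_real (horner ks (single k i)) (ell_prod ks) (x, y)) \<le> C * real (card A)"
      using C(3)[OF xy] by linarith
  qed
  then show ?thesis using C(2) conv_ps_horner
    unfolding Iinf_def mem_Collect_eq Linf_loc_iff[OF conv_ps_horner real_measurable_ell_prod] by blast
qed

lemma horner_Ip_imp_0:
  assumes ks: "distinct ks" "set ks = A" and p: "p \<ge> 1"
    and m: "\<And>k. k \<in> A \<Longrightarrow> p * (real (m k) - 1 - 2 * real (L k)) + 2 * real (L k) \<le> -1"
    and mem: "horner ks a \<in> Ip p (ell_prod ks)"
    and deg: "\<And>k i. k \<in> A \<Longrightarrow> lead_ord m ks k \<le> i \<Longrightarrow> coeff (a k) i = 0"
  shows "\<forall>k\<in>A. a k = 0"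
proof -
  obtain e where e: "e > 0" "Lp_sq p e (ratio_real (horner ks a) (ell_prod ks))"
    using mem unfolding Ip_def mem_Collect_eq Lp_loc_iff[OF conv_ps_horner real_measurable_ell_prod] by blast
  have "\<forall>k\<in>set ks. a k = 0"
    by (rule horner_Lp_imp_0[OF _ ks(1) p m e]) (use ks(2) deg in simp_all)
  then show ?thesis by (simp only: ks(2))
qed

text \<open>The first two conditions characterise \<open>m k\<close> as the least exponent for which
  the branch quotient is locally in L^p: the first gives membership of the basis germs, the second
  excludes lower orders. The third ensures that leading orders do not exceed
  \<open>D\<^sub>k\<close>.\<close>

lemma quot_dim_Ip:
  assumes ks: "distinct ks" "set ks = A" "greedy m ks" and p: "p \<ge> 1"
    and m: "\<And>k. k \<in> A \<Longrightarrow> p * (real (m k) - 2 * real (L k)) + 2 * real (L k) > -1"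
      "\<And>k. k \<in> A \<Longrightarrow> p * (real (m k) - 1 - 2 * real (L k)) + 2 * real (L k) \<le> -1"
      "\<And>k. k \<in> A \<Longrightarrow> m k \<le> 2 * L k"
  shows "quot_dim_is (Ip p (ell_prod ks)) (ideal2 (ell_prod ks) G) (\<Sum>k\<in>A. total_contact k - lead_ord m ks k)"
proof (rule quot_dim_is_of_leading_orders[OF ks(1,2)])
  show "lead_ord m ks k \<le> total_contact k" if "k \<in> A" for k
    by (rule lead_ord_le[where m = m]) (use ks that m(3) in auto)
  show "ideal2 (ell_prod ks) G \<subseteq> Ip p (ell_prod ks)"
    using ideal_subset_Iinf[OF ks(1,2)] Iinf_subset_Ip[of p ks] p by auto
  show "(\<lambda>x y. Q x y - R x y) \<in> Ip p (ell_prod ks)" if "Q \<in> Ip p (ell_prod ks)" "R \<in> Ip p (ell_prod ks)" for Q R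
    using Ip_diff[OF real_measurable_ell_prod _ that] p by simp
  show "(\<lambda>x y. c * Q x y) \<in> Ip p (ell_prod ks)" if "Q \<in> Ip p (ell_prod ks)" for Q c
    using Ip_scale[OF real_measurable_ell_prod _ that] p by simp
  show "horner ks (single k i) \<in> Ip p (ell_prod ks)" if "k \<in> A" "lead_ord m ks k \<le> i" for k i
    by (rule horner_single_Ip[OF ks that p m(1)])
  show "\<forall>k\<in>A. a k = 0" if "horner ks a \<in> Ip p (ell_prod ks)" "\<And>k i. k \<in> A \<Longrightarrow> lead_ord m ks k \<le> i \<Longrightarrow> coeff (a k) i = 0" for a
    by (rule horner_Ip_imp_0[OF ks(1,2) p m(2) that])
qed (auto simp: Ip_def)

lemma quot_dim_Iinf:
  assumes ks: "distinct ks" "set ks = A" "greedy (\<lambda>k. 2 * L k) ks"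
  shows "quot_dim_is (Iinf (ell_prod ks)) (ideal2 (ell_prod ks) G) (\<Sum>k\<in>A. total_contact k - lead_ord (\<lambda>k. 2 * L k) ks k)"
proof (rule quot_dim_is_of_leading_orders[OF ks(1,2)])
  show "lead_ord (\<lambda>k. 2 * L k) ks k \<le> total_contact k" if "k \<in> A" for k
    by (rule lead_ord_le) (use ks that in auto)
  show "ideal2 (ell_prod ks) G \<subseteq> Iinf (ell_prod ks)" by (rule ideal_subset_Iinf[OF ks(1,2)])
  show "(\<lambda>x y. Q x y - R x y) \<in> Iinf (ell_prod ks)" if "Q \<in> Iinf (ell_prod ks)" "R \<in> Iinf (ell_prod ks)" for Q R
    by (rule Iinf_diff[OF real_measurable_ell_prod that])
  show "(\<lambda>x y. c * Q x y) \<in> Iinf (ell_prod ks)" if "Q \<in> Iinf (ell_prod ks)" for Q c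
    by (rule Iinf_scale[OF real_measurable_ell_prod that])
  show "horner ks (single k i) \<in> Iinf (ell_prod ks)" if "k \<in> A" "lead_ord (\<lambda>k. 2 * L k) ks k \<le> i" for k i
    by (rule horner_single_Iinf[OF ks that])
  fix a assume a: "horner ks a \<in> Iinf (ell_prod ks)" "\<And>k i. k \<in> A \<Longrightarrow> lead_ord (\<lambda>k. 2 * L k) ks k \<le> i \<Longrightarrow> coeff (a k) i = 0"
  \<comment> \<open>For exponents this large the leading orders of the finite-exponent ideal are those of the bounded one.\<close>
  define p where "p = 2 * (\<Sum>k\<in>A. real (L k)) + 1"
  have pL: "p \<ge> 2 * real (L k) + 1" if "k \<in> A" for k
    using member_le_sum[OF that _ finite_A, of "\<lambda>k. real (L k)"] by (simp add: p_def)
  have p1: "p \<ge> 1" unfolding p_def by (simp add: sum_nonneg)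
  show "\<forall>k\<in>A. a k = 0"
  proof (rule horner_Ip_imp_0[OF ks(1,2) p1 _ _ a(2)])
    show "horner ks a \<in> Ip p (ell_prod ks)" using a(1) Iinf_subset_Ip[of p ks] p1 by auto
    show "p * (real (2 * L k) - 1 - 2 * real (L k)) + 2 * real (L k) \<le> -1" if "k \<in> A" for k
      using pL[OF that] by simp
  qed
qed (auto simp: Iinf_def)

text \<open>Subtracting \<open>sum_lead_ord\<close> from the sum of all contacts leaves each pair
  once plus \<open>2 L k - m k\<close> for each branch. The bounds on \<open>m\<close> make the
  subtractions of natural numbers exact.\<close>

lemma sum_total_minus_lead:
  assumes ks: "distinct ks" "set ks = A" and m: "\<And>k. k \<in> A \<Longrightarrow> m k \<le> 2 * L k"
    and T: "(\<Sum>k\<in>A. \<Sum>l\<in>A. contact k l) = 2 * T + (\<Sum>k\<in>A. contact k k)"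
  shows "(\<Sum>k\<in>A. total_contact k - lead_ord m ks k) = T + (\<Sum>k\<in>A. 2 * L k - m k)"
proof -
  have le: "lead_ord m ks k \<le> total_contact k" if "k \<in> A" for k
    by (rule lead_ord_le[where m = m]) (use ks that m in auto)
  have "(\<Sum>k\<in>A. total_contact k) = (\<Sum>k\<in>A. (total_contact k - lead_ord m ks k) + lead_ord m ks k)"
    by (rule sum.cong) (use le in auto)
  then have 1: "(\<Sum>k\<in>A. \<Sum>l\<in>A. contact k l) = (\<Sum>k\<in>A. total_contact k - lead_ord m ks k) + (\<Sum>k\<in>A. lead_ord m ks k)"
    by (simp add: sum.distrib total_contact_def)
  have "(\<Sum>k\<in>A. contact k k) = (\<Sum>k\<in>A. (2 * L k - m k) + m k)"
    by (rule sum.cong) (use m in \<open>auto simp: contact_self\<close>)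
  then have 2: "(\<Sum>k\<in>A. contact k k) = (\<Sum>k\<in>A. 2 * L k - m k) + (\<Sum>k\<in>A. m k)"
    by (simp add: sum.distrib)
  from sum_lead_ord[OF ks(1), of m] have 3: "2 * (\<Sum>k\<in>A. lead_ord m ks k) + (\<Sum>k\<in>A. contact k k) = 2 * (\<Sum>k\<in>A. m k) + (\<Sum>k\<in>A. \<Sum>l\<in>A. contact k l)"
    unfolding ks(2) .
  show ?thesis using 1 2 3 T by linarith
qed

end

section \<open>Comparison with the polynomial\<close>

lemma eval2_altdef: "eval2 P x y = (\<Sum>i\<le>degree P. poly (coeff P i) x * y ^ i)"
  unfolding eval2_def poly_altdef[of P] by (simp add: poly_sum poly_power)

lemma continuous_eval2:
  assumes "continuous_on S f" "continuous_on S g"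
  shows "continuous_on S (\<lambda>z. eval2 P (f z) (g z))"
  unfolding eval2_altdef by (intro continuous_intros assms)

lemma isCont_eval2:
  assumes "isCont f z" "isCont g z"
  shows "isCont (\<lambda>z. eval2 P (f z) (g z)) z"
  unfolding eval2_altdef by (intro continuous_intros assms)

lemma finite_real_roots:
  assumes "(R :: complex poly) \<noteq> 0"
  shows "finite {t :: real. poly R (of_real t) = 0}"
  using finite_vimageI[OF poly_roots_finite[OF assms], of "of_real :: real \<Rightarrow> complex"]
  by (simp add: vimage_def inj_of_real)

lemma nonneg_off_finite:
  fixes h :: "real \<Rightarrow> real"
  assumes "isCont h t0" "open D" "t0 \<in> D" "finite S" "\<And>t. t \<in> D \<Longrightarrow> t \<notin> S \<Longrightarrow> h t \<ge> 0"
  shows "h t0 \<ge> 0"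
proof -
  have "eventually (\<lambda>t. t \<in> D - (S - {t0})) (at t0)"
    by (rule eventually_at_in_open') (use assms in \<open>auto intro: open_Diff finite_imp_closed\<close>)
  moreover have "eventually (\<lambda>t. t \<noteq> t0) (at t0)" by (rule eventually_neq_at_within)
  ultimately have "eventually (\<lambda>t. h t \<ge> 0) (at t0)" by eventually_elim (use assms(5) in auto)
  moreover have "(h \<longlongrightarrow> h t0) (at t0)" using assms(1) by (simp add: isCont_def)
  ultimately show ?thesis by (intro tendsto_lowerbound) auto
qed

text \<open>Where \<open>P\<close> vanishes the quotient \<open>F / P\<close> is the junk value \<open>0\<close>, so a bound on it only
  bounds \<open>F\<close> off the zero set; the zero set is nowhere dense.\<close>

lemma bound_by_eval2:
  fixes F :: "complex \<Rightarrow> complex \<Rightarrow> complex"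
  assumes P: "P \<noteq> 0"
    and F: "continuous_on UNIV (\<lambda>z :: real \<times> real. F (of_real (fst z)) (of_real (snd z)))"
    and bound: "\<And>s t :: real. 0 < s\<^sup>2 + t\<^sup>2 \<Longrightarrow> s\<^sup>2 + t\<^sup>2 < e\<^sup>2 \<Longrightarrow>
      norm (F (of_real s) (of_real t) / eval2 P (of_real s) (of_real t)) \<le> C"
    and st: "0 < s\<^sup>2 + t\<^sup>2" "s\<^sup>2 + t\<^sup>2 < e\<^sup>2"
  shows "norm (F (of_real s) (of_real t)) \<le> C * norm (eval2 P (of_real s) (of_real t))"
proof -
  define h where "h = (\<lambda>(s :: real) (t :: real). C * norm (eval2 P (of_real s) (of_real t)) - norm (F (of_real s) (of_real t)))"
  have Fc: "isCont (\<lambda>z :: real \<times> real. F (of_real (fst z)) (of_real (snd z))) z" for z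
    using F continuous_on_eq_continuous_at[OF open_UNIV] by blast
  have ct: "isCont (\<lambda>t. h s t) t" and cs: "isCont (\<lambda>s. h s t) s" for s t
  proof -
    have "isCont (\<lambda>t. F (of_real s) (of_real t)) t"
      using isCont_o2[where f = "\<lambda>t. (s, t)" and a = t, OF _ Fc] by (auto intro: continuous_intros)
    then show "isCont (\<lambda>t. h s t) t" unfolding h_def
      by (intro continuous_intros isCont_eval2)
    have "isCont (\<lambda>s. F (of_real s) (of_real t)) s"
      using isCont_o2[where f = "\<lambda>s. (s, t)" and a = s, OF _ Fc] by (auto intro: continuous_intros)
    then show "isCont (\<lambda>s. h s t) s" unfolding h_def
      by (intro continuous_intros isCont_eval2)
  qed
  have h0: "h s t \<ge> 0" if "0 < s\<^sup>2 + t\<^sup>2" "s\<^sup>2 + t\<^sup>2 < e\<^sup>2" "eval2 P (of_real s) (of_real t) \<noteq> 0" for s t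
    using bound[OF that(1,2)] that(3) by (simp add: h_def norm_divide divide_le_eq split: if_splits)
  \<comment> \<open>For real \<open>s\<close> at which the leading coefficient in \<open>y\<close>
    is nonzero, \<open>P\<close> has finitely many real zeros on the vertical line over
    \<open>s\<close>, so continuity in \<open>t\<close> extends the bound to them. The finitely many
    other \<open>s\<close> are then reached by continuity in \<open>s\<close>.\<close>
  have h1: "h s t \<ge> 0" if st: "0 < s\<^sup>2 + t\<^sup>2" "s\<^sup>2 + t\<^sup>2 < e\<^sup>2" and s: "poly (lead_coeff P) (of_real s) \<noteq> 0" for s t
  proof (rule nonneg_off_finite[OF ct, of "{t. 0 < s\<^sup>2 + t\<^sup>2 \<and> s\<^sup>2 + t\<^sup>2 < e\<^sup>2}"])
    define R where "R = (\<Sum>i\<le>degree P. monom (poly (coeff P i) (of_real s)) i)"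
    have R: "poly R w = eval2 P (of_real s) w" for w
      by (simp add: R_def eval2_altdef poly_sum poly_monom)
    have "coeff R (degree P) = poly (lead_coeff P) (of_real s)"
      by (simp add: R_def coeff_sum)
    then have "R \<noteq> 0" using s by auto
    then show "finite {t :: real. poly R (of_real t) = 0}" by (rule finite_real_roots)
    show "open {t. 0 < s\<^sup>2 + t\<^sup>2 \<and> s\<^sup>2 + t\<^sup>2 < e\<^sup>2}"
      by (intro open_Collect_conj open_Collect_less continuous_intros)
    show "h s u \<ge> 0" if "u \<in> {t. 0 < s\<^sup>2 + t\<^sup>2 \<and> s\<^sup>2 + t\<^sup>2 < e\<^sup>2}" "u \<notin> {t. poly R (of_real t) = 0}" for u
      using h0[of s u] that by (simp add: R)
  qed (use st in auto)
  have "h s t \<ge> 0"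
  proof (rule nonneg_off_finite[OF cs, of "{s. 0 < s\<^sup>2 + t\<^sup>2 \<and> s\<^sup>2 + t\<^sup>2 < e\<^sup>2}"])
    show "finite {s :: real. poly (lead_coeff P) (of_real s) = 0}" using P by (intro finite_real_roots) simp
    show "open {s. 0 < s\<^sup>2 + t\<^sup>2 \<and> s\<^sup>2 + t\<^sup>2 < e\<^sup>2}"
      by (intro open_Collect_conj open_Collect_less continuous_intros)
  qed (use st h1 in auto)
  then show ?thesis by (simp add: h_def)
qed

lemma sum_symmetric_pairs:
  fixes c :: "nat \<Rightarrow> nat \<Rightarrow> nat"
  assumes sym: "\<And>j k. c j k = c k j"
  shows "(\<Sum>k\<in>{1..M}. \<Sum>l\<in>{1..M}. c k l) = 2 * (\<Sum>(j, k) \<in> {(j, k). 1 \<le> j \<and> j < k \<and> k \<le> M}. c j k) + (\<Sum>k\<in>{1..M}. c k k)"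
proof -
  let ?U = "{(j, k). 1 \<le> j \<and> j < k \<and> k \<le> M}"
  let ?V = "{(j, k). 1 \<le> k \<and> k < j \<and> j \<le> M}"
  let ?D = "(\<lambda>k. (k, k)) ` {1..M}"
  have fin: "finite ?U" "finite ?V" "finite ?D"
    by (auto intro: finite_subset[of _ "{1..M} \<times> {1..M}"])
  have "(\<Sum>k\<in>{1..M}. \<Sum>l\<in>{1..M}. c k l) = (\<Sum>(k, l)\<in>{1..M} \<times> {1..M}. c k l)"
    by (rule sum.cartesian_product)
  also have "{1..M} \<times> {1..M} = (?U \<union> ?V) \<union> ?D" by auto
  also have "(\<Sum>(k, l)\<in>(?U \<union> ?V) \<union> ?D. c k l) = (\<Sum>(k, l)\<in>?U \<union> ?V. c k l) + (\<Sum>(k, l)\<in>?D. c k l)"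
    using fin by (intro sum.union_disjoint) auto
  also have "(\<Sum>(k, l)\<in>?U \<union> ?V. c k l) = (\<Sum>(k, l)\<in>?U. c k l) + (\<Sum>(k, l)\<in>?V. c k l)"
    using fin by (intro sum.union_disjoint) auto
  also have "(\<Sum>(k, l)\<in>?V. c k l) = (\<Sum>(k, l)\<in>?U. c k l)"
    by (rule sum.reindex_bij_witness[of _ prod.swap prod.swap]) (auto simp: sym)
  also have "(\<Sum>(k, l)\<in>?D. c k l) = (\<Sum>k\<in>{1..M}. c k k)"
    by (subst sum.reindex) (auto simp: inj_on_def)
  finally show ?thesis by simp
qed

theorem theorem1p7:
  fixes P :: "complex poly poly" and L :: "nat \<Rightarrow> nat" and q :: "nat \<Rightarrow> real poly"
    and p :: real
  defines "M \<equiv> vanishing_order P"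
  assumes noH2: "\<forall>x y. Im x > 0 \<longrightarrow> Im y > 0 \<longrightarrow> eval2 P x y \<noteq> 0"
    and P00: "eval2 P 0 0 = 0"
    and coprime: "coprime P (conj2 P)"
    and q0: "\<forall>j\<in>{1..M}. poly (q j) 0 = 0"
    and qd: "\<forall>j\<in>{1..M}. poly (pderiv (q j)) 0 > 0"
    and qdeg: "\<forall>j\<in>{1..M}. degree (q j) < 2 * L j"
    and bdd: "\<exists>e>0. \<exists>C. \<forall>s t :: real. 0 < s\<^sup>2 + t\<^sup>2 \<and> s\<^sup>2 + t\<^sup>2 < e\<^sup>2 \<longrightarrow>
                norm (eval2 P (of_real s) (of_real t) / bracketP M L q (of_real s) (of_real t)) \<le> C \<and>
                norm (bracketP M L q (of_real s) (of_real t) / eval2 P (of_real s) (of_real t)) \<le> C"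
    and p: "1 \<le> p"
  shows "(\<exists>n. quot_dim_is (Ip p (eval2 P)) (ideal2 (bracketP M L q) (conj_fun (bracketP M L q))) n \<and>
             int n = (\<Sum>(j, k) \<in> {(j, k). 1 \<le> j \<and> j < k \<and> k \<le> M}. int (Omin (q k - q j) (2 * L j) (2 * L k)))
                     + (\<Sum>k=1..M. \<lceil>(2 * real (L k) + 1) / p\<rceil> - 1)) \<and>
           quot_dim_is (Iinf (eval2 P)) (ideal2 (bracketP M L q) (conj_fun (bracketP M L q)))
             (\<Sum>(j, k) \<in> {(j, k). 1 \<le> j \<and> j < k \<and> k \<le> M}. Omin (q k - q j) (2 * L j) (2 * L k))"
proof -
  \<comment> \<open>Positivity of \<open>L\<close> comes from the degree bound, since no degree is
    below 0.\<close>
  interpret branches "{1..M}" L q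
    by standard (use q0 qdeg in fastforce)+
  define F where "F = bracketP M L q"
  define T where "T = (\<Sum>(j, k) \<in> {(j, k). 1 \<le> j \<and> j < k \<and> k \<le> M}. contact j k)"
  have T: "(\<Sum>k\<in>{1..M}. \<Sum>l\<in>{1..M}. contact k l) = 2 * T + (\<Sum>k\<in>{1..M}. contact k k)"
    unfolding T_def by (rule sum_symmetric_pairs) (rule contact_commute)
  have Feq: "ell_prod ks = F" if "distinct ks" "set ks = {1..M}" for ks
    using that by (simp add: fun_eq_iff F_def bracketP_def ell_prod_set ell_def qc_def)
  have cnjq: "cnj (poly (map_poly complex_of_real f) (cnj x)) = poly (map_poly complex_of_real f) x" for f x
    by (induction f) (auto simp: map_poly_pCons)
  have Geq: "conj_fun F = G"
    unfolding fun_eq_iff conj_fun_def F_def bracketP_def G_def ell_bar_def qc_def by (simp add: cnjq)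
  \<comment> \<open>Any enumeration transports facts about \<open>ell_prod\<close> to
    \<open>F\<close>. The greedy orderings come later and may differ between finite and infinite
    exponents.\<close>
  obtain ks0 where "distinct ks0" "set ks0 = {1..M}"
    using finite_distinct_list[of "{1..M}"] by auto
  note ks0 = Feq[OF this] this
  have Fne: "F (of_real x) (of_real y) \<noteq> 0" if "(x, y) \<noteq> (0, 0)" for x y :: real
    using ell_prod_nonzero[OF _ that, of ks0] ks0 by simp
  have Fcont: "continuous_on UNIV (\<lambda>z :: real \<times> real. F (of_real (fst z)) (of_real (snd z)))"
    using continuous_ell_prod[of ks0] ks0 by simp
  have Fm: "real_measurable F" by (rule borel_measurable_continuous_onI[OF Fcont])
  have Pm: "real_measurable (eval2 P)"
    by (intro borel_measurable_continuous_onI continuous_eval2 continuous_intros)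
  \<comment> \<open>The zero polynomial equals its conjugate and is not coprime to itself.\<close>
  have "P \<noteq> 0" using coprime by (auto simp: conj2_def)
  obtain e C where e: "e > 0" and bnd: "\<And>s t :: real. 0 < s\<^sup>2 + t\<^sup>2 \<Longrightarrow> s\<^sup>2 + t\<^sup>2 < e\<^sup>2 \<Longrightarrow>
      norm (eval2 P (of_real s) (of_real t) / F (of_real s) (of_real t)) \<le> C"
     "\<And>s t :: real. 0 < s\<^sup>2 + t\<^sup>2 \<Longrightarrow> s\<^sup>2 + t\<^sup>2 < e\<^sup>2 \<Longrightarrow>
      norm (F (of_real s) (of_real t) / eval2 P (of_real s) (of_real t)) \<le> C"
    using bdd unfolding F_def by blast
  \<comment> \<open>The square of half side \<open>e / 2\<close> lies in the disc of radius
    \<open>e\<close>. That \<open>P\<close> has no real zeros there except possibly the origin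
    follows from the bound on \<open>F\<close>, which is nonzero off the origin.\<close>
  have cmp: "norm (F (of_real x) (of_real y)) \<le> C * norm (eval2 P (of_real x) (of_real y))"
    "norm (eval2 P (of_real x) (of_real y)) \<le> C * norm (F (of_real x) (of_real y))"
    "eval2 P (of_real x) (of_real y) \<noteq> 0"
    if xy: "(x, y) \<noteq> (0, 0)" "\<bar>x\<bar> < e / 2" "\<bar>y\<bar> < e / 2" for x y :: real
  proof -
    have "x\<^sup>2 < (e/2)\<^sup>2" "y\<^sup>2 < (e/2)\<^sup>2" using xy e by (auto simp: abs_square_less_1 power2_abs intro!: power2_strict_mono)
    then have "4 * x\<^sup>2 < e\<^sup>2" "4 * y\<^sup>2 < e\<^sup>2" by (simp_all add: power_divide)
    then have lt: "x\<^sup>2 + y\<^sup>2 < e\<^sup>2" using zero_le_power2[of e] by linarith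
    have gt: "0 < x\<^sup>2 + y\<^sup>2" using xy(1) by (simp add: sum_power2_gt_zero_iff)
    show 1: "norm (F (of_real x) (of_real y)) \<le> C * norm (eval2 P (of_real x) (of_real y))"
      by (rule bound_by_eval2[OF \<open>P \<noteq> 0\<close> Fcont bnd(2) gt lt])
    show "norm (eval2 P (of_real x) (of_real y)) \<le> C * norm (F (of_real x) (of_real y))"
      using bnd(1)[OF gt lt] Fne[OF xy(1)] by (simp add: norm_divide divide_le_eq)
    show "eval2 P (of_real x) (of_real y) \<noteq> 0" using 1 Fne[OF xy(1)] by auto
  qed
  have e2: "e / 2 > 0" using e by simp
  have r1: "norm (ratio_real Q (eval2 P) (x, y)) \<le> C * norm (ratio_real Q F (x, y))"
    and r2: "norm (ratio_real Q F (x, y)) \<le> C * norm (ratio_real Q (eval2 P) (x, y))"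
    if "(x, y) \<noteq> (0, 0)" "\<bar>x\<bar> < e / 2" "\<bar>y\<bar> < e / 2" for Q x y
  proof -
    have div: "n / b \<le> C * (n / a)" if "a \<le> C * b" "a > 0" "b > 0" "n \<ge> 0" for n a b :: real
      using mult_left_mono[OF that(1,4)] that by (simp add: field_simps)
    show "norm (ratio_real Q (eval2 P) (x, y)) \<le> C * norm (ratio_real Q F (x, y))"
      "norm (ratio_real Q F (x, y)) \<le> C * norm (ratio_real Q (eval2 P) (x, y))"
      unfolding ratio_real_def fst_conv snd_conv norm_divide
      by (rule div; use cmp[OF that] Fne[OF that(1)] in simp)+
  qed
  have IpF: "Ip p (eval2 P) = Ip p F"
    using ratio_compare(1)[OF _ Pm Fm e2 r1, of _ p] ratio_compare(1)[OF _ Fm Pm e2 r2, of _ p] p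
    unfolding Ip_def by auto
  have IinfF: "Iinf (eval2 P) = Iinf F"
    using ratio_compare(2)[OF _ Pm Fm e2 r1] ratio_compare(2)[OF _ Fm Pm e2 r2]
    unfolding Iinf_def by auto
  define c where "c = (\<lambda>k. \<lceil>(2 * real (L k) + 1) / p\<rceil>)"
  \<comment> \<open>Truncation by \<open>nat\<close> is exact because
    \<open>1 \<le> c k \<le> 2 L k + 1\<close>. The choice makes
    \<open>2 L k - m k = c k - 1\<close>, the contribution of the branch to the formula.\<close>
  define m where "m = (\<lambda>k. nat (2 * int (L k) + 1 - c k))"
  have c1: "c k \<ge> 1" for k
  proof -
    have "(2 * real (L k) + 1) / p > 0" using p by simp
    then show ?thesis unfolding c_def by linarith
  qed
  have c2: "c k \<le> 2 * int (L k) + 1" for k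
  proof -
    have "(2 * real (L k) + 1) / p \<le> (2 * real (L k) + 1) / 1" using p by (intro divide_left_mono) auto
    then show ?thesis unfolding c_def by (simp add: ceiling_le_iff)
  qed
  have mc: "real (m k) = 2 * real (L k) + 1 - of_int (c k)" for k
    using c2[of k] by (simp add: m_def)
  have mle: "m k \<le> 2 * L k" for k using c1[of k] by (simp add: m_def)
  \<comment> \<open>This and \<open>clt\<close> are the two inequalities defining the ceiling. In
    terms of \<open>m k\<close> they say that \<open>m k - 1\<close> misses the integrability
    threshold and \<open>m k\<close> meets it.\<close>
  have cge: "(2 * real (L k) + 1) \<le> p * of_int (c k)" for k
  proof -
    have "(2 * real (L k) + 1) / p \<le> of_int (c k)" unfolding c_def by (rule le_of_int_ceiling)
    then show ?thesis using p by (simp add: field_simps)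
  qed
  have clt: "p * (of_int (c k) - 1) < 2 * real (L k) + 1" for k
  proof -
    have "of_int (c k) - 1 < (2 * real (L k) + 1) / p" unfolding c_def using ceiling_correct by blast
    then show ?thesis using p by (simp add: field_simps)
  qed
  obtain ks where ks: "distinct ks" "set ks = {1..M}" "greedy m ks" using greedy_exists[of "{1..M}" m] by auto
  have "quot_dim_is (Ip p (ell_prod ks)) (ideal2 (ell_prod ks) G) (\<Sum>k\<in>{1..M}. total_contact k - lead_ord m ks k)"
  proof (rule quot_dim_Ip[OF ks p])
    fix k
    show "p * (real (m k) - 2 * real (L k)) + 2 * real (L k) > -1"
      using clt[of k] unfolding mc by (simp add: algebra_simps)
    show "p * (real (m k) - 1 - 2 * real (L k)) + 2 * real (L k) \<le> -1"
      using cge[of k] unfolding mc by (simp add: algebra_simps)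
  qed (rule mle)
  then have dimp: "quot_dim_is (Ip p F) (ideal2 F G) (T + (\<Sum>k\<in>{1..M}. 2 * L k - m k))"
    unfolding Feq[OF ks(1,2)] sum_total_minus_lead[OF ks(1,2) mle T] .
  have "int (2 * L k - m k) = c k - 1" for k using c1[of k] c2[of k] by (simp add: m_def)
  then have count: "int (T + (\<Sum>k\<in>{1..M}. 2 * L k - m k)) = (\<Sum>(j, k) \<in> {(j, k). 1 \<le> j \<and> j < k \<and> k \<le> M}. int (contact j k)) + (\<Sum>k=1..M. c k - 1)"
    by (simp add: T_def case_prod_unfold)
  obtain ls where ls: "distinct ls" "set ls = {1..M}" "greedy (\<lambda>k. 2 * L k) ls"
    using greedy_exists[of "{1..M}" "\<lambda>k. 2 * L k"] by auto
  \<comment> \<open>For \<open>m = 2 L\<close> the contributions \<open>2 L k - m k\<close> of the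
    single branches vanish and only the contacts between distinct branches remain.\<close>
  have diminf: "quot_dim_is (Iinf F) (ideal2 F G) T"
    using quot_dim_Iinf[OF ls] unfolding Feq[OF ls(1,2)] sum_total_minus_lead[OF ls(1,2) order_refl T] by simp
  show ?thesis
    unfolding F_def[symmetric] Geq IpF IinfF
    using dimp count diminf unfolding T_def contact_def c_def by blast
qed

end
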